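(* Let $(\mathcal{M},\tau)$ be a finite von Neumann algebra with first order differential structure $(\mathcal{A},\mathcal{H},l,r,\partial)$, and let $\|\cdot\|_L$ be a norm on $\partial(\mathcal{A})$, $L(x)=\|\partial x\|_L$ for $x\in\mathcal{A}$, and $\mathcal{H}_L$ the completion of $\partial(\mathcal{A})$ under $\|\cdot\|_L$. Let $\mathcal{P}:\mathcal{M}\to\mathcal{M}$ be a quantum channel and suppose $\partial\mathcal{P}=\hat{\mathcal{P}}\partial$ (on $\mathcal{A}$) for some linear map $\hat{\mathcal{P}}:\mathcal{H}\to\mathcal{H}$. Then for all $x\in\mathcal{A}$, $$L(\mathcal{P}(x))\le\|\hat{\mathcal{P}}:\mathcal{H}_L\to\mathcal{H}_L\|\,L(x).$$ In particular, if $\mathcal{H}=L_2(\hat{\mathcal{M}})$ for some finite von Neumann algebra $(\hat{\mathcal{M}},\tau)$ containing $\mathcal{M}$ with induced trace, with $l(x)\xi=x\xi$ and $r(x)\xi=\xi x$, and $\hat{\mathcal{P}}$ is a completely positive and trace-symmetric map, then for $1\le p\le\infty$, $$\|\mathcal{P}(x)\|_{\partial,p}\le\|\hat{\mathcal{P}}(1)\|\,\|x\|_{\partial,p},\qquad\text{where }\|x\|_{\partial,p}:=\|\partial x\|_{L_p(\hat{\mathcal{M}})}.$$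
   Context: A quantum channel is a normal unital completely positive map. A first order differential structure on $\mathcal{M}$ consists of a weak$^*$-dense subalgebra $\mathcal{A}\subset\mathcal{M}$, a Hilbert space $\mathcal{H}$, commuting non-degenerate $*$-homomorphisms $l:\mathcal{M}\to\mathcal{B}(\mathcal{H})$, $r:\mathcal{M}^{\mathrm{op}}\to\mathcal{B}(\mathcal{H})$, and a closed derivation $\partial:\mathcal{A}\to\mathcal{H}$ with $\partial(xy)=l(x)\partial y+r(y)\partial x$. The relation $\partial\mathcal{P}=\hat{\mathcal{P}}\partial$ includes $\mathcal{P}(\mathcal{A})\subset\mathcal{A}$; the operator norm of $\hat{\mathcal{P}}$ on $\mathcal{H}_L$ is that of its restriction to $\partial(\mathcal{A})$ and may be infinite. Trace-symmetric: $\tau(\hat{\mathcal{P}}(x)y)=\tau(x\hat{\mathcal{P}}(y))$. $L_p$-norms are $\|a\|_p=\tau(|a|^p)^{1/p}$, with $p=\infty$ the operator norm, and take the value $\infty$ when not finite. *)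

theory Defs
  imports "HOL-Analysis.Analysis" "HOL-Computational_Algebra.Polynomial"
begin

section \<open>Complex Hilbert spaces\<close>

text \<open>The inner product is conjugate-linear in its first argument. Positive definiteness follows
  from \<open>norm_eq_sqrt_cinner\<close>, since the norm is nonnegative and vanishes only at 0.\<close>

class complex_hilbert = banach +
  fixes scaleC :: "complex \<Rightarrow> 'a \<Rightarrow> 'a"  (infixr \<open>*\<^sub>C\<close> 75)
    and cinner :: "'a \<Rightarrow> 'a \<Rightarrow> complex"
  assumes scaleC_add_right: "c *\<^sub>C (x + y) = c *\<^sub>C x + c *\<^sub>C y"
    and scaleC_add_left: "(b + c) *\<^sub>C x = b *\<^sub>C x + c *\<^sub>C x"
    and scaleC_scaleC: "b *\<^sub>C c *\<^sub>C x = (b * c) *\<^sub>C x"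
    and scaleR_scaleC: "r *\<^sub>R x = complex_of_real r *\<^sub>C x"
    and cinner_commute: "cinner x y = cnj (cinner y x)"
    and cinner_add_right: "cinner x (y + z) = cinner x y + cinner x z"
    and cinner_scaleC_right: "cinner x (c *\<^sub>C y) = c * cinner x y"
    and norm_eq_sqrt_cinner: "norm x = sqrt (Re (cinner x x))"

instantiation complex :: complex_hilbert
begin

definition scaleC_complex :: "complex \<Rightarrow> complex \<Rightarrow> complex"
  where "scaleC_complex c z = c * z"

definition cinner_complex :: "complex \<Rightarrow> complex \<Rightarrow> complex"
  where "cinner_complex z w = cnj z * w"

instance
  by standard
    (auto simp: scaleC_complex_def cinner_complex_def algebra_simps scaleR_conv_of_real cmod_def
      power2_eq_square)

end


section \<open>Bounded operators\<close>

text \<open>Operators are plain functions; all operator-theoretic predicates below are relative to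
  \<open>bounded_op\<close>. The product is composition, the unit is \<open>id\<close>, the operator norm is \<open>onorm\<close>.\<close>

definition complex_linear :: "('a::complex_hilbert \<Rightarrow> 'b::complex_hilbert) \<Rightarrow> bool"
  where "complex_linear T \<longleftrightarrow>
    (\<forall>v w. T (v + w) = T v + T w) \<and> (\<forall>c v. T (c *\<^sub>C v) = c *\<^sub>C T v)"

definition bounded_op :: "('a::complex_hilbert \<Rightarrow> 'a) \<Rightarrow> bool"
  where "bounded_op T \<longleftrightarrow> complex_linear T \<and> bounded_linear T"

definition cadjoint :: "('a::complex_hilbert \<Rightarrow> 'a) \<Rightarrow> ('a \<Rightarrow> 'a)"
  where "cadjoint T = (THE S. \<forall>v w. cinner (S v) w = cinner v (T w))"

definition pos_op :: "('a::complex_hilbert \<Rightarrow> 'a) \<Rightarrow> bool"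
  where "pos_op T \<longleftrightarrow> bounded_op T \<and> (\<forall>v. cinner v (T v) \<in> \<real>\<^sub>\<ge>\<^sub>0)"

definition op_le :: "('a::complex_hilbert \<Rightarrow> 'a) \<Rightarrow> ('a \<Rightarrow> 'a) \<Rightarrow> bool"
  where "op_le S T \<longleftrightarrow> pos_op (\<lambda>v. T v - S v)"

definition op_abs :: "('a::complex_hilbert \<Rightarrow> 'a) \<Rightarrow> ('a \<Rightarrow> 'a)"
  where "op_abs T = (THE S. pos_op S \<and> S \<circ> S = cadjoint T \<circ> T)"

definition poly_op :: "real poly \<Rightarrow> ('a::complex_hilbert \<Rightarrow> 'a) \<Rightarrow> ('a \<Rightarrow> 'a)"
  where "poly_op q T = (\<lambda>v. \<Sum>i\<le>degree q. coeff q i *\<^sub>R (T ^^ i) v)"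

text \<open>Continuous functional calculus for a positive operator \<open>T\<close>, whose spectrum lies in
  \<open>{0..onorm T}\<close>: \<open>f(T)\<close> is the norm limit of \<open>q\<^sub>n(T)\<close> for polynomials \<open>q\<^sub>n\<close> converging to \<open>f\<close>
  uniformly on that interval.\<close>

definition pos_cfc :: "(real \<Rightarrow> real) \<Rightarrow> ('a::complex_hilbert \<Rightarrow> 'a) \<Rightarrow> ('a \<Rightarrow> 'a)"
  where "pos_cfc f T = (THE S. bounded_op S \<and>
    (\<forall>q. uniform_limit {0..onorm T} (\<lambda>n. poly (q n)) f sequentially \<longrightarrow>
         (\<lambda>n. onorm (\<lambda>v. poly_op (q n) T v - S v)) \<longlonglongrightarrow> 0))"

definition op_powr :: "('a::complex_hilbert \<Rightarrow> 'a) \<Rightarrow> real \<Rightarrow> ('a \<Rightarrow> 'a)"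
  where "op_powr T p = pos_cfc (\<lambda>t. t powr p) T"


section \<open>Finite von Neumann algebras\<close>

definition commutant :: "('a::complex_hilbert \<Rightarrow> 'a) set \<Rightarrow> ('a \<Rightarrow> 'a) set"
  where "commutant M = {T. bounded_op T \<and> (\<forall>S\<in>M. T \<circ> S = S \<circ> T)}"

definition von_neumann_algebra :: "('a::complex_hilbert \<Rightarrow> 'a) set \<Rightarrow> bool"
  where "von_neumann_algebra M \<longleftrightarrow>
    (\<forall>T\<in>M. bounded_op T \<and> cadjoint T \<in> M) \<and> commutant (commutant M) = M"

definition linear_on_ops ::
    "('a::complex_hilbert \<Rightarrow> 'a) set \<Rightarrow> (('a \<Rightarrow> 'a) \<Rightarrow> 'b::complex_hilbert) \<Rightarrow> bool"
  where "linear_on_ops V f \<longleftrightarrow>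
    (\<forall>S\<in>V. \<forall>T\<in>V. f (\<lambda>v. S v + T v) = f S + f T) \<and>
    (\<forall>c. \<forall>T\<in>V. f (\<lambda>v. c *\<^sub>C T v) = c *\<^sub>C f T)"

definition directed_ops :: "('a::complex_hilbert \<Rightarrow> 'a) set \<Rightarrow> bool"
  where "directed_ops D \<longleftrightarrow> D \<noteq> {} \<and> (\<forall>S\<in>D. \<forall>T\<in>D. \<exists>U\<in>D. op_le S U \<and> op_le T U)"

definition op_lub ::
    "('a::complex_hilbert \<Rightarrow> 'a) set \<Rightarrow> ('a \<Rightarrow> 'a) set \<Rightarrow> ('a \<Rightarrow> 'a) \<Rightarrow> bool"
  where "op_lub M D S \<longleftrightarrow> S \<in> M \<and> (\<forall>T\<in>D. op_le T S) \<and>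
    (\<forall>U\<in>M. (\<forall>T\<in>D. op_le T U) \<longrightarrow> op_le S U)"

text \<open>Normality is preservation of suprema of bounded upward directed sets of self-adjoint elements.
  A finite von Neumann algebra carries a finite faithful normal trace \<open>\<tau>\<close>; the normalization
  \<open>\<tau> id = 1\<close> is not required.\<close>

definition finite_von_neumann_algebra ::
    "('a::complex_hilbert \<Rightarrow> 'a) set \<Rightarrow> (('a \<Rightarrow> 'a) \<Rightarrow> complex) \<Rightarrow> bool"
  where "finite_von_neumann_algebra M \<tau> \<longleftrightarrow>
    von_neumann_algebra M \<and>
    linear_on_ops M \<tau> \<and>
    (\<forall>T\<in>M. pos_op T \<longrightarrow> \<tau> T \<in> \<real>\<^sub>\<ge>\<^sub>0) \<and>
    (\<forall>T\<in>M. pos_op T \<and> \<tau> T = 0 \<longrightarrow> T = (\<lambda>v. 0)) \<and>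
    (\<forall>S\<in>M. \<forall>T\<in>M. \<tau> (S \<circ> T) = \<tau> (T \<circ> S)) \<and>
    (\<forall>D S. D \<subseteq> {T \<in> M. cadjoint T = T} \<and> directed_ops D \<and> op_lub M D S \<longrightarrow>
       (SUP T\<in>D. Re (\<tau> T)) = Re (\<tau> S))"

definition ultraweak_topology :: "('a::complex_hilbert \<Rightarrow> 'a) topology"
  where "ultraweak_topology = topology_generated_by
    {{T. bounded_op T \<and> (\<Sum>n. cinner (a n) (T (b n))) \<in> U} | a b U.
      summable (\<lambda>n. (norm (a n))\<^sup>2) \<and> summable (\<lambda>n. (norm (b n))\<^sup>2) \<and> open U}"


section \<open>Completely positive maps\<close>

text \<open>Positivity of the matrix \<open>(X i j)\<close> as an operator on the \<open>n\<close>-fold direct sum.\<close>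

definition pos_op_matrix :: "nat \<Rightarrow> (nat \<Rightarrow> nat \<Rightarrow> 'a::complex_hilbert \<Rightarrow> 'a) \<Rightarrow> bool"
  where "pos_op_matrix n X \<longleftrightarrow>
    (\<forall>v. (\<Sum>i<n. \<Sum>j<n. cinner (v i) (X i j (v j))) \<in> \<real>\<^sub>\<ge>\<^sub>0)"

definition completely_positive ::
    "('a::complex_hilbert \<Rightarrow> 'a) set \<Rightarrow> (('a \<Rightarrow> 'a) \<Rightarrow> ('a \<Rightarrow> 'a)) \<Rightarrow> bool"
  where "completely_positive M P \<longleftrightarrow>
    (\<forall>T\<in>M. P T \<in> M) \<and>
    (\<forall>v. linear_on_ops M (\<lambda>T. P T v)) \<and>
    (\<forall>n X. (\<forall>i<n. \<forall>j<n. X i j \<in> M) \<and> pos_op_matrix n X \<longrightarrow>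
       pos_op_matrix n (\<lambda>i j. P (X i j)))"

definition quantum_channel ::
    "('a::complex_hilbert \<Rightarrow> 'a) set \<Rightarrow> (('a \<Rightarrow> 'a) \<Rightarrow> ('a \<Rightarrow> 'a)) \<Rightarrow> bool"
  where "quantum_channel M P \<longleftrightarrow>
    completely_positive M P \<and>
    P id = id \<and>
    (\<forall>D S. D \<subseteq> {T \<in> M. cadjoint T = T} \<and> directed_ops D \<and> op_lub M D S \<longrightarrow>
       op_lub M (P ` D) (P S))"

definition trace_symmetric ::
    "('a::complex_hilbert \<Rightarrow> 'a) set \<Rightarrow> (('a \<Rightarrow> 'a) \<Rightarrow> complex) \<Rightarrow> (('a \<Rightarrow> 'a) \<Rightarrow> ('a \<Rightarrow> 'a)) \<Rightarrow> bool"
  where "trace_symmetric M \<tau> P \<longleftrightarrow> (\<forall>S\<in>M. \<forall>T\<in>M. \<tau> (P S \<circ> T) = \<tau> (S \<circ> P T))"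


section \<open>First order differential structures\<close>

text \<open>Non-degenerate \<open>*\<close>-representation of \<open>M\<close> with product \<open>mul\<close>: composition for \<open>M\<close> itself, reversed
  composition for the opposite algebra.\<close>

definition nondegenerate_star_rep ::
    "('a::complex_hilbert \<Rightarrow> 'a) set \<Rightarrow> (('a \<Rightarrow> 'a) \<Rightarrow> ('a \<Rightarrow> 'a) \<Rightarrow> ('a \<Rightarrow> 'a)) \<Rightarrow>
     (('a \<Rightarrow> 'a) \<Rightarrow> ('h::complex_hilbert \<Rightarrow> 'h)) \<Rightarrow> bool"
  where "nondegenerate_star_rep M mul \<pi> \<longleftrightarrow>
    (\<forall>x\<in>M. bounded_op (\<pi> x)) \<and>
    (\<forall>\<xi>. linear_on_ops M (\<lambda>x. \<pi> x \<xi>)) \<and>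
    (\<forall>x\<in>M. \<forall>y\<in>M. \<pi> (mul x y) = \<pi> x \<circ> \<pi> y) \<and>
    (\<forall>x\<in>M. \<pi> (cadjoint x) = cadjoint (\<pi> x)) \<and>
    closure (span {\<pi> x \<xi> | x \<xi>. x \<in> M}) = UNIV"

definition weak_star_dense_subalgebra ::
    "('a::complex_hilbert \<Rightarrow> 'a) set \<Rightarrow> ('a \<Rightarrow> 'a) set \<Rightarrow> bool"
  where "weak_star_dense_subalgebra M A \<longleftrightarrow>
    A \<subseteq> M \<and> (\<lambda>v. 0) \<in> A \<and>
    (\<forall>x\<in>A. \<forall>y\<in>A. (\<lambda>v. x v + y v) \<in> A \<and> x \<circ> y \<in> A) \<and>
    (\<forall>c. \<forall>x\<in>A. (\<lambda>v. c *\<^sub>C x v) \<in> A) \<and>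
    M \<subseteq> ultraweak_topology closure_of A"

text \<open>The derivation is closed as an operator on \<open>M\<close> with the operator norm and domain \<open>A\<close>. This is implied
  by closedness with respect to the \<open>L\<^sub>2\<close>-norm or to the weak-star topology of \<open>M\<close>, both of
  which are coarser.\<close>

definition first_order_differential_structure ::
    "('a::complex_hilbert \<Rightarrow> 'a) set \<Rightarrow> ('a \<Rightarrow> 'a) set \<Rightarrow>
     (('a \<Rightarrow> 'a) \<Rightarrow> ('h::complex_hilbert \<Rightarrow> 'h)) \<Rightarrow> (('a \<Rightarrow> 'a) \<Rightarrow> ('h \<Rightarrow> 'h)) \<Rightarrow>
     (('a \<Rightarrow> 'a) \<Rightarrow> 'h) \<Rightarrow> bool"
  where "first_order_differential_structure M A l r \<delta> \<longleftrightarrow>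
    weak_star_dense_subalgebra M A \<and>
    nondegenerate_star_rep M (\<lambda>x y. x \<circ> y) l \<and>
    nondegenerate_star_rep M (\<lambda>x y. y \<circ> x) r \<and>
    (\<forall>x\<in>M. \<forall>y\<in>M. l x \<circ> r y = r y \<circ> l x) \<and>
    linear_on_ops A \<delta> \<and>
    (\<forall>x\<in>A. \<forall>y\<in>A. \<delta> (x \<circ> y) = l x (\<delta> y) + r y (\<delta> x)) \<and>
    (\<forall>X x \<xi>. (\<forall>n. X n \<in> A) \<and> x \<in> M \<and> (\<lambda>n. onorm (\<lambda>v. X n v - x v)) \<longlonglongrightarrow> 0 \<and>
       (\<lambda>n. \<delta> (X n)) \<longlonglongrightarrow> \<xi> \<longrightarrow> x \<in> A \<and> \<delta> x = \<xi>)"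

definition complex_norm_on :: "'h::complex_hilbert set \<Rightarrow> ('h \<Rightarrow> real) \<Rightarrow> bool"
  where "complex_norm_on V N \<longleftrightarrow>
    (\<forall>\<xi>\<in>V. 0 \<le> N \<xi> \<and> (N \<xi> = 0 \<longleftrightarrow> \<xi> = 0)) \<and>
    (\<forall>c. \<forall>\<xi>\<in>V. N (c *\<^sub>C \<xi>) = cmod c * N \<xi>) \<and>
    (\<forall>\<xi>\<in>V. \<forall>\<eta>\<in>V. N (\<xi> + \<eta>) \<le> N \<xi> + N \<eta>)"

text \<open>For \<open>T\<close> mapping \<open>V\<close> into itself this is the (possibly infinite) operator norm on the
  completion of \<open>(V, N)\<close>, as \<open>V\<close> is dense there.\<close>

definition opnorm_on :: "'h::complex_hilbert set \<Rightarrow> ('h \<Rightarrow> real) \<Rightarrow> ('h \<Rightarrow> 'h) \<Rightarrow> ennreal"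
  where "opnorm_on V N T = (SUP \<xi>\<in>{\<xi>\<in>V. N \<xi> \<le> 1}. ennreal (N (T \<xi>)))"

definition intertwines ::
    "('a::complex_hilbert \<Rightarrow> 'a) set \<Rightarrow> (('a \<Rightarrow> 'a) \<Rightarrow> 'h::complex_hilbert) \<Rightarrow>
     (('a \<Rightarrow> 'a) \<Rightarrow> ('a \<Rightarrow> 'a)) \<Rightarrow> ('h \<Rightarrow> 'h) \<Rightarrow> bool"
  where "intertwines A \<delta> P Q \<longleftrightarrow> (\<forall>x\<in>A. P x \<in> A \<and> \<delta> (P x) = Q (\<delta> x))"


section \<open>Noncommutative \<open>L\<^sub>p\<close>\<close>

text \<open>\<open>is_L2 M \<tau> \<Lambda>\<close>: the Hilbert space \<open>'h\<close>, with \<open>\<Lambda>\<close> as canonical embedding of \<open>M\<close>, is \<open>L\<^sub>2(M, \<tau>)\<close>,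
  the completion of \<open>M\<close> for the inner product \<open>\<tau>(x\<^sup>* y)\<close>.\<close>

definition is_L2 ::
    "('a::complex_hilbert \<Rightarrow> 'a) set \<Rightarrow> (('a \<Rightarrow> 'a) \<Rightarrow> complex) \<Rightarrow>
     (('a \<Rightarrow> 'a) \<Rightarrow> 'h::complex_hilbert) \<Rightarrow> bool"
  where "is_L2 M \<tau> \<Lambda> \<longleftrightarrow>
    linear_on_ops M \<Lambda> \<and>
    (\<forall>x\<in>M. \<forall>y\<in>M. cinner (\<Lambda> x) (\<Lambda> y) = \<tau> (cadjoint x \<circ> y)) \<and>
    closure (\<Lambda> ` M) = UNIV"

definition Lp_norm_op :: "(('a::complex_hilbert \<Rightarrow> 'a) \<Rightarrow> complex) \<Rightarrow> real \<Rightarrow> ('a \<Rightarrow> 'a) \<Rightarrow> real"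
  where "Lp_norm_op \<tau> p x = (Re (\<tau> (op_powr (op_abs x) p))) powr (1 / p)"

text \<open>\<open>L\<^sub>p(M)\<close> is the completion of \<open>M\<close> in \<open>Lp_norm_op \<tau> p\<close> for \<open>p < \<infinity>\<close>, and \<open>M\<close> itself for \<open>p = \<infinity>\<close>.
  Inside \<open>L\<^sub>1(M)\<close>, a vector \<open>\<xi>\<close> of \<open>L\<^sub>2(M)\<close> belongs to \<open>L\<^sub>p(M)\<close> iff it is the \<open>L\<^sub>2\<close>-limit of some
  \<open>p\<close>-Cauchy sequence in \<open>M\<close>; its norm is then the limit of the norms, which does not
  depend on the sequence. So both infima below are over at most one number, and
  \<open>Inf {} = \<infinity>\<close> is the value at vectors outside \<open>L\<^sub>p(M)\<close>.\<close>

definition Lp_norm ::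
    "('a::complex_hilbert \<Rightarrow> 'a) set \<Rightarrow> (('a \<Rightarrow> 'a) \<Rightarrow> complex) \<Rightarrow>
     (('a \<Rightarrow> 'a) \<Rightarrow> 'h::complex_hilbert) \<Rightarrow> ennreal \<Rightarrow> 'h \<Rightarrow> ennreal"
  where "Lp_norm M \<tau> \<Lambda> p \<xi> =
    (if p = \<infinity> then Inf {ennreal (onorm x) | x. x \<in> M \<and> \<Lambda> x = \<xi>}
     else Inf {ennreal c | c. \<exists>X. (\<forall>n. X n \<in> M) \<and> (\<lambda>n. \<Lambda> (X n)) \<longlonglongrightarrow> \<xi> \<and>
       (\<forall>e>0. \<exists>k. \<forall>m\<ge>k. \<forall>n\<ge>k. Lp_norm_op \<tau> (enn2real p) (\<lambda>v. X m v - X n v) < e) \<and>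
       (\<lambda>n. Lp_norm_op \<tau> (enn2real p) (X n)) \<longlonglongrightarrow> c})"

definition deriv_Lp_norm ::
    "('a::complex_hilbert \<Rightarrow> 'a) set \<Rightarrow> (('a \<Rightarrow> 'a) \<Rightarrow> complex) \<Rightarrow>
     (('a \<Rightarrow> 'a) \<Rightarrow> 'h::complex_hilbert) \<Rightarrow> (('a \<Rightarrow> 'a) \<Rightarrow> 'h) \<Rightarrow> ennreal \<Rightarrow> ('a \<Rightarrow> 'a) \<Rightarrow> ennreal"
  where "deriv_Lp_norm M \<tau> \<Lambda> \<delta> p x = Lp_norm M \<tau> \<Lambda> p (\<delta> x)"

text \<open>\<open>l\<close> and \<open>r\<close> are left and right multiplication on \<open>L\<^sub>2\<close> of the larger algebra \<open>M'\<close>. As \<open>l x\<close>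
  and \<open>r x\<close> are bounded, they are determined by their values on the dense subspace \<open>\<Lambda> ` M'\<close>.\<close>

definition acts_by_multiplication ::
    "('a::complex_hilbert \<Rightarrow> 'a) set \<Rightarrow> ('a \<Rightarrow> 'a) set \<Rightarrow> (('a \<Rightarrow> 'a) \<Rightarrow> 'h::complex_hilbert) \<Rightarrow>
     (('a \<Rightarrow> 'a) \<Rightarrow> ('h \<Rightarrow> 'h)) \<Rightarrow> (('a \<Rightarrow> 'a) \<Rightarrow> ('h \<Rightarrow> 'h)) \<Rightarrow> bool"
  where "acts_by_multiplication M M' \<Lambda> l r \<longleftrightarrow>
    (\<forall>x\<in>M. \<forall>y\<in>M'. l x (\<Lambda> y) = \<Lambda> (x \<circ> y) \<and> r x (\<Lambda> y) = \<Lambda> (y \<circ> x))"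

text \<open>\<open>Q\<close> is the bounded extension to \<open>L\<^sub>2(M)\<close> of the map \<open>\<Phi>\<close> on \<open>M\<close>.\<close>

definition L2_extension ::
    "('a::complex_hilbert \<Rightarrow> 'a) set \<Rightarrow> (('a \<Rightarrow> 'a) \<Rightarrow> 'h::complex_hilbert) \<Rightarrow>
     (('a \<Rightarrow> 'a) \<Rightarrow> ('a \<Rightarrow> 'a)) \<Rightarrow> ('h \<Rightarrow> 'h) \<Rightarrow> bool"
  where "L2_extension M \<Lambda> \<Phi> Q \<longleftrightarrow> bounded_op Q \<and> (\<forall>x\<in>M. Q (\<Lambda> x) = \<Lambda> (\<Phi> x))"

end

theory Submission
  imports Defs
begin

text \<open>The first part holds because \<open>\<partial>P x = Phat(\<partial>x)\<close>. The second reduces to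
  \<open>\<parallel>\<Phi> x\<parallel>\<^sub>p \<le> \<parallel>\<Phi> 1\<parallel> \<parallel>x\<parallel>\<^sub>p\<close> on the algebra and to Minkowski's inequality, which makes norms of
  \<open>p\<close>-Cauchy sequences converge. Interpolation is not needed. For positive \<open>a, c\<close>, positivity of
  \<open>\<tau>(\<Phi>(f(a)) g(c))\<close> turns the scalar inequality of Young into
  \<open>\<tau>(\<Phi>(a) c) \<le> \<parallel>\<Phi> 1\<parallel> (\<tau>(a\<^sup>p)/p + \<tau>(c\<^sup>q)/q)\<close>, by symmetry of \<open>\<Phi>\<close>. A general \<open>x\<close> is reduced to \<open>|x|\<close> and
  \<open>|x\<^sup>*|\<close> by applying \<open>\<Phi>\<close> to the positive operator matrix with rows \<open>(|x\<^sup>*|, x)\<close> and \<open>(x\<^sup>*, |x|)\<close>,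
  and pairing the result with the dual element of \<open>z = \<Phi> x\<close>. For \<open>\<Phi> = id\<close> and \<open>z = x + y\<close> the same
  pairing gives Minkowski's inequality.\<close>

section \<open>Hilbert spaces and adjoints\<close>

text \<open>The constant \<open>\<parallel>\<Phi> 1\<parallel>\<close> serves all \<open>p\<close>
  at once because both marginals of the form in \<open>f\<close> and \<open>g\<close> carry it:
  \<open>\<Phi> 1 \<le> K\<close> bounds the marginal in \<open>c\<close>, and symmetry carries the
  same estimate over to \<open>a\<close>. Young's inequality involves the marginals only; with
  weights fitted to the two norms its sum turns into the product of Hoelder's inequality. The
  obstacle is that \<open>\<Phi>(a)\<close> and \<open>c\<close> need not commute, so a scalar
  inequality in two variables cannot be evaluated at them. Freezing one variable at the nodes of a
  Bernstein polynomial leaves inequalities in one variable. The operator matrix takes the place of a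
  polar decomposition, and its two diagonal entries lead to equal estimates because functions of
  \<open>x\<^sup>* x\<close> and \<open>x x\<^sup>*\<close> have the same trace. The dual element is
  singular at 0 for \<open>p < 2\<close>, hence a regularization by \<open>e\<close>. Bernstein
  polynomials also carry the functional calculus: they show that a polynomial nonnegative on
  \<open>{0..onorm T}\<close> is positive at \<open>T\<close>.\<close>

lemma cinner_add_left: "cinner (x + y) z = cinner x z + cinner y z"
  for x y z :: "'a::complex_hilbert"
  by (metis cinner_add_right cinner_commute complex_cnj_add)

lemma cinner_scaleC_left: "cinner (c *\<^sub>C x) y = cnj c * cinner x y"
  for x y :: "'a::complex_hilbert"
  by (metis cinner_commute cinner_scaleC_right complex_cnj_mult)

lemma cinner_scaleR_right: "cinner x (r *\<^sub>R y) = r * cinner x y"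
  for x y :: "'a::complex_hilbert"
  by (simp add: scaleR_scaleC cinner_scaleC_right)

lemma cinner_scaleR_left: "cinner (r *\<^sub>R x) y = r * cinner x y"
  for x y :: "'a::complex_hilbert"
  by (simp add: scaleR_scaleC cinner_scaleC_left)

lemma cinner_minus_right: "cinner x (- y) = - cinner x y"
  for x y :: "'a::complex_hilbert"
  using cinner_scaleR_right[of x "-1" y] by simp

lemma cinner_minus_left: "cinner (- x) y = - cinner x y"
  for x y :: "'a::complex_hilbert"
  using cinner_scaleR_left[of "-1" x y] by simp

lemma cinner_diff_right: "cinner x (y - z) = cinner x y - cinner x z"
  for x y z :: "'a::complex_hilbert"
  using cinner_add_right[of x y "- z"] by (simp add: cinner_minus_right)

lemma cinner_diff_left: "cinner (x - y) z = cinner x z - cinner y z"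
  for x y z :: "'a::complex_hilbert"
  using cinner_add_left[of x "- y" z] by (simp add: cinner_minus_left)

lemma cinner_zero_right [simp]: "cinner x 0 = 0"
  for x :: "'a::complex_hilbert"
  using cinner_scaleR_right[of x 0 0] by simp

lemma cinner_zero_left [simp]: "cinner 0 x = 0"
  for x :: "'a::complex_hilbert"
  using cinner_scaleR_left[of 0 0 x] by simp

lemmas cinner_algebra = cinner_add_left cinner_add_right cinner_diff_left cinner_diff_right
  cinner_minus_left cinner_minus_right cinner_scaleR_left cinner_scaleR_right
  cinner_scaleC_left cinner_scaleC_right

lemma Re_cinner_self: "Re (cinner x x) = (norm x)\<^sup>2"
  for x :: "'a::complex_hilbert"
proof -
  have "0 \<le> Re (cinner x x)"
    using norm_ge_zero[of x] unfolding norm_eq_sqrt_cinner[of x] by simp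
  then show ?thesis by (simp add: norm_eq_sqrt_cinner[of x])
qed

lemma cinner_self: "cinner x x = complex_of_real ((norm x)\<^sup>2)"
  for x :: "'a::complex_hilbert"
  using cinner_commute[of x x] Re_cinner_self[of x] by (simp add: complex_eq_iff)

lemma Re_cinner_commute: "Re (cinner x y) = Re (cinner y x)"
  for x y :: "'a::complex_hilbert"
  by (subst cinner_commute) simp

lemma norm_add_sq: "(norm (x + y))\<^sup>2 = (norm x)\<^sup>2 + 2 * Re (cinner x y) + (norm y)\<^sup>2"
  for x y :: "'a::complex_hilbert"
  unfolding Re_cinner_self[symmetric] using Re_cinner_commute[of x y]
  by (simp add: cinner_algebra)

lemma norm_diff_sq: "(norm (x - y))\<^sup>2 = (norm x)\<^sup>2 - 2 * Re (cinner x y) + (norm y)\<^sup>2"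
  for x y :: "'a::complex_hilbert"
  unfolding Re_cinner_self[symmetric] using Re_cinner_commute[of x y]
  by (simp add: cinner_algebra)

lemma Re_cinner_le: "Re (cinner x y) \<le> norm x * norm y"
  for x y :: "'a::complex_hilbert"
proof (cases "x = 0 \<or> y = 0")
  case False
  then have n: "norm x > 0" "norm y > 0" by auto
  \<comment> \<open>Cross-multiplying by the norms gives both vectors the same length without a
    division; expanding the square leaves a positive multiple of the claim.\<close>
  have "0 \<le> (norm (norm y *\<^sub>R x - norm x *\<^sub>R y))\<^sup>2" by simp
  also have "\<dots> = 2 * (norm x * norm y)\<^sup>2 - 2 * (norm x * norm y) * Re (cinner x y)"
    by (simp only: norm_diff_sq) (simp add: cinner_algebra power2_eq_square algebra_simps)
  finally have "norm x * norm y * Re (cinner x y) \<le> norm x * norm y * (norm x * norm y)"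
    by (simp add: power2_eq_square)
  then show ?thesis using n by simp
qed auto

lemma norm_scaleC: "norm (c *\<^sub>C x) = cmod c * norm x"
  for x :: "'a::complex_hilbert"
proof -
  have "(norm (c *\<^sub>C x))\<^sup>2 = Re (cnj c * c * complex_of_real ((norm x)\<^sup>2))"
  proof -
    have "cinner (c *\<^sub>C x) (c *\<^sub>C x) = cnj c * c * cinner x x"
      by (simp only: cinner_scaleC_left cinner_scaleC_right mult_ac)
    then show ?thesis by (metis Re_cinner_self cinner_self)
  qed
  also have "\<dots> = (cmod c * norm x)\<^sup>2"
    unfolding power_mult_distrib cmod_power2
    by (simp add: power2_eq_square algebra_simps)
  finally show ?thesis by (simp add: power2_eq_iff_nonneg)
qed

lemma cmod_cinner_le: "cmod (cinner x y) \<le> norm x * norm y"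
  for x y :: "'a::complex_hilbert"
proof (cases "cinner x y = 0")
  case False
  \<comment> \<open>A phase that rotates the inner product onto its modulus, which reduces the claim
    to real parts.\<close>
  define c where "c = cnj (sgn (cinner x y))"
  have "cmod (cinner x y) = Re (cinner x (c *\<^sub>C y))"
  proof -
    have "cinner x (c *\<^sub>C y) = complex_of_real (cmod (cinner x y))"
      unfolding cinner_algebra c_def sgn_div_norm using complex_norm_square[of "cinner x y"] False
      by (simp add: scaleR_conv_of_real field_simps power2_eq_square)
    then show ?thesis by simp
  qed
  also have "\<dots> \<le> norm x * norm (c *\<^sub>C y)" by (rule Re_cinner_le)
  also have "\<dots> = norm x * norm y" using False by (simp add: norm_scaleC c_def norm_sgn)
  finally show ?thesis .
qed simp

lemma bounded_bilinear_cinner: "bounded_bilinear (cinner :: 'a::complex_hilbert \<Rightarrow> 'a \<Rightarrow> complex)"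
  by standard (auto simp: cinner_algebra scaleR_conv_of_real cmod_cinner_le intro!: exI[of _ 1])

lemmas tendsto_cinner [tendsto_intros] = bounded_bilinear.tendsto[OF bounded_bilinear_cinner]

lemma cinner_eqI: "(\<And>w. cinner w x = cinner w y) \<Longrightarrow> x = y"
  for x y :: "'a::complex_hilbert"
  using Re_cinner_self[of "x - y"] by (simp add: cinner_diff_right)

lemma parallelogram_law: "(norm (x - y))\<^sup>2 = 2 * (norm x)\<^sup>2 + 2 * (norm y)\<^sup>2 - (norm (x + y))\<^sup>2"
  for x y :: "'a::complex_hilbert"
  by (simp add: norm_diff_sq norm_add_sq)

text \<open>The representing vector minimizes \<open>\<parallel>v\<parallel>\<^sup>2 - 2 f v\<close>; minimizing sequences are Cauchy by
  the parallelogram law.\<close>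

lemma riesz_representation_real:
  fixes f :: "'a::complex_hilbert \<Rightarrow> real"
  assumes "bounded_linear f"
  shows "\<exists>z. \<forall>w. f w = Re (cinner z w)"
proof -
  interpret f: bounded_linear f by fact
  define J where "J v = (norm v)\<^sup>2 - 2 * f v" for v
  obtain K where K: "\<And>v. \<bar>f v\<bar> \<le> norm v * K" using f.bounded by auto
  \<comment> \<open>Completing the square in \<open>norm v\<close> bounds \<open>J\<close> from
    below, so that its infimum exists.\<close>
  have J_ge: "J v \<ge> - K\<^sup>2" for v
  proof -
    have "0 \<le> (norm v - K)\<^sup>2" by simp
    then show ?thesis using K[of v] unfolding J_def power2_diff by (auto simp: abs_le_iff)
  qed
  have bdd: "bdd_below (range J)" using J_ge by (auto intro!: bdd_belowI)
  define m where "m = Inf (range J)"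
  have m_le: "m \<le> J v" for v unfolding m_def by (rule cInf_lower[OF _ bdd]) simp
  have "\<exists>v. J v < m + inverse (real (Suc n))" for n
  proof -
    have "Inf (range J) < m + inverse (real (Suc n))" unfolding m_def by simp
    then show ?thesis using bdd by (subst (asm) cInf_less_iff) auto
  qed
  then obtain v where v: "\<And>n. J (v n) < m + inverse (real (Suc n))" by metis
  have diff: "(norm (x - y))\<^sup>2 \<le> 2 * (J x - m) + 2 * (J y - m)" for x y
  proof -
    have "(norm (x - y))\<^sup>2 = 2 * J x + 2 * J y - 4 * J ((1/2) *\<^sub>R (x + y))"
    proof -
      have "(norm ((1/2) *\<^sub>R (x + y)))\<^sup>2 = (norm (x + y))\<^sup>2 / 4"
        by (simp only: norm_scaleR) (simp add: power2_eq_square)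
      then show ?thesis unfolding J_def parallelogram_law[of x y] f.scaleR f.add
        by (simp add: field_simps)
    qed
    moreover have "m \<le> J ((1/2) *\<^sub>R (x + y))" by (rule m_le)
    ultimately show ?thesis by argo
  qed
  have "Cauchy v"
  proof (rule metric_CauchyI)
    fix e :: real assume "e > 0"
    then obtain N where N: "inverse (real (Suc N)) < e\<^sup>2 / 4"
      using reals_Archimedean[of "e\<^sup>2 / 4"] by auto
    have "dist (v i) (v j) < e" if "i \<ge> N" "j \<ge> N" for i j
    proof -
      have "inverse (real (Suc i)) \<le> inverse (real (Suc N))"
        "inverse (real (Suc j)) \<le> inverse (real (Suc N))" using that by auto
      then have "(norm (v i - v j))\<^sup>2 < e\<^sup>2"
        using diff[of "v i" "v j"] v[of i] v[of j] N by argo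
      then show ?thesis using \<open>e > 0\<close> by (simp add: dist_norm power_less_imp_less_base)
    qed
    then show "\<exists>M. \<forall>i\<ge>M. \<forall>j\<ge>M. dist (v i) (v j) < e" by blast
  qed
  then obtain z where z: "v \<longlonglongrightarrow> z" using Cauchy_convergent convergent_def by blast
  have "(\<lambda>n. J (v n)) \<longlonglongrightarrow> J z" unfolding J_def
    by (intro tendsto_intros z f.tendsto)
  moreover have "(\<lambda>n. m + inverse (real (Suc n))) \<longlonglongrightarrow> m + 0"
    by (intro tendsto_intros LIMSEQ_inverse_real_of_nat)
  ultimately have "J z \<le> m + 0"
    by (rule LIMSEQ_le) (use v less_imp_le in blast)
  then have Jz: "J z \<le> m" by simp
  show ?thesis
  proof (intro exI allI)
    fix w
    define d where "d = Re (cinner z w) - f w"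
    have "0 \<le> t\<^sup>2 * (norm w)\<^sup>2 + 2 * t * d" for t :: real
    proof -
      have "J z \<le> J (z + t *\<^sub>R w)" using Jz m_le order_trans by blast
      then show ?thesis
        by (simp add: J_def d_def norm_add_sq f.add f.scaleR cinner_algebra power_mult_distrib
            algebra_simps)
    qed
    note quad = this
    \<comment> \<open>The added 1 keeps \<open>c\<close> positive for \<open>w = 0\<close>. At
      \<open>t = - d / c\<close>, close to the minimizer of the quadratic polynomial, its value is
      at most \<open>- (d\<^sup>2 / c)\<close>.\<close>
    define c where "c = (norm w)\<^sup>2 + 1"
    have c: "c > 0" unfolding c_def by (smt (verit) zero_le_power2)
    have "0 \<le> (- d / c)\<^sup>2 * (norm w)\<^sup>2 + 2 * (- d / c) * d" by (rule quad)
    also have "\<dots> \<le> (- d / c)\<^sup>2 * c + 2 * (- d / c) * d"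
      by (intro add_right_mono mult_left_mono) (auto simp: c_def)
    also have "\<dots> = - (d\<^sup>2 / c)" using c by (simp add: power2_eq_square field_simps)
    finally have "d = 0" using c by (simp add: divide_le_0_iff)
    then show "f w = Re (cinner z w)" unfolding d_def by simp
  qed
qed

section \<open>Algebra of bounded operators and existence of adjoints\<close>

lemma bounded_linear_scaleC: "bounded_linear (\<lambda>x. c *\<^sub>C x :: 'a::complex_hilbert)"
  by (rule bounded_linear_intro[where K = "cmod c"])
    (simp_all add: scaleC_add_right norm_scaleC scaleR_scaleC scaleC_scaleC mult_ac)

lemma bounded_opD:
  assumes "bounded_op T"
  shows bounded_op_add: "T (v + w) = T v + T w"
    and bounded_op_scaleC: "T (c *\<^sub>C v) = c *\<^sub>C T v"
    and bounded_op_scaleR: "T (s *\<^sub>R v) = s *\<^sub>R T v"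
    and bounded_op_diff: "T (v - w) = T v - T w"
    and bounded_op_minus: "T (- v) = - T v"
    and bounded_op_zero: "T 0 = 0"
    and bounded_op_onorm: "norm (T v) \<le> onorm T * norm v"
    and bounded_op_bounded_linear: "bounded_linear T"
proof -
  interpret bounded_linear T using assms by (simp add: bounded_op_def)
  show "T (v + w) = T v + T w" "T (c *\<^sub>C v) = c *\<^sub>C T v" "T (s *\<^sub>R v) = s *\<^sub>R T v"
    "T (v - w) = T v - T w" "T (- v) = - T v" "T 0 = 0" "bounded_linear T"
    using assms by (auto simp: bounded_op_def complex_linear_def add scaleR diff neg
        bounded_linear_axioms)
  show "norm (T v) \<le> onorm T * norm v" using onorm[OF bounded_linear_axioms] .
qed

lemma bounded_opI:
  assumes "\<And>v w. T (v + w) = T v + T w" "\<And>c v. T (c *\<^sub>C v) = c *\<^sub>C T v"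
    and "\<And>v. norm (T v) \<le> K * norm v"
  shows "bounded_op T"
  unfolding bounded_op_def complex_linear_def
  using assms by (auto intro!: bounded_linear_intro[where K = K] simp: scaleR_scaleC mult.commute)

lemma scaleC_zero_right [simp]: "c *\<^sub>C 0 = (0 :: 'a::complex_hilbert)"
  using scaleC_add_right[of c 0 "0::'a"] by simp

lemma bounded_op_ident [simp]: "bounded_op (\<lambda>x. x)"
  by (rule bounded_opI[where K = 1]) auto

lemma bounded_op_id [simp]: "bounded_op id"
  by (simp add: id_def)

lemma bounded_op_zero_op [simp]: "bounded_op (\<lambda>x. 0)"
  by (rule bounded_opI[where K = 0]) auto

lemma bounded_op_comp:
  assumes "bounded_op S" "bounded_op T"
  shows "bounded_op (S \<circ> T)"
  using assms bounded_linear_compose[of S T]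
  by (auto simp: bounded_op_def complex_linear_def o_def)

lemma bounded_op_plus:
  assumes "bounded_op S" "bounded_op T"
  shows "bounded_op (\<lambda>v. S v + T v)"
  using assms bounded_linear_add[of S T]
  by (auto simp: bounded_op_def complex_linear_def algebra_simps scaleC_add_right)

lemma bounded_op_scaleC_op:
  assumes "bounded_op T"
  shows "bounded_op (\<lambda>v. c *\<^sub>C T v)"
  using assms bounded_linear_compose[OF bounded_linear_scaleC, of T c]
  by (auto simp: bounded_op_def complex_linear_def scaleC_add_right scaleC_scaleC mult.commute)

lemma bounded_op_scaleR_op:
  assumes "bounded_op T"
  shows "bounded_op (\<lambda>v. s *\<^sub>R T v)"
  using bounded_op_scaleC_op[OF assms, of "of_real s"] by (simp add: scaleR_scaleC)

lemma bounded_op_minus_op: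
  assumes "bounded_op T"
  shows "bounded_op (\<lambda>v. - T v)"
  using bounded_op_scaleR_op[OF assms, of "-1"] by simp

lemma bounded_op_minus_ops:
  assumes "bounded_op S" "bounded_op T"
  shows "bounded_op (\<lambda>v. S v - T v)"
  using bounded_op_plus[OF assms(1) bounded_op_minus_op[OF assms(2)]] by simp

lemma bounded_op_funpow: "bounded_op T \<Longrightarrow> bounded_op (T ^^ n)"
  by (induction n) (auto intro: bounded_op_comp)

lemmas bounded_op_intros = bounded_op_comp bounded_op_plus bounded_op_scaleC_op
  bounded_op_scaleR_op bounded_op_minus_op bounded_op_minus_ops bounded_op_funpow
  bounded_op_ident bounded_op_id bounded_op_zero_op

text \<open>The representing vector matches real parts only; replacing \<open>w\<close> by
  \<open>\<i> *\<^sub>C w\<close> yields the imaginary parts.\<close>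

lemma ex_adjoint:
  fixes T :: "'a::complex_hilbert \<Rightarrow> 'a"
  assumes T: "bounded_op T"
  shows "\<exists>S. \<forall>v w. cinner (S v) w = cinner v (T w)"
proof -
  have "\<exists>z. \<forall>w. cinner z w = cinner v (T w)" for v
  proof -
    have "bounded_linear (\<lambda>w. Re (cinner v (T w)))"
      using bounded_linear_compose[OF bounded_bilinear.bounded_linear_right[OF
          bounded_bilinear_cinner] bounded_op_bounded_linear[OF T]]
      by (rule bounded_linear_compose[OF bounded_linear_Re])
    then obtain z where z: "\<And>w. Re (cinner v (T w)) = Re (cinner z w)"
      using riesz_representation_real by blast
    have "cinner z w = cinner v (T w)" for w
    proof (rule complex_eqI)
      show "Re (cinner z w) = Re (cinner v (T w))" by (simp add: z)
      show "Im (cinner z w) = Im (cinner v (T w))"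
        using z[of "\<i> *\<^sub>C w"] by (simp add: bounded_op_scaleC[OF T] cinner_scaleC_right)
    qed
    then show ?thesis by blast
  qed
  then show ?thesis by metis
qed

text \<open>As \<open>cadjoint\<close> is a definite description, every adjoint below is computed
  through this lemma.\<close>

lemma adjoint_unique:
  assumes "\<And>v w. cinner (S v) w = cinner v (T w)"
  shows "cadjoint T = S"
  unfolding cadjoint_def
proof (rule the_equality)
  show "\<forall>v w. cinner (S v) w = cinner v (T w)" using assms by blast
next
  fix S' assume "\<forall>v w. cinner (S' v) w = cinner v (T w)"
  then have "cinner w (S' v) = cinner w (S v)" for v w
    using assms cinner_commute[of w "S' v"] cinner_commute[of w "S v"] by simp
  then show "S' = S" by (blast intro: cinner_eqI)
qed

lemma cinner_adjoint_left:
  assumes "bounded_op T"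
  shows "cinner (cadjoint T v) w = cinner v (T w)"
  using ex_adjoint[OF assms] adjoint_unique[of _ T] by metis

lemma cinner_adjoint_right:
  assumes "bounded_op T"
  shows "cinner v (cadjoint T w) = cinner (T v) w"
  using cinner_adjoint_left[OF assms, of w v] cinner_commute[of v "cadjoint T w"]
    cinner_commute[of "T v" w] by simp

lemma bounded_op_adjoint:
  assumes T: "bounded_op T"
  shows "bounded_op (cadjoint T)"
proof (rule bounded_opI)
  fix v w c
  show "cadjoint T (v + w) = cadjoint T v + cadjoint T w"
    by (rule cinner_eqI) (simp add: cinner_adjoint_right[OF T] cinner_add_right)
  show "cadjoint T (c *\<^sub>C v) = c *\<^sub>C cadjoint T v"
    by (rule cinner_eqI) (simp add: cinner_adjoint_right[OF T] cinner_scaleC_right)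
  show "norm (cadjoint T v) \<le> onorm T * norm v"
  proof (cases "cadjoint T v = 0")
    case True
    then show ?thesis using onorm_pos_le[OF bounded_op_bounded_linear[OF T]] by simp
  next
    case False
    \<comment> \<open>One factor \<open>norm (cadjoint T v)\<close> reappears on the right-hand side
      and cancels.\<close>
    have "(norm (cadjoint T v))\<^sup>2 = Re (cinner (T (cadjoint T v)) v)"
      by (simp add: Re_cinner_self[symmetric] cinner_adjoint_right[OF T])
    also have "\<dots> \<le> norm (T (cadjoint T v)) * norm v" by (rule Re_cinner_le)
    also have "\<dots> \<le> onorm T * norm (cadjoint T v) * norm v"
      by (intro mult_right_mono bounded_op_onorm T) auto
    finally show ?thesis using False by (simp add: power2_eq_square)
  qed
qed

lemma adjoint_adjoint: "bounded_op T \<Longrightarrow> cadjoint (cadjoint T) = T"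
  by (rule adjoint_unique) (simp add: cinner_adjoint_right)

lemma adjoint_comp:
  assumes "bounded_op S" "bounded_op T"
  shows "cadjoint (S \<circ> T) = cadjoint T \<circ> cadjoint S"
  by (rule adjoint_unique) (simp add: cinner_adjoint_left assms)

lemma adjoint_plus:
  assumes "bounded_op S" "bounded_op T"
  shows "cadjoint (\<lambda>v. S v + T v) = (\<lambda>v. cadjoint S v + cadjoint T v)"
  by (rule adjoint_unique) (simp add: cinner_adjoint_left assms cinner_algebra)

lemma adjoint_minus:
  assumes "bounded_op T"
  shows "cadjoint (\<lambda>v. - T v) = (\<lambda>v. - cadjoint T v)"
  by (rule adjoint_unique) (simp add: cinner_adjoint_left assms cinner_algebra)


section \<open>Positive operators\<close>

lemma pos_opD:
  assumes "pos_op T"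
  shows pos_op_bounded: "bounded_op T"
    and pos_op_Re: "0 \<le> Re (cinner v (T v))"
    and pos_op_Im: "Im (cinner v (T v)) = 0"
  using assms by (auto simp: pos_op_def complex_nonneg_Reals_iff)

text \<open>Polarization: reality of the form at \<open>v + w\<close> settles the imaginary part,
  and at \<open>v + \<i> *\<^sub>C w\<close> the real part.\<close>

lemma selfadjoint_of_real_form:
  assumes T: "bounded_op T" and real: "\<And>v. Im (cinner v (T v)) = 0"
  shows "cinner (T v) w = cinner v (T w)"
proof -
  have eq: "Im (cinner v (T w)) + Im (cinner w (T v)) = 0" for v w
    using real[of "v + w"] real[of v] real[of w]
    by (simp add: bounded_op_add[OF T] cinner_algebra)
  have "Re (cinner v (T w)) - Re (cinner w (T v)) = 0"
    using eq[of v "\<i> *\<^sub>C w"] by (simp add: bounded_op_scaleC[OF T] cinner_algebra)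
  moreover have "cinner (T v) w = cnj (cinner w (T v))" by (rule cinner_commute)
  ultimately show ?thesis using eq[of v w] by (simp add: complex_eq_iff)
qed

lemma pos_op_selfadjoint: "pos_op T \<Longrightarrow> cinner (T v) w = cinner v (T w)"
  by (rule selfadjoint_of_real_form) (auto simp: pos_opD)

lemma pos_op_adjoint: "pos_op T \<Longrightarrow> cadjoint T = T"
  by (rule adjoint_unique) (rule pos_op_selfadjoint)

lemma pos_opI:
  assumes "bounded_op T" "\<And>v w. cinner (T v) w = cinner v (T w)" "\<And>v. 0 \<le> Re (cinner v (T v))"
  shows "pos_op T"
  unfolding pos_op_def complex_nonneg_Reals_iff
proof (intro conjI allI)
  fix v
  show "Im (cinner v (T v)) = 0" using assms(2)[of v v] cinner_commute[of v "T v"]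
    by (simp add: complex_eq_iff)
qed (use assms in auto)

lemma pos_op_adjoint_comp:
  assumes "bounded_op T"
  shows "pos_op (cadjoint T \<circ> T)"
  by (rule pos_opI)
    (auto intro!: bounded_op_comp bounded_op_adjoint assms
      simp: cinner_adjoint_left cinner_adjoint_right assms Re_cinner_self)

lemma pos_op_conj:
  assumes "pos_op X" "bounded_op T"
  shows "pos_op (cadjoint T \<circ> X \<circ> T)"
  by (rule pos_opI)
    (auto intro!: bounded_op_comp bounded_op_adjoint
      simp: assms pos_opD cinner_adjoint_left cinner_adjoint_right pos_op_selfadjoint[OF assms(1)])

lemma pos_op_id [simp]: "pos_op id"
  by (auto intro!: pos_opI simp: Re_cinner_self)

text \<open>Turns a norm bound into an operator inequality. It is used for \<open>T\<close> itself
  and for \<open>\<Phi> id\<close>, which is where \<open>K\<close> enters.\<close>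

lemma pos_op_onorm_minus:
  assumes T: "bounded_op T" and sa: "\<And>v w. cinner (T v) w = cinner v (T w)" and R: "onorm T \<le> R"
  shows "pos_op (\<lambda>v. R *\<^sub>R v - T v)"
proof (rule pos_opI)
  show "bounded_op (\<lambda>v. R *\<^sub>R v - T v)" by (intro bounded_op_intros T)
  fix v w
  show "cinner (R *\<^sub>R v - T v) w = cinner v (R *\<^sub>R w - T w)"
    by (simp add: cinner_algebra sa)
  have "Re (cinner v (T v)) \<le> norm v * norm (T v)" by (rule Re_cinner_le)
  also have "\<dots> \<le> norm v * (onorm T * norm v)"
    by (intro mult_left_mono bounded_op_onorm T) auto
  also have "\<dots> \<le> norm v * (R * norm v)" using R by (intro mult_left_mono mult_right_mono) auto
  also have "\<dots> = Re (cinner v (R *\<^sub>R v))"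
    by (simp add: cinner_scaleR_right cinner_self power2_eq_square)
  finally show "0 \<le> Re (cinner v (R *\<^sub>R v - T v))" by (simp add: cinner_diff_right)
qed


section \<open>Polynomials in an operator\<close>

lemma poly_op_eq_sum:
  assumes "degree q \<le> n"
  shows "poly_op q T v = (\<Sum>i\<le>n. coeff q i *\<^sub>R (T ^^ i) v)"
  unfolding poly_op_def
  by (rule sum.mono_neutral_left) (use assms in \<open>auto simp: coeff_eq_0\<close>)

lemma poly_op_0 [simp]: "poly_op 0 T v = 0"
  by (simp add: poly_op_def)

text \<open>The Horner step on which the inductions over polynomials rest.\<close>

lemma poly_op_pCons:
  assumes T: "bounded_op T"
  shows "poly_op (pCons a q) T v = a *\<^sub>R v + T (poly_op q T v)"
proof -
  interpret T: bounded_linear T by (rule bounded_op_bounded_linear[OF T])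
  have "poly_op (pCons a q) T v = (\<Sum>i\<le>Suc (degree q). coeff (pCons a q) i *\<^sub>R (T ^^ i) v)"
    by (rule poly_op_eq_sum) (rule degree_pCons_le)
  also have "\<dots> = a *\<^sub>R v + (\<Sum>i\<le>degree q. coeff q i *\<^sub>R T ((T ^^ i) v))"
    by (subst sum.atMost_Suc_shift) simp
  also have "\<dots> = a *\<^sub>R v + T (poly_op q T v)"
    by (simp add: poly_op_def T.sum T.scaleR)
  finally show ?thesis .
qed

lemma bounded_op_poly_op:
  assumes "bounded_op T"
  shows "bounded_op (poly_op q T)"
proof (induction q)
  case 0
  have "poly_op 0 T = (\<lambda>v. 0)" by auto
  then show ?case by simp
next
  case (pCons a q)
  have "poly_op (pCons a q) T = (\<lambda>v. a *\<^sub>R v + (T \<circ> poly_op q T) v)"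
    by (auto simp: poly_op_pCons assms)
  then show ?case
    using bounded_op_plus[OF bounded_op_scaleR_op[OF bounded_op_ident] bounded_op_comp[OF assms pCons.IH]]
    by simp
qed

lemma poly_op_add:
  assumes "bounded_op T"
  shows "poly_op (p + q) T v = poly_op p T v + poly_op q T v"
  using poly_op_eq_sum[of p "max (degree p) (degree q)" T v]
    poly_op_eq_sum[of q "max (degree p) (degree q)" T v]
    poly_op_eq_sum[of "p + q" "max (degree p) (degree q)" T v]
  by (simp add: degree_add_le algebra_simps sum.distrib)

lemma poly_op_smult: "poly_op (smult c q) T v = c *\<^sub>R poly_op q T v"
  using poly_op_eq_sum[of "smult c q" "degree q" T v]
  by (simp add: degree_smult_le poly_op_def scaleR_sum_right)

lemma poly_op_minus:
  assumes "bounded_op T"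
  shows "poly_op (p - q) T v = poly_op p T v - poly_op q T v"
  using poly_op_add[OF assms, of p "- q" v] poly_op_smult[of "-1" q T v] by simp

lemma poly_op_const [simp]: "poly_op [:a:] T v = a *\<^sub>R v"
  by (simp add: poly_op_def)

lemma poly_op_1 [simp]: "poly_op 1 T v = v"
  by (simp add: one_pCons)

lemma poly_op_mult:
  assumes T: "bounded_op T"
  shows "poly_op (p * q) T v = poly_op p T (poly_op q T v)"
proof (induction p)
  case (pCons a p)
  then show ?case by (simp add: poly_op_pCons poly_op_add poly_op_smult T)
qed simp

lemma poly_op_selfadjoint:
  assumes T: "bounded_op T" and sa: "\<And>v w. cinner (T v) w = cinner v (T w)"
  shows "cinner (poly_op q T v) w = cinner v (poly_op q T w)"
proof (induction q arbitrary: v w)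
  case (pCons a q)
  have "poly_op q T (T w) = T (poly_op q T w)" for w
    using poly_op_mult[OF T, of q "[:0,1:]" w] poly_op_mult[OF T, of "[:0,1:]" q w]
    by (simp add: poly_op_pCons T mult.commute)
  then show ?case by (simp add: poly_op_pCons T cinner_algebra sa pCons.IH)
qed simp

lemma poly_op_intertwine:
  assumes "bounded_op S" "bounded_op T" "bounded_op X" "\<And>v. X (T v) = S (X v)"
  shows "X (poly_op q T v) = poly_op q S (X v)"
proof (induction q)
  case (pCons a q)
  then show ?case by (simp add: poly_op_pCons bounded_opD assms)
qed (simp add: bounded_op_zero assms)


section \<open>Bernstein approximation\<close>

lemma smult_sum_right: "smult c (sum f A) = (\<Sum>k\<in>A. smult c (f k))"
  by (induction A rule: infinite_finite_induct) (simp_all add: smult_add_right)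

lemma pderiv_sum: "pderiv (sum f A) = (\<Sum>k\<in>A. pderiv (f k))"
  by (induction A rule: infinite_finite_induct) (simp_all add: pderiv_add)

text \<open>The Bernstein basis on \<open>{0..R}\<close>, kept as formal polynomials because it is
  differentiated and fed to linear functionals.\<close>

definition bernstein_basis :: "real \<Rightarrow> nat \<Rightarrow> nat \<Rightarrow> real poly"
  where "bernstein_basis R n k = smult ((n choose k) / R ^ n) ([:0, 1:] ^ k * [:R, -1:] ^ (n - k))"

definition bernstein_poly :: "real \<Rightarrow> nat \<Rightarrow> (real \<Rightarrow> real) \<Rightarrow> real poly"
  where "bernstein_poly R n f = (\<Sum>k\<le>n. smult (f (R * k / n)) (bernstein_basis R n k))"

lemma bernstein_basis_sum:
  assumes "R > 0"
  shows "(\<Sum>k\<le>n. bernstein_basis R n k) = 1"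
proof -
  have "(\<Sum>k\<le>n. bernstein_basis R n k) =
    smult (1 / R ^ n) (\<Sum>k\<le>n. of_nat (n choose k) * [:0, 1:] ^ k * [:R, -1:] ^ (n - k))"
    by (simp add: bernstein_basis_def smult_sum_right of_nat_poly mult.assoc)
  also have "\<dots> = smult (1 / R ^ n) (([:0, 1:] + [:R, -1:]) ^ n)"
    by (simp only: binomial_ring)
  also have "\<dots> = smult (1 / R ^ n) ([:R:] ^ n)" by simp
  also have "\<dots> = 1" using assms by (simp add: poly_const_pow one_pCons)
  finally show ?thesis .
qed

text \<open>Logarithmic derivative of the basis element, with \<open>X (R - X)\<close> clearing the
  denominators. Solved for the first term on the right, it tells how multiplying a coefficient by
  the node \<open>R * k / n\<close> acts on the basis.\<close>

lemma bernstein_basis_pderiv: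
  assumes "k \<le> n"
  shows "[:0, 1:] * [:R, -1:] * pderiv (bernstein_basis R n k) =
    smult (R * k) (bernstein_basis R n k) - smult n ([:0, 1:] * bernstein_basis R n k)"
proof -
  have X: "[:0, 1:] * pderiv ([:0, 1:] ^ k) = smult k ([:0, 1::real:] ^ k)"
    by (cases k) (simp_all add: pderiv_power_Suc pderiv_pCons del: power_Suc, simp add: algebra_simps)
  have Y: "[:R, -1:] * pderiv ([:R, -1:] ^ m) = smult (- real m) ([:R, -1:] ^ m)" for m
    by (cases m) (simp_all add: pderiv_power_Suc pderiv_pCons del: power_Suc, simp add: algebra_simps)
  have gen: "x * smult (- b) q * p + y * smult a p * q = (y * [:a:] - x * [:b:]) * (p * q)"
    for x y p q :: "real poly" and a b
    by (simp add: algebra_simps)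
  have "[:0, 1:] * [:R, -1:] * pderiv ([:0, 1:] ^ k * [:R, -1:] ^ (n - k)) =
    [:0, 1:] * ([:R, -1:] * pderiv ([:R, -1:] ^ (n - k))) * [:0, 1:] ^ k +
    [:R, -1:] * ([:0, 1:] * pderiv ([:0, 1:] ^ k)) * [:R, -1:] ^ (n - k)"
    by (simp only: pderiv_mult distrib_left mult_ac)
  also have "\<dots> = ([:R, -1:] * [:k:] - [:0, 1:] * [:real (n - k):]) * ([:0, 1:] ^ k * [:R, -1:] ^ (n - k))"
    unfolding X Y by (rule gen)
  also have "[:R, -1:] * [:k:] - [:0, 1:] * [:real (n - k):] = [:R * k:] - [:real n:] * [:0, 1:]"
    using assms by (simp add: of_nat_diff)
  also have "([:R * k:] - [:real n:] * [:0, 1:]) * b = smult (R * k) b - smult n ([:0, 1:] * b)" for b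
    by (simp add: algebra_simps)
  finally show ?thesis
    unfolding bernstein_basis_def pderiv_smult mult_smult_right
    by (simp only: smult_diff_right smult_smult mult.commute)
qed

text \<open>Multiplying \<open>q\<close> by the variable multiplies the coefficient at each node by
  \<open>R * k / n\<close>, which \<open>bernstein_basis_pderiv\<close> turns into an operation on
  polynomials. The factor \<open>1 / n\<close> makes the derivative term vanish in the
  limit.\<close>

lemma bernstein_poly_pCons:
  assumes "R > 0" "n > 0"
  shows "bernstein_poly R n (poly (pCons a q)) = [:a:] + [:0, 1:] * bernstein_poly R n (poly q)
    + smult (1 / n) ([:0, 1:] * [:R, -1:] * pderiv (bernstein_poly R n (poly q)))"
proof -
  define B where "B = bernstein_basis R n"
  have d: "smult (R * k / n) (B k) =
      [:0, 1:] * B k + smult (1 / n) ([:0, 1:] * [:R, -1:] * pderiv (B k))" if "k \<le> n" for k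
    using bernstein_basis_pderiv[OF that, of R] assms that
    by (simp add: B_def smult_diff_right)
  have "bernstein_poly R n (poly (pCons a q)) =
    (\<Sum>k\<le>n. smult a (B k)) + (\<Sum>k\<le>n. smult (poly q (R * k / n)) (smult (R * k / n) (B k)))"
    unfolding bernstein_poly_def B_def[symmetric] sum.distrib[symmetric]
    by (rule sum.cong) (simp_all add: smult_add_left mult.commute)
  also have "(\<Sum>k\<le>n. smult a (B k)) = [:a:]"
    using bernstein_basis_sum[OF assms(1), of n] by (simp add: B_def smult_sum_right[symmetric])
  also have "(\<Sum>k\<le>n. smult (poly q (R * k / n)) (smult (R * k / n) (B k))) =
    (\<Sum>k\<le>n. [:0, 1:] * smult (poly q (R * k / n)) (B k)
      + smult (1 / n) ([:0, 1:] * [:R, -1:] * pderiv (smult (poly q (R * k / n)) (B k))))"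
    by (rule sum.cong) (simp_all add: d pderiv_smult smult_add_right mult_ac)
  also have "\<dots> = [:0, 1:] * bernstein_poly R n (poly q)
    + smult (1 / n) ([:0, 1:] * [:R, -1:] * pderiv (bernstein_poly R n (poly q)))"
    unfolding bernstein_poly_def B_def[symmetric] sum.distrib sum_distrib_left smult_sum_right pderiv_sum
    by simp
  finally show ?thesis by (simp only: add.assoc)
qed

text \<open>In the induction \<open>\<phi>\<close> is replaced by its compositions with
  multiplication by the variable and with the derivative times \<open>X (R - X)\<close>, so it has
  to be a general linear functional.\<close>

lemma bernstein_poly_tendsto:
  fixes \<phi> :: "real poly \<Rightarrow> real"
  assumes "R > 0" "\<And>p q. \<phi> (p + q) = \<phi> p + \<phi> q" "\<And>c p. \<phi> (smult c p) = c * \<phi> p"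
  shows "(\<lambda>n. \<phi> (bernstein_poly R n (poly q))) \<longlonglongrightarrow> \<phi> q"
  using assms(2,3)
proof (induction q arbitrary: \<phi>)
  case 0
  have "\<phi> 0 = 0" using 0(2)[of 0 0] by simp
  then show ?case by (simp add: bernstein_poly_def)
next
  case (pCons a q)
  let ?B = "\<lambda>n. bernstein_poly R n (poly q)"
  have 1: "(\<lambda>n. \<phi> ([:0, 1:] * ?B n)) \<longlonglongrightarrow> \<phi> ([:0, 1:] * q)"
    by (rule pCons.IH[of "\<lambda>p. \<phi> ([:0, 1:] * p)"])
      (simp_all only: distrib_left mult_smult_right pCons.prems)
  have 2: "(\<lambda>n. \<phi> ([:0, 1:] * [:R, -1:] * pderiv (?B n))) \<longlonglongrightarrow> \<phi> ([:0, 1:] * [:R, -1:] * pderiv q)"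
    by (rule pCons.IH[of "\<lambda>p. \<phi> ([:0, 1:] * [:R, -1:] * pderiv p)"])
      (simp_all only: pderiv_add pderiv_smult distrib_left mult_smult_right pCons.prems)
  have "(\<lambda>n. \<phi> [:a:] + \<phi> ([:0, 1:] * ?B n) + 1 / real n * \<phi> ([:0, 1:] * [:R, -1:] * pderiv (?B n)))
    \<longlonglongrightarrow> \<phi> [:a:] + \<phi> ([:0, 1:] * q) + 0 * \<phi> ([:0, 1:] * [:R, -1:] * pderiv q)"
    by (intro tendsto_intros 1 2 lim_1_over_n)
  also have "\<phi> [:a:] + \<phi> ([:0, 1:] * q) + 0 * \<phi> ([:0, 1:] * [:R, -1:] * pderiv q) = \<phi> (pCons a q)"
    by (simp add: pCons.prems(1)[symmetric])
  finally show ?case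
    by (rule Lim_transform_eventually)
      (auto intro!: eventually_mono[OF eventually_gt_at_top[of 0]]
        simp only: bernstein_poly_pCons[OF assms(1)] pCons.prems)
qed

text \<open>Hausdorff's moment criterion: the Bernstein polynomials of \<open>q\<close> combine the
  products in \<open>pos\<close> with nonnegative coefficients, multiples of values of
  \<open>q\<close> at the nodes, and their images converge to \<open>\<phi> q\<close>.\<close>

lemma hausdorff_positivity:
  fixes \<phi> :: "real poly \<Rightarrow> real"
  assumes "R > 0" "\<And>p q. \<phi> (p + q) = \<phi> p + \<phi> q" "\<And>c p. \<phi> (smult c p) = c * \<phi> p"
    and pos: "\<And>i j. 0 \<le> \<phi> ([:0, 1:] ^ i * [:R, -1:] ^ j)"
    and q: "\<And>t. t \<in> {0..R} \<Longrightarrow> 0 \<le> poly q t"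
  shows "0 \<le> \<phi> q"
proof (rule LIMSEQ_le_const[OF bernstein_poly_tendsto[of R \<phi> q, OF assms(1-3)]], intro exI allI impI)
  fix n :: nat
  have sum: "\<phi> (sum g {..m}) = (\<Sum>k\<le>m. \<phi> (g k))" for g and m :: nat
    by (induction m) (auto simp: assms(2))
  show "0 \<le> \<phi> (bernstein_poly R n (poly q))"
    unfolding bernstein_poly_def bernstein_basis_def sum assms(3)
    using assms(1) by (intro sum_nonneg mult_nonneg_nonneg q pos)
      (auto simp: divide_le_eq mult_left_mono)
qed

lemma bernstein_basis_nonneg:
  assumes "0 \<le> t" "t \<le> R"
  shows "0 \<le> poly (bernstein_basis R n k) t"
  using assms by (simp add: bernstein_basis_def)

lemma poly_bernstein_poly:
  "poly (bernstein_poly R n f) t = (\<Sum>k\<le>n. f (R * k / n) * poly (bernstein_basis R n k) t)"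
  by (simp add: bernstein_poly_def poly_sum)

lemma bernstein_poly_uniform_limit:
  assumes R: "R > 0" and f: "continuous_on {0..R} f"
  shows "uniform_limit {0..R} (\<lambda>n. poly (bernstein_poly R n f)) f sequentially"
  unfolding uniform_limit_sequentially_iff
proof (intro allI impI)
  fix e :: real assume e: "e > 0"
  have "continuous_on {0..1} (\<lambda>x. f (R * x))"
    by (intro continuous_on_compose2[OF f] continuous_intros) (use R in \<open>auto simp: mult_le_one mult_left_le\<close>)
  from Bernstein_Weierstrass[OF this e] obtain N where N:
    "\<And>n x. N \<le> n \<Longrightarrow> x \<in> {0..1} \<Longrightarrow> \<bar>f (R * x) - (\<Sum>k\<le>n. f (R * (k / n)) * Bernstein n k x)\<bar> < e"
    by blast
  have B: "poly (bernstein_basis R n k) t = Bernstein n k (t / R)" if "k \<le> n" for n k t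
  proof -
    have "R ^ n = R ^ k * R ^ (n - k)" using that by (simp add: power_add[symmetric])
    moreover have "1 - t / R = (R - t) / R" using R by (simp add: field_simps)
    ultimately show ?thesis
      by (simp add: bernstein_basis_def Bernstein_def power_divide)
  qed
  have "dist (poly (bernstein_poly R n f) t) (f t) < e" if "N \<le> n" "t \<in> {0..R}" for n t
  proof -
    have "t / R \<in> {0..1}" using that R by auto
    from N[OF that(1) this] show ?thesis
      using R by (simp add: poly_bernstein_poly B dist_real_def abs_minus_commute)
  qed
  then show "\<exists>N. \<forall>n\<ge>N. \<forall>t\<in>{0..R}. dist (poly (bernstein_poly R n f) t) (f t) < e" by blast
qed

text \<open>The degenerate interval \<open>R = 0\<close> is included for the sake of the zero
  operator.\<close>

lemma poly_uniform_approx: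
  fixes f :: "real \<Rightarrow> real"
  assumes "0 \<le> R" and f: "continuous_on {0..R} f"
  obtains q where "uniform_limit {0..R} (\<lambda>n. poly (q n)) f sequentially"
proof (cases "R = 0")
  case True
  then have "{0..R} = {0}" by auto
  then have "uniform_limit {0..R} (\<lambda>n. poly [:f 0:]) f sequentially" by simp
  then show ?thesis by (rule that)
next
  case False
  then show ?thesis using that bernstein_poly_uniform_limit[of R f] assms by auto
qed

text \<open>\<open>(T\<^sup>k (R - T)\<^sup>m v, v)\<close> reduces, by moving squares to the other side, to exponents
  at most 1, and \<open>R T (R - T) = T (R - T)\<^sup>2 + T\<^sup>2 (R - T)\<close>.\<close>

lemma pos_op_poly_op:
  assumes T: "pos_op T" and q: "\<And>t. t \<in> {0..onorm T} \<Longrightarrow> 0 \<le> poly q t"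
  shows "pos_op (poly_op q T)"
proof (rule pos_opI)
  have bT: "bounded_op T" using T by (rule pos_op_bounded)
  show "bounded_op (poly_op q T)" by (rule bounded_op_poly_op[OF bT])
  have sa: "cinner (poly_op q T v) w = cinner v (poly_op q T w)" for q v w
    by (rule poly_op_selfadjoint[OF bT pos_op_selfadjoint[OF T]])
  then show "cinner (poly_op q T v) w = cinner v (poly_op q T w)" for v w .
  fix v
  define R where "R = onorm T"
  have R0: "R \<ge> 0" unfolding R_def by (rule onorm_pos_le[OF bounded_op_bounded_linear[OF bT]])
  show "0 \<le> Re (cinner v (poly_op q T v))"
  proof (cases "R = 0")
    \<comment> \<open>Norm 0 forces \<open>T = 0\<close>, and the Bernstein argument requires an
      interval of positive length.\<close>
    case True
    then have "T = (\<lambda>v. 0)"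
      using bounded_op_onorm[OF bT] by (auto simp: R_def)
    then have "poly_op q T v = poly q 0 *\<^sub>R v"
      by (cases q) (simp add: poly_op_pCons)
    then show ?thesis using q[of 0] R0
      by (simp add: R_def cinner_algebra Re_cinner_self)
  next
    case False
    then have R: "R > 0" using R0 by simp
    define \<phi> where "\<phi> v p = Re (cinner v (poly_op p T v))" for v p
    have add: "\<phi> v (p + q) = \<phi> v p + \<phi> v q" for v p q
      by (simp add: \<phi>_def poly_op_add bT cinner_algebra)
    have smult: "\<phi> v (smult c p) = c * \<phi> v p" for v c p
      by (simp add: \<phi>_def poly_op_smult cinner_algebra)
    have sq: "\<phi> v (p * (p * q)) = \<phi> (poly_op p T v) q" for v p q
      using poly_op_mult[OF bT, of q p v]
      by (simp add: \<phi>_def poly_op_mult[OF bT, of p] sa mult.commute[of p q])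
    have 1: "0 \<le> \<phi> w 1" for w by (simp add: \<phi>_def Re_cinner_self)
    have X: "0 \<le> \<phi> w [:0, 1:]" for w
      by (simp add: \<phi>_def poly_op_pCons bT bounded_op_zero pos_op_Re[OF T])
    have Y: "0 \<le> \<phi> w [:R, -1:]" for w
      using pos_op_Re[OF pos_op_onorm_minus[OF bT pos_op_selfadjoint[OF T] order_refl], of w]
      by (simp add: \<phi>_def poly_op_pCons bT bounded_op_minus bounded_op_zero R_def)
    have XY: "0 \<le> \<phi> w ([:0, 1:] * [:R, -1:])" for w
    proof -
      have "smult R ([:0, 1:] * [:R, -1:]) =
          [:0, 1:] * ([:0, 1:] * [:R, -1:]) + [:R, -1:] * ([:R, -1:] * [:0, 1:])"
        by simp
      then have "R * \<phi> w ([:0, 1:] * [:R, -1:]) =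
          \<phi> w ([:0, 1:] * ([:0, 1:] * [:R, -1:])) + \<phi> w ([:R, -1:] * ([:R, -1:] * [:0, 1:]))"
        by (simp only: smult[symmetric] add[symmetric])
      then have "0 \<le> R * \<phi> w ([:0, 1:] * [:R, -1:])" by (simp only: sq) (simp only: X Y add_nonneg_nonneg)
      then show ?thesis using R by (simp add: zero_le_mult_iff)
    qed
    have "0 \<le> \<phi> v ([:0, 1:] ^ i * [:R, -1:] ^ j)" for i j
    proof -
      have pw: "p ^ i = p ^ (i div 2) * (p ^ (i div 2) * p ^ (i mod 2))" for p :: "real poly" and i
        by (metis mult.assoc mult_2 power_add mult_div_mod_eq)
      have "[:0, 1:] ^ i * [:R, -1:] ^ j = ([:0, 1:] ^ (i div 2) * [:R, -1:] ^ (j div 2)) *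
          (([:0, 1:] ^ (i div 2) * [:R, -1:] ^ (j div 2)) * ([:0, 1:] ^ (i mod 2) * [:R, -1:] ^ (j mod 2)))"
        by (subst pw[of _ i], subst pw[of _ j]) (simp only: mult_ac)
      moreover have "0 \<le> \<phi> w ([:0, 1:] ^ (i mod 2) * [:R, -1:] ^ (j mod 2))" for w
        using 1 X Y XY by (cases "even i"; cases "even j") (simp_all add: mod_2_eq_odd del: mult_pCons_left mult_pCons_right)
      ultimately show ?thesis by (simp only: sq)
    qed
    then have "0 \<le> \<phi> v q"
      using hausdorff_positivity[OF R, of "\<phi> v" q] add smult q unfolding R_def by blast
    then show ?thesis by (simp add: \<phi>_def)
  qed
qed

text \<open>\<open>c\<^sup>2 - q\<^sup>2\<close> is nonnegative on the interval, and positivity of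
  its value at \<open>T\<close> compares the squared norms.\<close>

lemma poly_op_bound:
  assumes T: "pos_op T" and c: "\<And>t. t \<in> {0..onorm T} \<Longrightarrow> \<bar>poly q t\<bar> \<le> c"
  shows "norm (poly_op q T v) \<le> c * norm v"
proof -
  have bT: "bounded_op T" using T by (rule pos_op_bounded)
  have "0 \<le> onorm T" by (rule onorm_pos_le[OF bounded_op_bounded_linear[OF bT]])
  then have c0: "0 \<le> c" using c[of 0] by auto
  have "pos_op (poly_op ([:c\<^sup>2:] - q * q) T)"
  proof (rule pos_op_poly_op[OF T])
    fix t assume "t \<in> {0..onorm T}"
    then have "\<bar>poly q t\<bar>\<^sup>2 \<le> c\<^sup>2" using c c0 by (intro power_mono) auto
    then show "0 \<le> poly ([:c\<^sup>2:] - q * q) t" by (simp add: power2_eq_square)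
  qed
  from pos_op_Re[OF this, of v] Re_cinner_commute[of v "poly_op q T (poly_op q T v)"]
  have "(norm (poly_op q T v))\<^sup>2 \<le> (c * norm v)\<^sup>2"
    by (simp add: poly_op_minus bT poly_op_mult cinner_algebra Re_cinner_self power_mult_distrib
      poly_op_selfadjoint[OF bT pos_op_selfadjoint[OF T], of q _ v])
  then show ?thesis using c0 by (simp add: power2_le_iff_abs_le)
qed


section \<open>Continuous functional calculus\<close>

lemma onorm_nonneg: "bounded_op T \<Longrightarrow> 0 \<le> onorm T"
  by (rule onorm_pos_le[OF bounded_op_bounded_linear])

text \<open>Replaces the supremum inside \<open>onorm\<close> by bounds at each vector, the form in
  which the estimates of the calculus come.\<close>

lemma onorm_tendsto_zero_iff:
  fixes T :: "nat \<Rightarrow> 'a::complex_hilbert \<Rightarrow> 'a"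
  assumes "\<And>n. bounded_op (T n)"
  shows "(\<lambda>n. onorm (T n)) \<longlonglongrightarrow> 0 \<longleftrightarrow> (\<forall>e>0. \<forall>\<^sub>F n in sequentially. \<forall>v. norm (T n v) \<le> e * norm v)"
proof
  assume lim: "(\<lambda>n. onorm (T n)) \<longlonglongrightarrow> 0"
  show "\<forall>e>0. \<forall>\<^sub>F n in sequentially. \<forall>v. norm (T n v) \<le> e * norm v"
  proof (intro allI impI)
    fix e :: real assume "e > 0"
    with lim have "\<forall>\<^sub>F n in sequentially. onorm (T n) < e" by (simp add: order_tendsto_iff)
    then show "\<forall>\<^sub>F n in sequentially. \<forall>v. norm (T n v) \<le> e * norm v"
    proof (rule eventually_mono, intro allI)
      fix n and v :: 'a assume "onorm (T n) < e"
      then have "onorm (T n) * norm v \<le> e * norm v" by (intro mult_right_mono) auto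
      with bounded_op_onorm[OF assms, of n v] show "norm (T n v) \<le> e * norm v" by linarith
    qed
  qed
next
  assume *: "\<forall>e>0. \<forall>\<^sub>F n in sequentially. \<forall>v. norm (T n v) \<le> e * norm v"
  show "(\<lambda>n. onorm (T n)) \<longlonglongrightarrow> 0"
  proof (rule tendstoI)
    fix e :: real assume "e > 0"
    then have "\<forall>\<^sub>F n in sequentially. \<forall>v. norm (T n v) \<le> e / 2 * norm v"
      using * half_gt_zero by blast
    then show "\<forall>\<^sub>F n in sequentially. dist (onorm (T n)) 0 < e"
    proof (rule eventually_mono)
      fix n assume "\<forall>v. norm (T n v) \<le> e / 2 * norm v"
      then have "onorm (T n) \<le> e / 2" by (intro onorm_bound) (use \<open>e > 0\<close> in auto)
      then show "dist (onorm (T n)) 0 < e" using onorm_nonneg[OF assms] \<open>e > 0\<close> by simp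
    qed
  qed
qed

text \<open>The limit operator is described by an estimate against each single polynomial. This
  makes it independent of the approximating sequence.\<close>

lemma ex_functional_calculus:
  fixes T :: "'a::complex_hilbert \<Rightarrow> 'a"
  assumes T: "pos_op T" and f: "continuous_on {0..onorm T} f"
  shows "\<exists>S. bounded_op S \<and>
    (\<forall>q c v. (\<forall>t\<in>{0..onorm T}. \<bar>poly q t - f t\<bar> \<le> c) \<longrightarrow> norm (poly_op q T v - S v) \<le> c * norm v)"
proof -
  have bT: "bounded_op T" using T by (rule pos_op_bounded)
  note b = bounded_op_poly_op[OF bT]
  obtain r where r: "uniform_limit {0..onorm T} (\<lambda>n. poly (r n)) f sequentially"
    using poly_uniform_approx[OF onorm_nonneg[OF bT] f] .
  have close: "norm (poly_op p T v - poly_op q T v) \<le> (c + d) * norm v"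
    if "\<forall>t\<in>{0..onorm T}. \<bar>poly p t - f t\<bar> \<le> c" "\<forall>t\<in>{0..onorm T}. \<bar>poly q t - f t\<bar> \<le> d" for p q c d v
  proof -
    have "\<bar>poly (p - q) t\<bar> \<le> c + d" if "t \<in> {0..onorm T}" for t
      using bspec[OF \<open>\<forall>t\<in>_. \<bar>poly p t - f t\<bar> \<le> c\<close> that]
        bspec[OF \<open>\<forall>t\<in>_. \<bar>poly q t - f t\<bar> \<le> d\<close> that] by simp
    from poly_op_bound[OF T this, of v] show ?thesis by (simp add: poly_op_minus bT)
  qed
  have ev: "\<exists>N. \<forall>n\<ge>N. \<forall>t\<in>{0..onorm T}. \<bar>poly (r n) t - f t\<bar> \<le> e" if "e > 0" for e
    using r that unfolding uniform_limit_sequentially_iff dist_real_def by (meson less_imp_le)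
  have "Cauchy (\<lambda>n. poly_op (r n) T v)" for v
  proof (rule metric_CauchyI)
    fix e :: real assume e: "e > 0"
    \<comment> \<open>The added 1 permits the division by \<open>k\<close> when
      \<open>v = 0\<close>; the same device recurs below.\<close>
    define k where "k = norm v + 1"
    have k: "k > 0" by (simp add: k_def add_nonneg_pos)
    define d where "d = e / (4 * k)"
    have d: "d > 0" using e k by (simp add: d_def)
    then obtain N where N: "\<forall>n\<ge>N. \<forall>t\<in>{0..onorm T}. \<bar>poly (r n) t - f t\<bar> \<le> d" using ev by blast
    have "dist (poly_op (r m) T v) (poly_op (r n) T v) < e" if "m \<ge> N" "n \<ge> N" for m n
    proof -
      have "norm (poly_op (r m) T v - poly_op (r n) T v) \<le> (d + d) * norm v"
        using N that by (intro close) auto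
      also have "\<dots> \<le> (d + d) * k" using d by (intro mult_left_mono) (auto simp: k_def)
      also have "\<dots> = e / 2" using k by (simp add: d_def field_simps)
      finally show ?thesis using e by (simp add: dist_norm)
    qed
    then show "\<exists>M. \<forall>m\<ge>M. \<forall>n\<ge>M. dist (poly_op (r m) T v) (poly_op (r n) T v) < e" by blast
  qed
  then have "\<exists>y. (\<lambda>n. poly_op (r n) T v) \<longlonglongrightarrow> y" for v
    using Cauchy_convergent convergent_def by blast
  then obtain S where S: "\<And>v. (\<lambda>n. poly_op (r n) T v) \<longlonglongrightarrow> S v" by metis
  have approx: "norm (poly_op q T v - S v) \<le> c * norm v"
    if q: "\<forall>t\<in>{0..onorm T}. \<bar>poly q t - f t\<bar> \<le> c" for q c v
  proof (rule field_le_epsilon)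
    fix e :: real assume e: "e > 0"
    define d where "d = e / (norm v + 1)"
    have d: "d > 0" using e by (simp add: d_def add_nonneg_pos)
    then obtain N where N: "\<forall>n\<ge>N. \<forall>t\<in>{0..onorm T}. \<bar>poly (r n) t - f t\<bar> \<le> d" using ev by blast
    have "norm (poly_op q T v - S v) \<le> (c + d) * norm v"
    proof (rule LIMSEQ_le_const2)
      show "(\<lambda>n. norm (poly_op q T v - poly_op (r n) T v)) \<longlonglongrightarrow> norm (poly_op q T v - S v)"
        by (intro tendsto_intros S)
      show "\<exists>N. \<forall>n\<ge>N. norm (poly_op q T v - poly_op (r n) T v) \<le> (c + d) * norm v"
        using close[OF q] N by blast
    qed
    also have "\<dots> \<le> c * norm v + d * (norm v + 1)" using d by (simp add: algebra_simps)
    also have "d * (norm v + 1) = e" unfolding d_def by (simp add: add_nonneg_eq_0_iff)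
    finally show "norm (poly_op q T v - S v) \<le> c * norm v + e" .
  qed
  have "bounded_op S"
  proof -
    obtain N where N: "\<forall>t\<in>{0..onorm T}. \<bar>poly (r N) t - f t\<bar> \<le> 1" using ev[of 1] by auto
    show ?thesis
    proof (rule bounded_opI)
      fix v w c
      have "(\<lambda>n. poly_op (r n) T (v + w)) \<longlonglongrightarrow> S v + S w"
        unfolding bounded_op_add[OF b] by (intro tendsto_intros S)
      then show "S (v + w) = S v + S w" using S LIMSEQ_unique by blast
      have "(\<lambda>n. poly_op (r n) T (c *\<^sub>C v)) \<longlonglongrightarrow> c *\<^sub>C S v"
        unfolding bounded_op_scaleC[OF b]
        by (rule bounded_linear.tendsto[OF bounded_linear_scaleC S])
      then show "S (c *\<^sub>C v) = c *\<^sub>C S v" using S LIMSEQ_unique by blast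
      have "norm (S v) \<le> norm (poly_op (r N) T v) + norm (poly_op (r N) T v - S v)"
        by (metis norm_minus_commute norm_triangle_sub)
      also have "\<dots> \<le> onorm (poly_op (r N) T) * norm v + 1 * norm v"
        by (intro add_mono bounded_op_onorm b approx N)
      finally show "norm (S v) \<le> (onorm (poly_op (r N) T) + 1) * norm v" by (simp add: algebra_simps)
    qed
  qed
  then show ?thesis using approx by blast
qed

lemma
  assumes T: "pos_op T" and f: "continuous_on {0..onorm T} f"
  shows bounded_op_cfc: "bounded_op (pos_cfc f T)"
    and cfc_approx: "(\<And>t. t \<in> {0..onorm T} \<Longrightarrow> \<bar>poly q t - f t\<bar> \<le> c) \<Longrightarrow>
      norm (poly_op q T v - pos_cfc f T v) \<le> c * norm v"
proof -
  have bT: "bounded_op T" using T by (rule pos_op_bounded)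
  obtain S where S: "bounded_op S" and approx:
    "\<And>q c v. (\<forall>t\<in>{0..onorm T}. \<bar>poly q t - f t\<bar> \<le> c) \<Longrightarrow> norm (poly_op q T v - S v) \<le> c * norm v"
    using ex_functional_calculus[OF T f] by blast
  have lim: "(\<lambda>n. onorm (\<lambda>v. poly_op (q n) T v - S v)) \<longlonglongrightarrow> 0"
    if q: "uniform_limit {0..onorm T} (\<lambda>n. poly (q n)) f sequentially" for q
    unfolding onorm_tendsto_zero_iff[OF bounded_op_minus_ops[OF bounded_op_poly_op[OF bT] S]]
  proof (intro allI impI)
    fix e :: real assume "e > 0"
    with q have "\<forall>\<^sub>F n in sequentially. \<forall>t\<in>{0..onorm T}. dist (poly (q n) t) (f t) < e"
      by (simp add: uniform_limit_iff)
    then show "\<forall>\<^sub>F n in sequentially. \<forall>v. norm (poly_op (q n) T v - S v) \<le> e * norm v"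
      by (rule eventually_mono) (auto intro!: approx simp: dist_real_def less_imp_le)
  qed
  have "pos_cfc f T = S"
    unfolding pos_cfc_def
  proof (rule the_equality)
    fix S' assume S': "bounded_op S' \<and>
      (\<forall>q. uniform_limit {0..onorm T} (\<lambda>n. poly (q n)) f sequentially \<longrightarrow>
         (\<lambda>n. onorm (\<lambda>v. poly_op (q n) T v - S' v)) \<longlonglongrightarrow> 0)"
    \<comment> \<open>The condition on \<open>S'\<close> is an implication about approximating
      sequences; the existence of one such sequence gives it content and pins \<open>S'\<close>
      down.\<close>
    obtain r where r: "uniform_limit {0..onorm T} (\<lambda>n. poly (r n)) f sequentially"
      using poly_uniform_approx[OF onorm_nonneg[OF bT] f] .
    have conv: "(\<lambda>n. poly_op (r n) T v) \<longlonglongrightarrow> U v"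
      if "bounded_op U" "(\<lambda>n. onorm (\<lambda>v. poly_op (r n) T v - U v)) \<longlonglongrightarrow> 0" for U v
    proof (rule LIM_zero_cancel, rule Lim_null_comparison)
      show "(\<lambda>n. onorm (\<lambda>v. poly_op (r n) T v - U v) * norm v) \<longlonglongrightarrow> 0"
        using tendsto_mult_right[OF that(2), of "norm v"] by simp
      show "\<forall>\<^sub>F n in sequentially. norm (poly_op (r n) T v - U v) \<le>
          onorm (\<lambda>v. poly_op (r n) T v - U v) * norm v"
        by (intro always_eventually allI
            bounded_op_onorm[OF bounded_op_minus_ops[OF bounded_op_poly_op[OF bT] that(1)]])
    qed
    show "S' = S"
    proof
      fix v
      show "S' v = S v"
        using LIMSEQ_unique[OF conv[OF _ mp[OF spec[OF conjunct2[OF S']] r], of v]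
            conv[OF S lim[OF r], of v]] S' by simp
    qed
  qed (use S lim in blast)
  then show "bounded_op (pos_cfc f T)"
    "(\<And>t. t \<in> {0..onorm T} \<Longrightarrow> \<bar>poly q t - f t\<bar> \<le> c) \<Longrightarrow>
      norm (poly_op q T v - pos_cfc f T v) \<le> c * norm v"
    using S approx by auto
qed

lemma cfc_tendsto:
  assumes T: "pos_op T" and f: "continuous_on {0..onorm T} f"
    and q: "uniform_limit {0..onorm T} (\<lambda>n. poly (q n)) f sequentially"
  shows "(\<lambda>n. poly_op (q n) T v) \<longlonglongrightarrow> pos_cfc f T v"
proof (rule metric_LIMSEQ_I)
  fix e :: real assume e: "e > 0"
  define k where "k = norm v + 1"
  have k: "k > 0" by (simp add: k_def add_nonneg_pos)
  define d where "d = e / (2 * k)"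
  have d: "d > 0" using e k by (simp add: d_def)
  then obtain N where N: "\<forall>n\<ge>N. \<forall>t\<in>{0..onorm T}. dist (poly (q n) t) (f t) < d"
    using q unfolding uniform_limit_sequentially_iff by blast
  have "dist (poly_op (q n) T v) (pos_cfc f T v) < e" if "n \<ge> N" for n
  proof -
    have "norm (poly_op (q n) T v - pos_cfc f T v) \<le> d * norm v"
      using N that by (intro cfc_approx[OF T f]) (auto simp: dist_real_def less_imp_le)
    also have "\<dots> \<le> d * k" using d by (simp add: k_def)
    also have "\<dots> = e / 2" using k by (simp add: d_def)
    finally show ?thesis using e by (simp add: dist_norm)
  qed
  then show "\<exists>N. \<forall>n\<ge>N. dist (poly_op (q n) T v) (pos_cfc f T v) < e" by blast
qed

text \<open>Gives access to scalar identities that hold for nonnegative arguments only, such as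
  \<open>sqrt t * sqrt t = t\<close>.\<close>

lemma cfc_cong:
  assumes "\<And>t. 0 \<le> t \<Longrightarrow> t \<le> onorm T \<Longrightarrow> f t = g t"
  shows "pos_cfc f T = pos_cfc g T"
proof -
  have "uniform_limit {0..onorm T} h f F \<longleftrightarrow> uniform_limit {0..onorm T} h g F" for h :: "nat \<Rightarrow> real \<Rightarrow> real" and F
    by (rule uniform_limit_cong') (use assms in auto)
  then show ?thesis unfolding pos_cfc_def by simp
qed

lemma cfc_poly:
  assumes "pos_op T"
  shows "pos_cfc (poly q) T = poly_op q T"
proof
  fix v
  have "norm (poly_op q T v - pos_cfc (poly q) T v) \<le> 0 * norm v"
    by (rule cfc_approx[OF assms]) (auto intro!: continuous_intros)
  then show "pos_cfc (poly q) T v = poly_op q T v" by simp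
qed

lemma cfc_const:
  assumes "pos_op T"
  shows "pos_cfc (\<lambda>t. c) T = (\<lambda>v. c *\<^sub>R v)"
proof -
  have "poly [:c:] = (\<lambda>t. c)" by (intro ext) simp
  then have "pos_cfc (\<lambda>t. c) T = poly_op [:c:] T" using cfc_poly[OF assms, of "[:c:]"] by (simp only:)
  then show ?thesis by auto
qed

lemma cfc_ident:
  assumes "pos_op T"
  shows "pos_cfc (\<lambda>t. t) T = T"
proof -
  have "poly [:0, 1:] = (\<lambda>t::real. t)" by (intro ext) simp
  then have "pos_cfc (\<lambda>t. t) T = poly_op [:0, 1:] T"
    using cfc_poly[OF assms, of "[:0, 1:]"] by (simp only:)
  then show ?thesis using pos_op_bounded[OF assms] by (auto simp: poly_op_pCons bounded_op_zero)
qed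

section \<open>Algebraic rules, positivity and composition\<close>

lemma cfc_add:
  assumes T: "pos_op T" and f: "continuous_on {0..onorm T} f" and g: "continuous_on {0..onorm T} g"
  shows "pos_cfc (\<lambda>t. f t + g t) T v = pos_cfc f T v + pos_cfc g T v"
proof -
  have bT: "bounded_op T" using T by (rule pos_op_bounded)
  obtain p where p: "uniform_limit {0..onorm T} (\<lambda>n. poly (p n)) f sequentially"
    using poly_uniform_approx[OF onorm_nonneg[OF bT] f] .
  obtain q where q: "uniform_limit {0..onorm T} (\<lambda>n. poly (q n)) g sequentially"
    using poly_uniform_approx[OF onorm_nonneg[OF bT] g] .
  have "(\<lambda>n. poly_op (p n + q n) T v) \<longlonglongrightarrow> pos_cfc (\<lambda>t. f t + g t) T v"
    using uniform_limit_add[OF p q] by (intro cfc_tendsto T continuous_intros f g) (simp add: poly_add[abs_def])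
  moreover have "(\<lambda>n. poly_op (p n + q n) T v) \<longlonglongrightarrow> pos_cfc f T v + pos_cfc g T v"
    unfolding poly_op_add[OF bT] by (intro tendsto_intros cfc_tendsto T f g p q)
  ultimately show ?thesis by (rule LIMSEQ_unique)
qed

lemma cfc_mult:
  assumes T: "pos_op T" and f: "continuous_on {0..onorm T} f" and g: "continuous_on {0..onorm T} g"
  shows "pos_cfc (\<lambda>t. f t * g t) T v = pos_cfc f T (pos_cfc g T v)"
proof -
  have bT: "bounded_op T" using T by (rule pos_op_bounded)
  note b = bounded_op_poly_op[OF bT] and bf = bounded_op_cfc[OF T f]
  obtain p where p: "uniform_limit {0..onorm T} (\<lambda>n. poly (p n)) f sequentially"
    using poly_uniform_approx[OF onorm_nonneg[OF bT] f] .
  obtain q where q: "uniform_limit {0..onorm T} (\<lambda>n. poly (q n)) g sequentially"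
    using poly_uniform_approx[OF onorm_nonneg[OF bT] g] .
  have bd: "bounded (f ` {0..onorm T})" "bounded (g ` {0..onorm T})"
    by (intro compact_imp_bounded compact_continuous_image f g compact_Icc)+
  have "(\<lambda>n. poly_op (p n * q n) T v) \<longlonglongrightarrow> pos_cfc (\<lambda>t. f t * g t) T v"
    using uniform_lim_mult[OF p q bd] by (intro cfc_tendsto T continuous_intros f g) (simp add: poly_mult[abs_def])
  moreover have "(\<lambda>n. poly_op (p n * q n) T v) \<longlonglongrightarrow> pos_cfc f T (pos_cfc g T v)"
  proof -
    let ?w = "pos_cfc g T v"
    have qv: "(\<lambda>n. poly_op (q n) T v) \<longlonglongrightarrow> ?w" by (intro cfc_tendsto T g q)
    obtain C where "\<forall>t\<in>{0..onorm T}. \<bar>f t\<bar> \<le> C" using bd(1) by (auto simp: bounded_iff)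
    then have C: "\<bar>f t\<bar> \<le> C" if "t \<in> {0..onorm T}" for t using that by blast
    \<comment> \<open>From some index on \<open>poly (p n)\<close> is within 1 of \<open>f\<close>,
      so the operators \<open>poly_op (p n) T\<close> share the bound \<open>C + 1\<close>. This
      controls a product in which both factors vary with \<open>n\<close>.\<close>
    have "\<forall>\<^sub>F n in sequentially. \<forall>t\<in>{0..onorm T}. dist (poly (p n) t) (f t) < 1"
      using p by (simp add: uniform_limit_iff)
    then have "\<forall>\<^sub>F n in sequentially. norm (poly_op (p n) T (poly_op (q n) T v) - poly_op (p n) T ?w)
        \<le> (C + 1) * norm (poly_op (q n) T v - ?w)"
    proof (rule eventually_mono)
      fix n assume n: "\<forall>t\<in>{0..onorm T}. dist (poly (p n) t) (f t) < 1"
      have "\<bar>poly (p n) t\<bar> \<le> C + 1" if "t \<in> {0..onorm T}" for t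
        using bspec[OF n that] C[OF that] by (simp add: dist_real_def)
      from poly_op_bound[OF T this]
      show "norm (poly_op (p n) T (poly_op (q n) T v) - poly_op (p n) T ?w)
        \<le> (C + 1) * norm (poly_op (q n) T v - ?w)"
        by (simp add: bounded_op_diff[OF b, symmetric])
    qed
    moreover have "(\<lambda>n. (C + 1) * norm (poly_op (q n) T v - ?w)) \<longlonglongrightarrow> 0"
      using tendsto_mult_left[OF tendsto_norm[OF LIM_zero[OF qv]], of "C + 1"] by simp
    ultimately have "(\<lambda>n. poly_op (p n) T (poly_op (q n) T v) - poly_op (p n) T ?w) \<longlonglongrightarrow> 0"
      by (rule Lim_null_comparison)
    from tendsto_add[OF this cfc_tendsto[OF T f p, of ?w]] show ?thesis
      by (simp add: poly_op_mult bT)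
  qed
  ultimately show ?thesis by (rule LIMSEQ_unique)
qed

lemma cfc_scaleR:
  assumes T: "pos_op T" and f: "continuous_on {0..onorm T} f"
  shows "pos_cfc (\<lambda>t. c * f t) T v = c *\<^sub>R pos_cfc f T v"
  using cfc_mult[OF T continuous_on_const f, of c v] by (simp add: cfc_const T)

lemma cfc_diff:
  assumes T: "pos_op T" and f: "continuous_on {0..onorm T} f" and g: "continuous_on {0..onorm T} g"
  shows "pos_cfc (\<lambda>t. f t - g t) T v = pos_cfc f T v - pos_cfc g T v"
  using cfc_add[OF T f continuous_on_mult_left[OF g, of "-1"], of v] cfc_scaleR[OF T g, of "-1" v]
  by simp

lemma cfc_selfadjoint:
  assumes T: "pos_op T" and f: "continuous_on {0..onorm T} f"
  shows "cinner (pos_cfc f T v) w = cinner v (pos_cfc f T w)"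
proof -
  have bT: "bounded_op T" using T by (rule pos_op_bounded)
  obtain p where p: "uniform_limit {0..onorm T} (\<lambda>n. poly (p n)) f sequentially"
    using poly_uniform_approx[OF onorm_nonneg[OF bT] f] .
  have "(\<lambda>n. cinner (poly_op (p n) T v) w) \<longlonglongrightarrow> cinner (pos_cfc f T v) w"
    by (intro tendsto_intros cfc_tendsto T f p)
  moreover have "(\<lambda>n. cinner (poly_op (p n) T v) w) \<longlonglongrightarrow> cinner v (pos_cfc f T w)"
    unfolding poly_op_selfadjoint[OF bT pos_op_selfadjoint[OF T]]
    by (intro tendsto_intros cfc_tendsto T f p)
  ultimately show ?thesis by (rule LIMSEQ_unique)
qed

text \<open>Since \<open>f\<close> is the square of \<open>sqrt \<circ> f\<close> on the interval,
  the form is the squared norm of a vector.\<close>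

lemma pos_op_cfc:
  assumes T: "pos_op T" and f: "continuous_on {0..onorm T} f"
    and nonneg: "\<And>t. 0 \<le> t \<Longrightarrow> t \<le> onorm T \<Longrightarrow> 0 \<le> f t"
  shows "pos_op (pos_cfc f T)"
proof (rule pos_opI)
  fix v w
  show "cinner (pos_cfc f T v) w = cinner v (pos_cfc f T w)" by (rule cfc_selfadjoint[OF T f])
  let ?g = "\<lambda>t. sqrt (f t)"
  have g: "continuous_on {0..onorm T} ?g" by (intro continuous_intros f)
  have "pos_cfc f T = pos_cfc (\<lambda>t. ?g t * ?g t) T" by (rule cfc_cong) (simp add: nonneg)
  then have "cinner v (pos_cfc f T v) = cinner (pos_cfc ?g T v) (pos_cfc ?g T v)"
    by (simp only: cfc_mult[OF T g g] cfc_selfadjoint[OF T g])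
  then show "0 \<le> Re (cinner v (pos_cfc f T v))" by (simp add: Re_cinner_self)
qed (rule bounded_op_cfc[OF T f])

lemma cfc_bound:
  assumes T: "pos_op T" and f: "continuous_on {0..onorm T} f"
    and c: "\<And>t. 0 \<le> t \<Longrightarrow> t \<le> onorm T \<Longrightarrow> \<bar>f t\<bar> \<le> c"
  shows "norm (pos_cfc f T v) \<le> c * norm v"
proof -
  have c0: "0 \<le> c" using c[of 0] onorm_nonneg[OF pos_op_bounded[OF T]] by auto
  have "pos_op (pos_cfc (\<lambda>t. c\<^sup>2 - f t * f t) T)"
  proof (rule pos_op_cfc[OF T])
    fix t assume "0 \<le> t" "t \<le> onorm T"
    then have "\<bar>f t\<bar>\<^sup>2 \<le> c\<^sup>2" using c by (intro power_mono) auto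
    then show "0 \<le> c\<^sup>2 - f t * f t" by (simp add: power2_eq_square)
  qed (intro continuous_intros f)
  from pos_op_Re[OF this, of v]
  have "(norm (pos_cfc f T v))\<^sup>2 \<le> (c * norm v)\<^sup>2"
    by (simp add: cfc_diff T f continuous_on_mult continuous_on_const cfc_const cfc_mult cinner_algebra
      Re_cinner_self[symmetric] power_mult_distrib cfc_selfadjoint[symmetric])
  then show ?thesis using c0 by (simp add: power2_le_iff_abs_le)
qed

text \<open>\<open>S\<close> and \<open>T\<close> may differ in norm, so \<open>f\<close> is
  approximated on the larger of their intervals by a single polynomial sequence. With
  \<open>S = T\<close> this puts functions of \<open>T\<close> into a von Neumann algebra; with
  \<open>X = x\<close> it exchanges \<open>cadjoint x \<circ> x\<close> and
  \<open>x \<circ> cadjoint x\<close>.\<close>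

lemma cfc_commutes:
  assumes S: "pos_op S" and T: "pos_op T" and X: "bounded_op X" "\<And>v. X (T v) = S (X v)"
    and f: "continuous_on {0..} f"
  shows "X (pos_cfc f T v) = pos_cfc f S (X v)"
proof -
  have bS: "bounded_op S" and bT: "bounded_op T" using S T pos_op_bounded by auto
  define R where "R = max (onorm S) (onorm T)"
  have R0: "0 \<le> R" using onorm_nonneg[OF bS] by (simp add: R_def)
  have fR: "continuous_on {0..R} f" by (rule continuous_on_subset[OF f]) auto
  obtain p where p: "uniform_limit {0..R} (\<lambda>n. poly (p n)) f sequentially"
    using poly_uniform_approx[OF R0 fR] .
  have "(\<lambda>n. X (poly_op (p n) T v)) \<longlonglongrightarrow> X (pos_cfc f T v)"
    by (intro bounded_linear.tendsto[OF bounded_op_bounded_linear[OF X(1)]] cfc_tendsto T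
        continuous_on_subset[OF f] uniform_limit_on_subset[OF p]) (auto simp: R_def)
  moreover have "(\<lambda>n. X (poly_op (p n) T v)) \<longlonglongrightarrow> pos_cfc f S (X v)"
    unfolding poly_op_intertwine[where X = X, OF bS bT X]
    by (intro cfc_tendsto S continuous_on_subset[OF f] uniform_limit_on_subset[OF p])
      (auto simp: R_def)
  ultimately show ?thesis by (rule LIMSEQ_unique)
qed

lemma poly_op_cfc:
  assumes T: "pos_op T" and f: "continuous_on {0..onorm T} f"
  shows "poly_op q (pos_cfc f T) v = pos_cfc (\<lambda>t. poly q (f t)) T v"
proof (induction q arbitrary: v)
  case 0
  then show ?case by (simp add: cfc_const T)
next
  case (pCons a q)
  then show ?case
    by (simp add: poly_op_pCons bounded_op_cfc T f cfc_add cfc_mult cfc_const continuous_on_mult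
      continuous_on_const continuous_on_poly)
qed

lemma cfc_compose:
  assumes T: "pos_op T" and f: "continuous_on {0..} f" "\<And>t. 0 \<le> t \<Longrightarrow> 0 \<le> f t"
    and g: "continuous_on {0..} g"
  shows "pos_cfc g (pos_cfc f T) = pos_cfc (\<lambda>t. g (f t)) T"
proof
  fix v
  have fT: "continuous_on {0..onorm T} f" by (rule continuous_on_subset[OF f(1)]) auto
  have pf: "pos_op (pos_cfc f T)" by (rule pos_op_cfc[OF T fT f(2)])
  obtain B where "\<forall>t\<in>{0..onorm T}. \<bar>f t\<bar> \<le> B"
    using compact_imp_bounded[OF compact_continuous_image[OF fT compact_Icc]]
    by (auto simp: bounded_iff)
  then have B: "\<bar>f t\<bar> \<le> B" if "t \<in> {0..onorm T}" for t using that by blast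
  have B0: "0 \<le> B" using B[of 0] onorm_nonneg[OF pos_op_bounded[OF T]] by auto
  \<comment> \<open>\<open>{0..B}\<close> contains the range of \<open>f\<close> on
    \<open>{0..onorm T}\<close> and also the interval that belongs to \<open>pos_cfc f T\<close>, so
    one polynomial sequence serves both limits.\<close>
  have le: "onorm (pos_cfc f T) \<le> B"
    by (rule onorm_bound) (auto intro!: cfc_bound T fT B B0)
  obtain q where q: "uniform_limit {0..B} (\<lambda>n. poly (q n)) g sequentially"
    using poly_uniform_approx[OF B0 continuous_on_subset[OF g]] by auto
  have "(\<lambda>n. poly_op (q n) (pos_cfc f T) v) \<longlonglongrightarrow> pos_cfc g (pos_cfc f T) v"
    by (intro cfc_tendsto pf continuous_on_subset[OF g] uniform_limit_on_subset[OF q]) (use le in auto)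
  moreover have "(\<lambda>n. poly_op (q n) (pos_cfc f T) v) \<longlonglongrightarrow> pos_cfc (\<lambda>t. g (f t)) T v"
  proof (rule metric_LIMSEQ_I)
    have gf: "continuous_on {0..onorm T} (\<lambda>t. g (f t))"
      by (rule continuous_on_compose2[OF g fT]) (simp add: image_subset_iff f(2))
    fix e :: real assume e: "e > 0"
    define k where "k = norm v + 1"
    have k: "k > 0" by (simp add: k_def add_nonneg_pos)
    define d where "d = e / (2 * k)"
    have d: "d > 0" using e k by (simp add: d_def)
    then obtain N where N: "\<forall>n\<ge>N. \<forall>t\<in>{0..B}. dist (poly (q n) t) (g t) < d"
      using q unfolding uniform_limit_sequentially_iff by blast
    have "dist (poly_op (q n) (pos_cfc f T) v) (pos_cfc (\<lambda>t. g (f t)) T v) < e" if "n \<ge> N" for n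
    proof -
      have c: "continuous_on {0..onorm T} (\<lambda>t. poly (q n) (f t))"
        by (intro continuous_on_poly fT)
      have "norm (pos_cfc (\<lambda>t. poly (q n) (f t) - g (f t)) T v) \<le> d * norm v"
      proof (rule cfc_bound[OF T continuous_on_diff[OF c gf]])
        fix t assume "0 \<le> t" "t \<le> onorm T"
        then have "f t \<in> {0..B}" using B[of t] f(2)[of t] by auto
        then show "\<bar>poly (q n) (f t) - g (f t)\<bar> \<le> d"
          using N that by (auto simp: dist_real_def less_imp_le)
      qed
      also have "\<dots> \<le> d * k" using d by (simp add: k_def)
      also have "\<dots> = e / 2" using k by (simp add: d_def)
      finally show ?thesis using e by (simp add: dist_norm poly_op_cfc T fT cfc_diff c gf)
    qed
    then show "\<exists>N. \<forall>n\<ge>N. dist (poly_op (q n) (pos_cfc f T) v) (pos_cfc (\<lambda>t. g (f t)) T v) < e"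
      by blast
  qed
  ultimately show "pos_cfc g (pos_cfc f T) v = pos_cfc (\<lambda>t. g (f t)) T v" by (rule LIMSEQ_unique)
qed

text \<open>Uniqueness of the positive root comes from the calculus of the root itself: the function
  \<open>sqrt\<close> applied to the square of \<open>S\<close> gives back \<open>S\<close>.\<close>

lemma op_abs_eq_cfc:
  assumes "bounded_op x"
  shows "op_abs x = pos_cfc sqrt (cadjoint x \<circ> x)"
  unfolding op_abs_def
proof (rule the_equality)
  let ?T = "cadjoint x \<circ> x"
  have T: "pos_op ?T" by (rule pos_op_adjoint_comp[OF assms])
  have s: "continuous_on A sqrt" for A by (intro continuous_intros)
  have "pos_cfc sqrt ?T \<circ> pos_cfc sqrt ?T = pos_cfc (\<lambda>t. sqrt t * sqrt t) ?T"
    by (intro ext) (simp only: o_apply cfc_mult[OF T s s])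
  also have "\<dots> = pos_cfc (\<lambda>t. t) ?T" by (rule cfc_cong) simp
  also have "\<dots> = ?T" by (rule cfc_ident[OF T])
  finally show "pos_op (pos_cfc sqrt ?T) \<and> pos_cfc sqrt ?T \<circ> pos_cfc sqrt ?T = ?T"
    using pos_op_cfc[OF T s] by simp
next
  fix S assume S: "pos_op S \<and> S \<circ> S = cadjoint x \<circ> x"
  then have "cadjoint x \<circ> x = pos_cfc (\<lambda>t. t * t) S"
    by (auto simp: fun_eq_iff cfc_mult continuous_on_id cfc_ident)
  then have "pos_cfc sqrt (cadjoint x \<circ> x) = pos_cfc (\<lambda>t. sqrt (t * t)) S"
    using S by (simp add: cfc_compose continuous_intros)
  also have "\<dots> = pos_cfc (\<lambda>t. t) S" by (rule cfc_cong) simp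
  also have "\<dots> = S" using S by (simp add: cfc_ident)
  finally show "S = pos_cfc sqrt (cadjoint x \<circ> x)" by simp
qed

text \<open>Origin of the exponents \<open>p / 2\<close>: from here on powers of the absolute value
  are functions of \<open>cadjoint x \<circ> x\<close>.\<close>

lemma op_powr_op_abs:
  assumes x: "bounded_op x" and p: "p > 0"
  shows "op_powr (op_abs x) p = pos_cfc (\<lambda>s. s powr (p / 2)) (cadjoint x \<circ> x)"
proof -
  have "op_powr (op_abs x) p = pos_cfc (\<lambda>s. sqrt s powr p) (cadjoint x \<circ> x)"
    unfolding op_powr_def op_abs_eq_cfc[OF x] using p
    by (intro cfc_compose pos_op_adjoint_comp[OF x]) (auto intro!: continuous_intros continuous_on_powr')
  also have "\<dots> = pos_cfc (\<lambda>s. s powr (p / 2)) (cadjoint x \<circ> x)"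
    by (rule cfc_cong) (simp add: powr_half_sqrt[symmetric] powr_powr)
  finally show ?thesis .
qed


section \<open>Von Neumann algebras and traces\<close>

context
  fixes M :: "('a::complex_hilbert \<Rightarrow> 'a) set"
  assumes M: "von_neumann_algebra M"
begin

lemma vna_bounded: "T \<in> M \<Longrightarrow> bounded_op T"
  and vna_adjoint: "T \<in> M \<Longrightarrow> cadjoint T \<in> M"
  using M by (auto simp: von_neumann_algebra_def)

text \<open>The double commutant property with \<open>S\<close> in the commutant of
  \<open>M\<close>; the algebraic closure properties of \<open>M\<close> reduce to commutation with
  such \<open>S\<close>.\<close>

lemma vna_memI:
  assumes "bounded_op T"
    and "\<And>S v. bounded_op S \<Longrightarrow> (\<And>U w. U \<in> M \<Longrightarrow> S (U w) = U (S w)) \<Longrightarrow> T (S v) = S (T v)"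
  shows "T \<in> M"
proof -
  have "T \<in> commutant (commutant M)"
    unfolding commutant_def[of "commutant M"] using assms
    by (auto simp: commutant_def fun_eq_iff)
  then show ?thesis using M by (simp add: von_neumann_algebra_def)
qed

lemma vna_id: "id \<in> M"
  and vna_ident: "(\<lambda>v. v) \<in> M"
  and vna_zero: "(\<lambda>v. 0) \<in> M"
  by (auto intro!: vna_memI simp: bounded_op_zero)

lemma vna_comp: "S \<in> M \<Longrightarrow> T \<in> M \<Longrightarrow> S \<circ> T \<in> M"
proof (rule vna_memI)
  assume "S \<in> M" "T \<in> M"
  then show "bounded_op (S \<circ> T)" by (intro bounded_op_comp vna_bounded)
  fix U v assume "\<And>X w. X \<in> M \<Longrightarrow> U (X w) = X (U w)"
  from this[OF \<open>S \<in> M\<close>] this[OF \<open>T \<in> M\<close>] show "(S \<circ> T) (U v) = U ((S \<circ> T) v)" by simp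
qed

lemma vna_plus: "S \<in> M \<Longrightarrow> T \<in> M \<Longrightarrow> (\<lambda>v. S v + T v) \<in> M"
proof (rule vna_memI)
  assume "S \<in> M" "T \<in> M"
  then show "bounded_op (\<lambda>v. S v + T v)" by (intro bounded_op_plus vna_bounded)
  fix U v assume "bounded_op U" "\<And>X w. X \<in> M \<Longrightarrow> U (X w) = X (U w)"
  from this(1) this(2)[OF \<open>S \<in> M\<close>] this(2)[OF \<open>T \<in> M\<close>]
  show "S (U v) + T (U v) = U (S v + T v)" by (simp add: bounded_op_add)
qed

lemma vna_scaleC: "T \<in> M \<Longrightarrow> (\<lambda>v. c *\<^sub>C T v) \<in> M"
proof (rule vna_memI)
  assume "T \<in> M"
  then show "bounded_op (\<lambda>v. c *\<^sub>C T v)" by (intro bounded_op_scaleC_op vna_bounded)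
  fix U v assume "bounded_op U" "\<And>X w. X \<in> M \<Longrightarrow> U (X w) = X (U w)"
  from this(1) this(2)[OF \<open>T \<in> M\<close>]
  show "c *\<^sub>C T (U v) = U (c *\<^sub>C T v)" by (simp add: bounded_op_scaleC)
qed

lemma vna_scaleR: "T \<in> M \<Longrightarrow> (\<lambda>v. s *\<^sub>R T v) \<in> M"
  by (simp add: scaleR_scaleC vna_scaleC)

lemma vna_minus: "T \<in> M \<Longrightarrow> (\<lambda>v. - T v) \<in> M"
  using vna_scaleR[of T "-1"] by simp

lemma vna_diff: "S \<in> M \<Longrightarrow> T \<in> M \<Longrightarrow> (\<lambda>v. S v - T v) \<in> M"
  using vna_plus[of S "\<lambda>v. - T v"] vna_minus by simp

lemma vna_cfc:
  assumes "T \<in> M" "pos_op T" "continuous_on {0..} f"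
  shows "pos_cfc f T \<in> M"
proof (rule vna_memI)
  show "bounded_op (pos_cfc f T)"
    by (rule bounded_op_cfc[OF assms(2) continuous_on_subset[OF assms(3)]]) auto
  fix S v assume "bounded_op S" "\<And>U w. U \<in> M \<Longrightarrow> S (U w) = U (S w)"
  then show "pos_cfc f T (S v) = S (pos_cfc f T v)"
    using cfc_commutes[OF assms(2,2) _ _ assms(3), of S v] assms(1) by simp
qed

end

lemmas vna_intros = vna_id vna_ident vna_zero vna_comp vna_plus vna_scaleC vna_scaleR vna_minus
  vna_diff vna_adjoint

section \<open>Inequalities for the trace, and symmetric completely positive maps\<close>

locale finite_trace =
  fixes M :: "('a::complex_hilbert \<Rightarrow> 'a) set" and \<tau> :: "('a \<Rightarrow> 'a) \<Rightarrow> complex"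
  assumes finite_vna: "finite_von_neumann_algebra M \<tau>"
begin

lemma vna: "von_neumann_algebra M"
  using finite_vna by (simp add: finite_von_neumann_algebra_def)

lemmas mem_bounded = vna_bounded[OF vna]
lemmas mem_intros = vna_intros[OF vna]

lemma
  assumes "S \<in> M" "T \<in> M"
  shows trace_add: "\<tau> (\<lambda>v. S v + T v) = \<tau> S + \<tau> T"
    and trace_comm: "\<tau> (S \<circ> T) = \<tau> (T \<circ> S)"
  using assms finite_vna by (auto simp: finite_von_neumann_algebra_def linear_on_ops_def)

lemma trace_scaleR:
  assumes "T \<in> M"
  shows "\<tau> (\<lambda>v. s *\<^sub>R T v) = s * \<tau> T"
  using assms finite_vna
  by (simp add: finite_von_neumann_algebra_def linear_on_ops_def scaleR_scaleC scaleC_complex_def)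

lemma trace_minus: "T \<in> M \<Longrightarrow> \<tau> (\<lambda>v. - T v) = - \<tau> T"
  using trace_scaleR[of T "-1"] by simp

lemma trace_diff: "S \<in> M \<Longrightarrow> T \<in> M \<Longrightarrow> \<tau> (\<lambda>v. S v - T v) = \<tau> S - \<tau> T"
  using trace_add[of S "\<lambda>v. - T v"] trace_minus[of T] mem_intros by simp

lemma trace_pos: "T \<in> M \<Longrightarrow> pos_op T \<Longrightarrow> 0 \<le> Re (\<tau> T)"
  using finite_vna by (auto simp: finite_von_neumann_algebra_def complex_nonneg_Reals_iff)

text \<open>\<open>X \<circ> Y\<close> itself need not be positive, but by cyclicity it has the
  trace of the positive operator \<open>sqrt Y \<circ> X \<circ> sqrt Y\<close>.\<close>

lemma trace_mult_pos:
  assumes X: "X \<in> M" "pos_op X" and Y: "Y \<in> M" "pos_op Y"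
  shows "0 \<le> Re (\<tau> (X \<circ> Y))"
proof -
  let ?S = "pos_cfc sqrt Y"
  have s: "continuous_on A sqrt" for A by (intro continuous_intros)
  have S: "?S \<in> M" by (rule vna_cfc[OF vna Y s])
  have pS: "pos_op ?S" by (rule pos_op_cfc[OF Y(2) s]) simp
  have "?S \<circ> ?S = pos_cfc (\<lambda>t. sqrt t * sqrt t) Y"
    by (intro ext) (simp only: o_apply cfc_mult[OF Y(2) s s])
  also have "\<dots> = pos_cfc (\<lambda>t. t) Y" by (rule cfc_cong) simp
  also have "\<dots> = Y" by (rule cfc_ident[OF Y(2)])
  finally have "\<tau> (X \<circ> Y) = \<tau> ((X \<circ> ?S) \<circ> ?S)" by (simp only: comp_assoc)
  also have "\<dots> = \<tau> (cadjoint ?S \<circ> X \<circ> ?S)"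
    using trace_comm[of "X \<circ> ?S" ?S] by (simp add: mem_intros X S pos_op_adjoint[OF pS] o_assoc)
  finally show ?thesis
    using trace_pos[of "cadjoint ?S \<circ> X \<circ> ?S"] pos_op_conj[OF X(2) pos_op_bounded[OF pS]]
    by (simp add: mem_intros X S)
qed

lemma trace_mono:
  assumes "S \<in> M" "T \<in> M" "pos_op (\<lambda>v. T v - S v)"
  shows "Re (\<tau> S) \<le> Re (\<tau> T)"
  using trace_pos[of "\<lambda>v. T v - S v"] assms by (simp add: trace_diff mem_intros)

lemma trace_cfc_mono:
  assumes T: "T \<in> M" "pos_op T" and f: "continuous_on {0..} f" and g: "continuous_on {0..} g"
    and le: "\<And>t. 0 \<le> t \<Longrightarrow> t \<le> onorm T \<Longrightarrow> f t \<le> g t"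
  shows "Re (\<tau> (pos_cfc f T)) \<le> Re (\<tau> (pos_cfc g T))"
proof (rule trace_mono)
  have fT: "continuous_on {0..onorm T} f" by (rule continuous_on_subset[OF f]) auto
  have gT: "continuous_on {0..onorm T} g" by (rule continuous_on_subset[OF g]) auto
  have "pos_op (pos_cfc (\<lambda>t. g t - f t) T)"
    by (rule pos_op_cfc[OF T(2) continuous_on_diff[OF gT fT]]) (simp add: le)
  moreover have "pos_cfc (\<lambda>t. g t - f t) T = (\<lambda>v. pos_cfc g T v - pos_cfc f T v)"
    by (intro ext cfc_diff T fT gT)
  ultimately show "pos_op (\<lambda>v. pos_cfc g T v - pos_cfc f T v)" by simp
qed (intro vna_cfc vna T f g)+

lemma trace_cfc_add:
  assumes T: "T \<in> M" "pos_op T" and f: "continuous_on {0..} f" and g: "continuous_on {0..} g"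
  shows "\<tau> (pos_cfc (\<lambda>t. f t + g t) T) = \<tau> (pos_cfc f T) + \<tau> (pos_cfc g T)"
proof -
  have "pos_cfc (\<lambda>t. f t + g t) T = (\<lambda>v. pos_cfc f T v + pos_cfc g T v)"
    by (intro ext cfc_add T continuous_on_subset[OF f] continuous_on_subset[OF g]) auto
  then show ?thesis by (simp add: trace_add vna_cfc vna T f g)
qed

lemma trace_cfc_scaleR:
  assumes T: "T \<in> M" "pos_op T" and f: "continuous_on {0..} f"
  shows "\<tau> (pos_cfc (\<lambda>t. c * f t) T) = c * \<tau> (pos_cfc f T)"
proof -
  have "pos_cfc (\<lambda>t. c * f t) T = (\<lambda>v. c *\<^sub>R pos_cfc f T v)"
    by (intro ext cfc_scaleR T continuous_on_subset[OF f]) auto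
  then show ?thesis by (simp add: trace_scaleR vna_cfc vna T f)
qed

lemma trace_cfc_const:
  assumes "pos_op T"
  shows "\<tau> (pos_cfc (\<lambda>t. c) T) = c * \<tau> id"
  using trace_scaleR[of id c] mem_intros by (simp add: cfc_const assms)

text \<open>Norm continuity of the trace on functions of \<open>T\<close>, obtained from
  monotonicity and finiteness: a constant error \<open>e\<close> has trace
  \<open>e * \<tau> id\<close>.\<close>

lemma trace_cfc_close:
  assumes T: "T \<in> M" "pos_op T" and f: "continuous_on {0..} f" and g: "continuous_on {0..} g"
    and le: "\<And>t. 0 \<le> t \<Longrightarrow> t \<le> onorm T \<Longrightarrow> \<bar>f t - g t\<bar> \<le> e"
  shows "\<bar>Re (\<tau> (pos_cfc f T)) - Re (\<tau> (pos_cfc g T))\<bar> \<le> e * Re (\<tau> id)"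
proof -
  have ge: "continuous_on {0..} (\<lambda>t. g t + e)" and fe: "continuous_on {0..} (\<lambda>t. f t + e)"
    by (intro continuous_intros f g)+
  have "Re (\<tau> (pos_cfc f T)) \<le> Re (\<tau> (pos_cfc (\<lambda>t. g t + e) T))"
    by (rule trace_cfc_mono[OF T f ge]) (use le in \<open>simp add: abs_le_iff algebra_simps\<close>)
  moreover have "Re (\<tau> (pos_cfc g T)) \<le> Re (\<tau> (pos_cfc (\<lambda>t. f t + e) T))"
    by (rule trace_cfc_mono[OF T g fe]) (use le in \<open>simp add: abs_le_iff algebra_simps\<close>)
  ultimately show ?thesis
    by (simp add: trace_cfc_add[OF T] f g trace_cfc_const[OF T(2)])
qed

text \<open>For polynomials without constant term this is cyclicity combined with
  \<open>x \<circ> r(S) = r(T) \<circ> x\<close>, and constants contribute multiples of the finite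
  number \<open>\<tau> id\<close>. Polynomials approximate \<open>f\<close> on the intervals of
  \<open>S\<close> and \<open>T\<close> at once.\<close>

lemma trace_cfc_adjoint_comp:
  assumes x: "x \<in> M" and f: "continuous_on {0..} f"
  shows "Re (\<tau> (pos_cfc f (cadjoint x \<circ> x))) = Re (\<tau> (pos_cfc f (x \<circ> cadjoint x)))"
proof -
  have bx: "bounded_op x" using x by (rule mem_bounded)
  define S where "S = cadjoint x \<circ> x"
  define T where "T = x \<circ> cadjoint x"
  have S: "S \<in> M" "pos_op S" unfolding S_def using x by (auto intro: mem_intros pos_op_adjoint_comp bx)
  have T: "T \<in> M" "pos_op T"
    unfolding T_def using x pos_op_adjoint_comp[OF bounded_op_adjoint[OF bx]]
    by (auto intro: mem_intros simp: adjoint_adjoint bx)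
  note bS = pos_op_bounded[OF S(2)] and bT = pos_op_bounded[OF T(2)]
  have mem: "poly_op r S \<in> M" "poly_op r T \<in> M" for r
    using vna_cfc[OF vna S, of "poly r"] vna_cfc[OF vna T, of "poly r"]
    by (auto simp: cfc_poly S T continuous_intros)
  have poly: "\<tau> (poly_op q S) = \<tau> (poly_op q T)" for q
  proof (cases q)
    case (pCons a r)
    have inter: "x \<circ> poly_op r S = poly_op r T \<circ> x"
    proof
      fix v show "(x \<circ> poly_op r S) v = (poly_op r T \<circ> x) v"
        unfolding o_apply by (rule poly_op_intertwine[OF bT bS bx]) (simp add: S_def T_def)
    qed
    have "poly_op q S = (\<lambda>v. a *\<^sub>R id v + (cadjoint x \<circ> (x \<circ> poly_op r S)) v)"
      by (intro ext) (simp add: pCons poly_op_pCons[OF bS], simp add: S_def)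
    then have "\<tau> (poly_op q S) = a * \<tau> id + \<tau> (cadjoint x \<circ> (x \<circ> poly_op r S))"
      using trace_add[of "\<lambda>v. a *\<^sub>R id v" "cadjoint x \<circ> (x \<circ> poly_op r S)"] trace_scaleR[of id a]
      by (simp add: mem_intros mem x del: id_apply)
    also have "\<tau> (cadjoint x \<circ> (x \<circ> poly_op r S)) = \<tau> ((poly_op r T \<circ> x) \<circ> cadjoint x)"
      by (subst trace_comm) (auto intro!: mem_intros mem x simp: inter)
    also have "\<dots> = \<tau> (T \<circ> poly_op r T)"
      using trace_comm[OF mem(2) T(1), of r] by (simp add: T_def comp_assoc)
    also have "a * \<tau> id + \<tau> (T \<circ> poly_op r T) = \<tau> (poly_op q T)"
    proof -
      have "poly_op q T = (\<lambda>v. a *\<^sub>R id v + (T \<circ> poly_op r T) v)"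
        by (auto simp: pCons poly_op_pCons[OF bT])
      then show ?thesis
        using trace_add[of "\<lambda>v. a *\<^sub>R id v" "T \<circ> poly_op r T"] trace_scaleR[of id a]
        by (simp add: mem_intros mem T del: id_apply)
    qed
    finally show ?thesis .
  qed
  define R where "R = max (onorm S) (onorm T)"
  have R0: "0 \<le> R" using onorm_nonneg[OF bS] by (simp add: R_def)
  obtain p where p: "uniform_limit {0..R} (\<lambda>n. poly (p n)) f sequentially"
    using poly_uniform_approx[OF R0 continuous_on_subset[OF f]] by auto
  define A where "A = Re (\<tau> (pos_cfc f S))"
  define B where "B = Re (\<tau> (pos_cfc f T))"
  have "\<bar>A - B\<bar> \<le> 0 + e" if e: "e > 0" for e
  proof -
    have t0: "0 \<le> Re (\<tau> id)" by (rule trace_pos) (auto intro: mem_intros)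
    define k where "k = Re (\<tau> id) + 1"
    have k: "k > 0" using t0 by (simp add: k_def)
    define d where "d = e / (2 * k)"
    have d: "d > 0" using e k by (simp add: d_def)
    then obtain n where n: "\<forall>t\<in>{0..R}. dist (poly (p n) t) (f t) < d"
      using p unfolding uniform_limit_sequentially_iff by blast
    have "\<bar>A - Re (\<tau> (pos_cfc (poly (p n)) S))\<bar> \<le> d * Re (\<tau> id)"
      unfolding A_def using n
      by (intro trace_cfc_close S f continuous_intros)
        (auto simp: R_def dist_real_def abs_minus_commute less_imp_le)
    moreover have "\<bar>B - Re (\<tau> (pos_cfc (poly (p n)) T))\<bar> \<le> d * Re (\<tau> id)"
      unfolding B_def using n
      by (intro trace_cfc_close T f continuous_intros)
        (auto simp: R_def dist_real_def abs_minus_commute less_imp_le)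
    ultimately have "\<bar>A - B\<bar> \<le> 2 * (d * Re (\<tau> id))" by (simp add: cfc_poly S T poly)
    also have "\<dots> \<le> 2 * (d * k)" using d by (simp add: k_def)
    also have "\<dots> = e" using k by (simp add: d_def)
    finally show ?thesis by simp
  qed
  then have "\<bar>A - B\<bar> \<le> 0" by (rule field_le_epsilon)
  then show ?thesis by (simp add: A_def B_def S_def T_def)
qed

end

text \<open>\<open>K\<close> is an upper bound and not the norm itself, so that the identity map is
  an instance with \<open>K = 1\<close> even on a zero space, where \<open>onorm id\<close> is
  0.\<close>

locale symmetric_cp_map = finite_trace M \<tau> for M :: "('a::complex_hilbert \<Rightarrow> 'a) set" and \<tau> +
  fixes \<Phi> :: "('a \<Rightarrow> 'a) \<Rightarrow> ('a \<Rightarrow> 'a)" and K :: real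
  assumes cp: "completely_positive M \<Phi>" and symmetric: "trace_symmetric M \<tau> \<Phi>"
    and K: "onorm (\<Phi> id) \<le> K"
begin

lemma map_mem: "T \<in> M \<Longrightarrow> \<Phi> T \<in> M"
  using cp by (simp add: completely_positive_def)

lemma map_add: "S \<in> M \<Longrightarrow> T \<in> M \<Longrightarrow> \<Phi> (\<lambda>v. S v + T v) = (\<lambda>v. \<Phi> S v + \<Phi> T v)"
  using cp by (auto simp: completely_positive_def linear_on_ops_def)

lemma map_scaleR: "T \<in> M \<Longrightarrow> \<Phi> (\<lambda>v. s *\<^sub>R T v) = (\<lambda>v. s *\<^sub>R \<Phi> T v)"
  using cp by (auto simp: completely_positive_def linear_on_ops_def scaleR_scaleC)

lemma map_diff: "S \<in> M \<Longrightarrow> T \<in> M \<Longrightarrow> \<Phi> (\<lambda>v. S v - T v) = (\<lambda>v. \<Phi> S v - \<Phi> T v)"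
  using map_add[of S "\<lambda>v. (-1) *\<^sub>R T v"] map_scaleR[of T "-1"] mem_intros(7)[of T "-1"] by simp

lemma map_matrix_pos:
  "(\<And>i j. i < n \<Longrightarrow> j < n \<Longrightarrow> X i j \<in> M) \<Longrightarrow> pos_op_matrix n X \<Longrightarrow> pos_op_matrix n (\<lambda>i j. \<Phi> (X i j))"
  using cp by (simp add: completely_positive_def)

lemma map_pos:
  assumes "T \<in> M" "pos_op T"
  shows "pos_op (\<Phi> T)"
proof -
  have "pos_op_matrix 1 (\<lambda>i j. T)" using assms by (simp add: pos_op_matrix_def pos_op_def)
  then have "pos_op_matrix 1 (\<lambda>i j. \<Phi> T)" using map_matrix_pos[of 1 "\<lambda>i j. T"] assms by simp
  then have "cinner v (\<Phi> T v) \<in> \<real>\<^sub>\<ge>\<^sub>0" for v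
    unfolding pos_op_matrix_def by (auto dest: spec[where x = "\<lambda>i. v"])
  then show ?thesis using mem_bounded[OF map_mem[OF assms(1)]] by (simp add: pos_op_def)
qed

lemma K_nonneg: "0 \<le> K"
  using onorm_nonneg[OF mem_bounded[OF map_mem[OF vna_id[OF vna]]]] K by linarith

lemma pos_K_minus: "pos_op (\<lambda>v. K *\<^sub>R v - \<Phi> id v)"
  by (rule pos_op_onorm_minus[OF mem_bounded[OF map_mem[OF vna_id[OF vna]]]
      pos_op_selfadjoint[OF map_pos[OF vna_id[OF vna] pos_op_id]] K])

text \<open>The two marginals of the form \<open>\<tau>(\<Phi>(f(a)) g(c))\<close>. The second is
  bounded through \<open>\<Phi> id \<le> K\<close>; trace symmetry and cyclicity reduce the first to
  it.\<close>

lemma trace_map_le: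
  assumes X: "X \<in> M" "pos_op X"
  shows "Re (\<tau> (\<Phi> X)) \<le> K * Re (\<tau> X)" "Re (\<tau> (\<Phi> id \<circ> X)) \<le> K * Re (\<tau> X)"
proof -
  have mem: "(\<lambda>v. K *\<^sub>R X v) \<in> M" "\<Phi> id \<circ> X \<in> M" by (intro mem_intros map_mem X)+
  have "(\<lambda>v. K *\<^sub>R v - \<Phi> id v) \<in> M" by (intro mem_intros map_mem)
  from trace_mult_pos[OF this pos_K_minus X]
  moreover have "(\<lambda>v. K *\<^sub>R v - \<Phi> id v) \<circ> X = (\<lambda>v. K *\<^sub>R X v - (\<Phi> id \<circ> X) v)" by auto
  ultimately have "0 \<le> Re (\<tau> (\<lambda>v. K *\<^sub>R X v - (\<Phi> id \<circ> X) v))" by simp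
  then show *: "Re (\<tau> (\<Phi> id \<circ> X)) \<le> K * Re (\<tau> X)"
    using trace_diff[OF mem] trace_scaleR[OF X(1), of K] by (simp del: o_apply)
  have "\<tau> (\<Phi> X) = \<tau> (X \<circ> \<Phi> id)"
    using symmetric X mem_intros(1) unfolding trace_symmetric_def by (metis comp_id)
  also have "\<dots> = \<tau> (\<Phi> id \<circ> X)" using X by (intro trace_comm mem_intros map_mem)
  finally show "Re (\<tau> (\<Phi> X)) \<le> K * Re (\<tau> X)" using * by simp
qed

end


section \<open>A trace inequality of Young type\<close>

context symmetric_cp_map
begin

text \<open>For \<open>f, g \<ge> 0\<close> the form \<open>\<tau>(\<Phi>(f(a)) g(c))\<close> is nonnegative, and hence behaves like the integral of
  \<open>f(s) g(t)\<close> for a measure on the plane. The proof approximates functions of \<open>t\<close> by Bernstein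
  polynomials, whose basis elements are nonnegative and sum to 1.\<close>

lemma trace_young:
  assumes a: "a \<in> M" "pos_op a" and c: "c \<in> M" "pos_op c"
    and cont: "continuous_on {0..} f" "continuous_on {0..} g"
      "continuous_on {0..} u" "continuous_on {0..} w"
    and nonneg: "\<And>s. 0 \<le> s \<Longrightarrow> 0 \<le> f s" "\<And>s. 0 \<le> s \<Longrightarrow> 0 \<le> u s" "\<And>s. 0 \<le> s \<Longrightarrow> 0 \<le> w s"
    and le: "\<And>s t. 0 \<le> s \<Longrightarrow> 0 \<le> t \<Longrightarrow> f s * g t \<le> u s + w t"
  shows "Re (\<tau> (\<Phi> (pos_cfc f a) \<circ> pos_cfc g c)) \<le>
    K * (Re (\<tau> (pos_cfc u a)) + Re (\<tau> (pos_cfc w c)))"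
proof -
  define \<beta> where "\<beta> f g = Re (\<tau> (\<Phi> (pos_cfc f a) \<circ> pos_cfc g c))" for f g
  let ?C = "\<lambda>f :: real \<Rightarrow> real. continuous_on {0..} f"
  have ca: "continuous_on {0..onorm a} f" and cc: "continuous_on {0..onorm c} f" if "?C f" for f
    by (rule continuous_on_subset[OF that]; simp)+
  note mem = vna_cfc[OF vna a] vna_cfc[OF vna c] map_mem mem_intros
  have m: "\<Phi> (pos_cfc f a) \<circ> pos_cfc g c \<in> M" if "?C f" "?C g" for f g
    by (intro mem that)
  have add_l: "\<beta> (\<lambda>s. f s + f' s) g = \<beta> f g + \<beta> f' g" if "?C f" "?C f'" "?C g" for f f' g
  proof -
    have "pos_cfc (\<lambda>s. f s + f' s) a = (\<lambda>v. pos_cfc f a v + pos_cfc f' a v)"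
      by (intro ext cfc_add a ca that)
    then have "\<Phi> (pos_cfc (\<lambda>s. f s + f' s) a) = (\<lambda>v. \<Phi> (pos_cfc f a) v + \<Phi> (pos_cfc f' a) v)"
      by (simp add: map_add mem that)
    then show ?thesis
      using trace_add[OF m[of f g] m[of f' g]] that by (simp add: \<beta>_def o_def)
  qed
  have scale_l: "\<beta> (\<lambda>s. r * f s) g = r * \<beta> f g" if "?C f" "?C g" for r f g
  proof -
    have "pos_cfc (\<lambda>s. r * f s) a = (\<lambda>v. r *\<^sub>R pos_cfc f a v)"
      by (intro ext cfc_scaleR a ca that)
    then have "\<Phi> (pos_cfc (\<lambda>s. r * f s) a) = (\<lambda>v. r *\<^sub>R \<Phi> (pos_cfc f a) v)"
      by (simp add: map_scaleR mem that)
    then show ?thesis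
      using trace_scaleR[OF m[of f g], of r] that by (simp add: \<beta>_def o_def)
  qed
  have add_r: "\<beta> f (\<lambda>s. g s + g' s) = \<beta> f g + \<beta> f g'" if "?C f" "?C g" "?C g'" for f g g'
  proof -
    have "pos_cfc (\<lambda>s. g s + g' s) c = (\<lambda>v. pos_cfc g c v + pos_cfc g' c v)"
      by (intro ext cfc_add c cc that)
    then show ?thesis
      using trace_add[OF m[of f g] m[of f g']] that
      by (simp add: \<beta>_def o_def bounded_op_add[OF mem_bounded] mem)
  qed
  have scale_r: "\<beta> f (\<lambda>s. r * g s) = r * \<beta> f g" if "?C f" "?C g" for r f g
  proof -
    have "pos_cfc (\<lambda>s. r * g s) c = (\<lambda>v. r *\<^sub>R pos_cfc g c v)"
      by (intro ext cfc_scaleR c cc that)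
    then show ?thesis
      using trace_scaleR[OF m[of f g], of r] that
      by (simp add: \<beta>_def o_def bounded_op_scaleR[OF mem_bounded] mem)
  qed
  have pos: "0 \<le> \<beta> f g" if "?C f" "?C g" "\<And>s. 0 \<le> s \<Longrightarrow> 0 \<le> f s"
    "\<And>t. 0 \<le> t \<Longrightarrow> t \<le> onorm c \<Longrightarrow> 0 \<le> g t" for f g
    unfolding \<beta>_def
    by (intro trace_mult_pos mem map_pos pos_op_cfc a c ca cc that)
  have mono_l: "\<beta> f g \<le> \<beta> f' g" if "?C f" "?C f'" "?C g" "\<And>s. 0 \<le> s \<Longrightarrow> f s \<le> f' s"
    "\<And>t. 0 \<le> t \<Longrightarrow> t \<le> onorm c \<Longrightarrow> 0 \<le> g t" for f f' g
    using add_l[of f "\<lambda>s. f' s - f s" g] pos[of "\<lambda>s. f' s - f s" g] that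
    by (simp add: continuous_on_diff)
  have mono_r: "\<beta> f g \<le> \<beta> f g'" if "?C f" "?C g" "?C g'" "\<And>s. 0 \<le> s \<Longrightarrow> 0 \<le> f s"
    "\<And>t. 0 \<le> t \<Longrightarrow> t \<le> onorm c \<Longrightarrow> g t \<le> g' t" for f g g'
    using add_r[of f g "\<lambda>s. g' s - g s"] pos[of f "\<lambda>s. g' s - g s"] that
    by (simp add: continuous_on_diff)
  have sum_r: "\<beta> f (\<lambda>t. \<Sum>k\<le>m. d k * b k t) = (\<Sum>k\<le>m. d k * \<beta> f (b k))"
    if "?C f" "\<And>k. ?C (b k)" for f b d and m :: nat
  proof (induction m)
    case (Suc m)
    then show ?case
      by (simp add: add_r scale_r that continuous_on_sum continuous_on_mult_left)
  qed (simp add: scale_r that)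
  have one: "?C (\<lambda>s. 1)" by simp
  \<comment> \<open>The added 1 makes the Bernstein interval nondegenerate when
    \<open>c = 0\<close>.\<close>
  define R where "R = onorm c + 1"
  have R: "R > 0" "onorm c \<le> R" using onorm_nonneg[OF mem_bounded[OF c(1)]] by (auto simp: R_def)
  define b where "b n k = poly (bernstein_basis R n k)" for n k
  have b: "?C (b n k)" for n k unfolding b_def by (intro continuous_intros)
  have b0: "0 \<le> b n k t" if "0 \<le> t" "t \<le> onorm c" for n k t
    unfolding b_def using that R by (intro bernstein_basis_nonneg) auto
  define B where "B n h t = (\<Sum>k\<le>n. h (R * k / n) * b n k t)" for n h t
  have B: "B n h = poly (bernstein_poly R n h)" for n h
    by (auto simp: B_def b_def poly_bernstein_poly)
  have contB: "?C (B n h)" for n h unfolding B by (intro continuous_intros)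
  have B1: "B n (\<lambda>t. 1) = (\<lambda>t. 1)" if "n > 0" for n
  proof -
    have "bernstein_poly R n (\<lambda>t. 1) = 1"
      using bernstein_basis_sum[OF R(1), of n] by (simp add: bernstein_poly_def)
    then show ?thesis unfolding B by auto
  qed
  have "\<beta> f g \<le> \<beta> u (\<lambda>t. 1) + \<beta> (\<lambda>s. 1) w"
  proof (rule field_le_epsilon)
    fix e' :: real assume e': "e' > 0"
    \<comment> \<open>Replacing \<open>g\<close> and \<open>w\<close> by Bernstein polynomials costs
      \<open>e\<close> times the first two summands of \<open>k\<close>; the 1 makes
      \<open>k\<close> positive.\<close>
    define k where "k = \<beta> f (\<lambda>t. 1) + \<beta> (\<lambda>s. 1) (\<lambda>t. 1) + 1"
    have k: "k > 0" unfolding k_def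
      by (intro add_nonneg_pos add_nonneg_nonneg pos cont one nonneg) auto
    define e where "e = e' / k"
    have e: "e > 0" using e' k by (simp add: e_def)
    have unif: "\<exists>N. \<forall>n\<ge>N. \<forall>t\<in>{0..R}. dist (B n h t) (h t) < e" if "?C h" for h
      using bernstein_poly_uniform_limit[OF R(1) continuous_on_subset[OF that]] e
      unfolding uniform_limit_sequentially_iff B by auto
    from unif[OF cont(2)] unif[OF cont(4)] obtain N1 N2 where
      N1: "\<forall>n\<ge>N1. \<forall>t\<in>{0..R}. dist (B n g t) (g t) < e" and
      N2: "\<forall>n\<ge>N2. \<forall>t\<in>{0..R}. dist (B n w t) (w t) < e" by blast
    define n where "n = N1 + N2 + 1"
    have close: "g t \<le> B n g t + e * 1" "B n w t \<le> w t + e * 1" if "0 \<le> t" "t \<le> onorm c" for t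
    proof -
      have "dist (B n g t) (g t) < e" "dist (B n w t) (w t) < e"
        using N1 N2 that R by (auto simp: n_def)
      then show "g t \<le> B n g t + e * 1" "B n w t \<le> w t + e * 1" by (auto simp: dist_real_def)
    qed
    have "\<beta> f g \<le> \<beta> f (\<lambda>t. B n g t + e * 1)"
      by (intro mono_r cont contB nonneg continuous_intros close)
    also have "\<dots> = \<beta> f (B n g) + e * \<beta> f (\<lambda>t. 1)"
      using add_r[OF cont(1) contB[of n g] continuous_on_mult_left[OF one, of e]]
      by (simp only: scale_r[OF cont(1) one])
    also have "\<beta> f (B n g) = (\<Sum>k\<le>n. g (R * k / n) * \<beta> f (b n k))"
      unfolding B_def by (rule sum_r[OF cont(1) b])
    also have "\<dots> \<le> (\<Sum>k\<le>n. \<beta> u (b n k) + w (R * k / n) * \<beta> (\<lambda>s. 1) (b n k))"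
    proof (rule sum_mono)
      fix k :: nat
      \<comment> \<open>At the node \<open>t = R * k / n\<close> the scalar hypothesis is an
        inequality between functions of \<open>s\<close> alone, in which the form is monotone
        because \<open>b n k\<close> is nonnegative on \<open>{0..onorm c}\<close>. A node may
        exceed \<open>onorm c\<close>; \<open>le\<close> covers the whole half-line.\<close>
      have "0 \<le> R * k / n" using R by simp
      then have "\<beta> (\<lambda>s. g (R * k / n) * f s) (b n k) \<le> \<beta> (\<lambda>s. u s + w (R * k / n) * 1) (b n k)"
        by (intro mono_l continuous_intros cont b b0) (use le in \<open>auto simp: mult.commute\<close>)
      then show "g (R * k / n) * \<beta> f (b n k) \<le> \<beta> u (b n k) + w (R * k / n) * \<beta> (\<lambda>s. 1) (b n k)"
        unfolding scale_l[OF cont(1) b] add_l[OF cont(3) continuous_on_mult_left[OF one] b]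
          scale_l[OF one b] .
    qed
    also have "\<dots> = \<beta> u (\<lambda>t. \<Sum>k\<le>n. 1 * b n k t) + \<beta> (\<lambda>s. 1) (B n w)"
      unfolding sum.distrib B_def sum_r[OF cont(3) b] sum_r[OF one b] by simp
    \<comment> \<open>The basis is a partition of unity, so the sum over the nodes collapses to a
      marginal.\<close>
    also have "(\<lambda>t. \<Sum>k\<le>n. 1 * b n k t) = (\<lambda>t. 1)"
      using B1[of n] by (simp add: B_def fun_eq_iff n_def)
    also have "\<beta> (\<lambda>s. 1) (B n w) \<le> \<beta> (\<lambda>s. 1) (\<lambda>t. w t + e * 1)"
      by (intro mono_r cont contB one continuous_intros close) simp
    also have "\<dots> = \<beta> (\<lambda>s. 1) w + e * \<beta> (\<lambda>s. 1) (\<lambda>t. 1)"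
      using add_r[OF one cont(4) continuous_on_mult_left[OF one, of e]]
      by (simp only: scale_r[OF one one])
    finally have "\<beta> f g \<le> \<beta> u (\<lambda>t. 1) + \<beta> (\<lambda>s. 1) w + e * (k - 1)"
      by (simp add: k_def algebra_simps)
    also have "e * (k - 1) \<le> e'" using e k by (simp add: e_def field_simps)
    finally show "\<beta> f g \<le> \<beta> u (\<lambda>t. 1) + \<beta> (\<lambda>s. 1) w + e'" by simp
  qed
  also have "\<beta> u (\<lambda>t. 1) = Re (\<tau> (\<Phi> (pos_cfc u a)))"
    by (simp add: \<beta>_def cfc_const c o_def)
  also have "\<dots> \<le> K * Re (\<tau> (pos_cfc u a))"
    by (intro trace_map_le mem cont pos_op_cfc a ca nonneg)
  also have "\<beta> (\<lambda>s. 1) w = Re (\<tau> (\<Phi> id \<circ> pos_cfc w c))"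
    by (simp add: \<beta>_def cfc_const a id_def)
  also have "\<dots> \<le> K * Re (\<tau> (pos_cfc w c))"
    by (intro trace_map_le mem cont pos_op_cfc c cc nonneg)
  finally show ?thesis by (simp add: \<beta>_def algebra_simps)
qed

end


section \<open>Two-by-two operator matrices\<close>

definition matrix2 :: "'b \<Rightarrow> 'b \<Rightarrow> 'b \<Rightarrow> 'b \<Rightarrow> nat \<Rightarrow> nat \<Rightarrow> 'b"
  where "matrix2 A B C D i j = (if i = 0 then if j = 0 then A else B else if j = 0 then C else D)"

lemma pos_op_matrix2:
  "pos_op_matrix 2 (matrix2 A B C D) \<longleftrightarrow>
    (\<forall>v w. cinner v (A v) + cinner v (B w) + cinner w (C v) + cinner w (D w) \<in> \<real>\<^sub>\<ge>\<^sub>0)"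
proof -
  have "pos_op_matrix 2 (matrix2 A B C D) \<longleftrightarrow>
    (\<forall>v. cinner (v 0) (A (v 0)) + cinner (v 0) (B (v (Suc 0))) + cinner (v (Suc 0)) (C (v 0))
      + cinner (v (Suc 0)) (D (v (Suc 0))) \<in> \<real>\<^sub>\<ge>\<^sub>0)" (is "_ \<longleftrightarrow> (\<forall>v. ?P (v 0) (v (Suc 0)))")
    by (simp add: pos_op_matrix_def matrix2_def numeral_2_eq_2 lessThan_Suc algebra_simps)
  also have "\<dots> \<longleftrightarrow> (\<forall>v w. ?P v w)"
  proof (intro iffI allI)
    fix v w assume "\<forall>v. ?P (v 0) (v (Suc 0))"
    from spec[OF this, of "\<lambda>i. if i = 0 then v else w"] show "?P v w" by simp
  qed blast
  finally show ?thesis .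
qed

lemma cfc_form_mono:
  assumes T: "pos_op T" and f: "continuous_on {0..} f" and g: "continuous_on {0..} g"
    and le: "\<And>t. 0 \<le> t \<Longrightarrow> f t \<le> g t"
  shows "Re (cinner v (pos_cfc f T v)) \<le> Re (cinner v (pos_cfc g T v))"
proof -
  have c: "continuous_on {0..onorm T} f" "continuous_on {0..onorm T} g"
    by (rule continuous_on_subset[OF f] continuous_on_subset[OF g]; simp)+
  have "pos_op (pos_cfc (\<lambda>t. g t - f t) T)"
    by (rule pos_op_cfc[OF T continuous_on_diff[OF c(2,1)]]) (simp add: le)
  from pos_op_Re[OF this, of v] show ?thesis
    by (simp add: cfc_diff[OF T c(2,1)] cinner_diff_right)
qed

context
  fixes x :: "'a::complex_hilbert \<Rightarrow> 'a"
  assumes x: "bounded_op x"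
begin

lemma pos_op_comp_adjoint: "pos_op (x \<circ> cadjoint x)"
  using pos_op_adjoint_comp[OF bounded_op_adjoint[OF x]] by (simp add: adjoint_adjoint x)

lemma cfc_swap:
  assumes "continuous_on {0..} f"
  shows "x (pos_cfc f (cadjoint x \<circ> x) v) = pos_cfc f (x \<circ> cadjoint x) (x v)"
  by (rule cfc_commutes[OF pos_op_comp_adjoint pos_op_adjoint_comp[OF x] x _ assms]) simp

text \<open>\<open>cfc_swap\<close> rewrites the vector as \<open>x\<close> applied to a function of
  \<open>cadjoint x \<circ> x\<close>; moving \<open>x\<close> across the inner product produces the
  factor \<open>s\<close>.\<close>

lemma norm_cfc_swap:
  assumes f: "continuous_on {0..} f"
  shows "(norm (pos_cfc f (x \<circ> cadjoint x) (x v)))\<^sup>2 =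
    Re (cinner v (pos_cfc (\<lambda>s. f s * (s * f s)) (cadjoint x \<circ> x) v))"
proof -
  let ?T = "cadjoint x \<circ> x"
  have T: "pos_op ?T" by (rule pos_op_adjoint_comp[OF x])
  have c: "continuous_on {0..onorm ?T} f" by (rule continuous_on_subset[OF f]) simp
  have "(norm (pos_cfc f (x \<circ> cadjoint x) (x v)))\<^sup>2 =
      Re (cinner (pos_cfc f ?T v) (?T (pos_cfc f ?T v)))"
    by (simp add: Re_cinner_self[symmetric] cfc_swap[OF f, symmetric] cinner_adjoint_right x)
  also have "\<dots> = Re (cinner v (pos_cfc (\<lambda>s. f s * (s * f s)) ?T v))"
    by (simp only: cfc_mult[OF T] cfc_ident[OF T] c continuous_on_id continuous_on_mult
        cfc_selfadjoint[OF T c])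
  finally show ?thesis .
qed

text \<open>With \<open>g(s) = (\<surd>s + e)\<^bsup>-1/2\<^esup>\<close>, expand \<open>\<parallel>g(xx\<^sup>*) (|x\<^sup>*| v + x w)\<parallel>\<^sup>2 \<ge> 0\<close> and let \<open>e\<close> tend to 0.\<close>

lemma pos_op_matrix_abs:
  "pos_op_matrix 2 (matrix2 (pos_cfc sqrt (x \<circ> cadjoint x)) x (cadjoint x)
    (pos_cfc sqrt (cadjoint x \<circ> x)))"
  unfolding pos_op_matrix2
proof (intro allI)
  fix v w
  let ?S = "x \<circ> cadjoint x" and ?T = "cadjoint x \<circ> x"
  have S: "pos_op ?S" and T: "pos_op ?T" by (rule pos_op_comp_adjoint pos_op_adjoint_comp[OF x])+
  have sq: "continuous_on {0..} sqrt" by (intro continuous_intros)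
  have cS: "continuous_on {0..onorm ?S} f" if "continuous_on {0..} f" for f :: "real \<Rightarrow> real"
    by (rule continuous_on_subset[OF that]) simp
  let ?A = "pos_cfc sqrt ?S" and ?B = "pos_cfc sqrt ?T"
  have pA: "pos_op ?A" and pB: "pos_op ?B"
    by (intro pos_op_cfc S T continuous_on_subset[OF sq]; simp)+
  have adj: "cinner w (cadjoint x v) = cnj (cinner v (x w))"
    by (subst cinner_commute) (simp add: cinner_adjoint_left x)
  have "Re (cinner v (?A v)) + 2 * Re (cinner v (x w)) + Re (cinner w (?B w)) \<ge> 0"
  proof (rule field_le_epsilon)
    fix e' :: real assume e': "e' > 0"
    define k where "k = 2 * (norm v * norm w) + 1"
    have k: "k > 0" by (simp add: k_def add_nonneg_pos)
    define e where "e = e' / k"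
    have e: "e > 0" using e' k by (simp add: e_def)
    have pos: "sqrt s + e > 0" if "0 \<le> s" for s using that e by (simp add: add_nonneg_pos)
    define g where "g s = 1 / sqrt (sqrt s + e)" for s
    have g: "continuous_on {0..} g" unfolding g_def using pos by (intro continuous_intros) (auto, fastforce+)
    have gg: "g s * g s = 1 / (sqrt s + e)" if "0 \<le> s" for s
      using pos[OF that] by (simp add: g_def)
    let ?G = "pos_cfc g ?S"
    \<comment> \<open>Both squared norms in the expansion have the weight
      \<open>s / (sqrt s + e)\<close>, so this single estimate bounds them by the diagonal
      entries.\<close>
    have le: "s / (sqrt s + e) \<le> sqrt s" if "0 \<le> s" for s
      using pos[OF that] that e by (simp add: divide_le_eq algebra_simps)
    have "0 \<le> (norm (?G (?A v + x w)))\<^sup>2" by simp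
    also have "\<dots> = (norm (?G (?A v)))\<^sup>2 + 2 * Re (cinner (?G (?A v)) (?G (x w))) + (norm (?G (x w)))\<^sup>2"
      by (simp only: bounded_op_add[OF bounded_op_cfc[OF S cS[OF g]]] norm_add_sq)
    finally have 0: "0 \<le> \<dots>" .
    have "(norm (?G (?A v)))\<^sup>2 = Re (cinner v (pos_cfc (\<lambda>s. sqrt s * (g s * (g s * sqrt s))) ?S v))"
      by (simp only: Re_cinner_self[symmetric] cfc_mult[OF S] cS[OF g] cS[OF sq] continuous_on_mult
          cfc_selfadjoint[OF S])
    also have "\<dots> \<le> Re (cinner v (?A v))"
    proof (intro cfc_form_mono S continuous_intros g)
      fix s :: real assume s: "0 \<le> s"
      have "sqrt s * (g s * (g s * sqrt s)) = (g s * g s) * s" using s by (simp add: mult_ac)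
      then show "sqrt s * (g s * (g s * sqrt s)) \<le> sqrt s" using le[OF s] by (simp add: gg[OF s])
    qed
    finally have A: "(norm (?G (?A v)))\<^sup>2 \<le> Re (cinner v (?A v))" .
    have AG: "cinner (?G (?A v)) (?G (x w)) = cinner v (pos_cfc (\<lambda>s. sqrt s * (g s * g s)) ?S (x w))"
      by (simp only: cfc_mult[OF S] cS[OF g] cS[OF sq] continuous_on_mult cfc_selfadjoint[OF S])
    have "(norm (?G (x w)))\<^sup>2 = Re (cinner w (pos_cfc (\<lambda>s. g s * (s * g s)) ?T w))"
      by (rule norm_cfc_swap[OF g])
    also have "\<dots> \<le> Re (cinner w (?B w))"
    proof (intro cfc_form_mono T continuous_intros g)
      fix s :: real assume s: "0 \<le> s"
      have "g s * (s * g s) = (g s * g s) * s" by simp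
      then show "g s * (s * g s) \<le> sqrt s" using le[OF s] by (simp add: gg[OF s])
    qed
    finally have B: "(norm (?G (x w)))\<^sup>2 \<le> Re (cinner w (?B w))" .
    have 1: "0 \<le> Re (cinner v (?A v)) +
        2 * Re (cinner v (pos_cfc (\<lambda>s. sqrt s * (g s * g s)) ?S (x w))) + Re (cinner w (?B w))"
      using 0 A B unfolding AG by linarith
    \<comment> \<open>\<open>h(s) = e / (sqrt s + e)\<close> is what the weight of the cross term
      lacks to be 1.\<close>
    define h where "h s = e * (g s * g s)" for s
    have h: "continuous_on {0..} h" unfolding h_def by (intro continuous_intros g)
    have "x w = pos_cfc (\<lambda>s. sqrt s * (g s * g s) + h s) ?S (x w)"
    proof -
      have "pos_cfc (\<lambda>s. sqrt s * (g s * g s) + h s) ?S = pos_cfc (\<lambda>s. 1) ?S"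
        by (rule cfc_cong) (use pos in \<open>simp add: h_def gg add_divide_distrib[symmetric], fastforce\<close>)
      then show ?thesis by (simp add: cfc_const S)
    qed
    also have "\<dots> = pos_cfc (\<lambda>s. sqrt s * (g s * g s)) ?S (x w) + pos_cfc h ?S (x w)"
      by (intro cfc_add S cS continuous_intros g h)
    finally have "Re (cinner v (x w)) = Re (cinner v (pos_cfc (\<lambda>s. sqrt s * (g s * g s)) ?S (x w)))
        + Re (cinner v (pos_cfc h ?S (x w)))"
      by (metis cinner_add_right plus_complex.sel(1))
    \<comment> \<open>\<open>h\<close> equals 1 at 0 for every \<open>e\<close>, so it is not small
      by itself. The factor \<open>x\<close> helps: it contributes \<open>s\<close>, and
      \<open>s * h(s)\<^sup>2 \<le> e\<^sup>2\<close>.\<close>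
    moreover have "\<bar>Re (cinner v (pos_cfc h ?S (x w)))\<bar> \<le> norm v * (e * norm w)"
    proof -
      have "(norm (pos_cfc h ?S (x w)))\<^sup>2 = Re (cinner w (pos_cfc (\<lambda>s. h s * (s * h s)) ?T w))"
        by (rule norm_cfc_swap[OF h])
      also have "\<dots> \<le> Re (cinner w (pos_cfc (\<lambda>s. e\<^sup>2) ?T w))"
      proof (intro cfc_form_mono T continuous_intros h)
        fix s :: real assume s: "0 \<le> s"
        have "h s * (s * h s) = (e * (sqrt s / (sqrt s + e)))\<^sup>2"
          using s by (simp add: h_def gg power2_eq_square power_divide)
        also have "\<dots> \<le> e\<^sup>2"
          using pos[OF s] s e by (intro power_mono) (auto simp: divide_le_eq)
        finally show "h s * (s * h s) \<le> e\<^sup>2" .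
      qed
      also have "\<dots> = (e * norm w)\<^sup>2"
        by (simp add: cfc_const T cinner_scaleR_right Re_cinner_self power_mult_distrib)
      finally have "norm (pos_cfc h ?S (x w)) \<le> e * norm w"
        using e by (simp add: power2_le_iff_abs_le)
      then have "norm v * norm (pos_cfc h ?S (x w)) \<le> norm v * (e * norm w)"
        by (intro mult_left_mono) auto
      moreover have "\<bar>Re (cinner v (pos_cfc h ?S (x w)))\<bar> \<le> norm v * norm (pos_cfc h ?S (x w))"
        using abs_Re_le_cmod cmod_cinner_le order_trans by blast
      ultimately show ?thesis by simp
    qed
    moreover have "2 * (norm v * (e * norm w)) \<le> e'"
    proof -
      have "2 * (norm v * (e * norm w)) \<le> e * k" using e by (simp add: k_def algebra_simps)
      then show ?thesis using k by (simp add: e_def)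
    qed
    ultimately show "0 \<le> Re (cinner v (?A v)) + 2 * Re (cinner v (x w)) + Re (cinner w (?B w)) + e'"
      using 1 by (smt (verit))
  qed
  then show "cinner v (?A v) + cinner v (x w) + cinner w (cadjoint x v) + cinner w (?B w) \<in> \<real>\<^sub>\<ge>\<^sub>0"
    using pos_op_Im[OF pA, of v] pos_op_Im[OF pB, of w] by (simp add: complex_nonneg_Reals_iff adj)
qed

end


section \<open>Pairing with dual elements\<close>

context finite_trace
begin

text \<open>\<open>W\<close> is the matrix compressed by the column \<open>(S, T)\<close>, hence
  positive; cyclicity then moves the adjoints to the right.\<close>

lemma trace_matrix_pos:
  assumes mem: "A \<in> M" "B \<in> M" "C \<in> M" "D \<in> M" "S \<in> M" "T \<in> M"
    and pos: "pos_op_matrix 2 (matrix2 A B C D)"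
  shows "0 \<le> Re (\<tau> (A \<circ> (S \<circ> cadjoint S))) + Re (\<tau> (B \<circ> (T \<circ> cadjoint S)))
    + Re (\<tau> (C \<circ> (S \<circ> cadjoint T))) + Re (\<tau> (D \<circ> (T \<circ> cadjoint T)))"
proof -
  define Z where "Z X Y U = cadjoint X \<circ> (Y \<circ> U)" for X Y U :: "'a \<Rightarrow> 'a"
  have Z: "Z X Y U \<in> M" if "X \<in> M" "Y \<in> M" "U \<in> M" for X Y U
    unfolding Z_def by (intro mem_intros that)
  have \<tau>Z: "\<tau> (Z X Y U) = \<tau> (Y \<circ> (U \<circ> cadjoint X))" if "X \<in> M" "Y \<in> M" "U \<in> M" for X Y U
    unfolding Z_def using that by (subst trace_comm) (auto intro: mem_intros simp: comp_assoc)
  define W where "W v = Z S A S v + Z S B T v + Z T C S v + Z T D T v" for v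
  have "W \<in> M" unfolding W_def by (intro mem_intros Z mem)
  moreover have "pos_op W"
    unfolding pos_op_def
  proof (intro conjI allI)
    fix v
    have "cinner v (W v) = cinner (S v) (A (S v)) + cinner (S v) (B (T v))
        + cinner (T v) (C (S v)) + cinner (T v) (D (T v))"
      by (simp add: W_def Z_def cinner_add_right cinner_adjoint_right mem_bounded mem)
    then show "cinner v (W v) \<in> \<real>\<^sub>\<ge>\<^sub>0" using pos unfolding pos_op_matrix2 by simp
  qed (rule mem_bounded[OF \<open>W \<in> M\<close>])
  ultimately have "0 \<le> Re (\<tau> W)" by (rule trace_pos)
  also have "\<tau> W = \<tau> (Z S A S) + \<tau> (Z S B T) + \<tau> (Z T C S) + \<tau> (Z T D T)"
    unfolding W_def by (simp add: trace_add Z mem mem_intros)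
  finally show ?thesis by (simp add: \<tau>Z mem)
qed

end

context symmetric_cp_map
begin

lemma map_matrix2_pos:
  assumes "A \<in> M" "B \<in> M" "C \<in> M" "D \<in> M" "pos_op_matrix 2 (matrix2 A B C D)"
  shows "pos_op_matrix 2 (matrix2 (\<Phi> A) (\<Phi> B) (\<Phi> C) (\<Phi> D))"
proof -
  have "pos_op_matrix 2 (\<lambda>i j. \<Phi> (matrix2 A B C D i j))"
  proof (rule map_matrix_pos)
    show "matrix2 A B C D i j \<in> M" for i j using assms by (simp add: matrix2_def)
  qed (rule assms)
  moreover have "(\<lambda>i j. \<Phi> (matrix2 A B C D i j)) = matrix2 (\<Phi> A) (\<Phi> B) (\<Phi> C) (\<Phi> D)"
    by (intro ext) (simp add: matrix2_def)
  ultimately show ?thesis by simp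
qed

lemma abs_mem:
  assumes "x \<in> M"
  shows "pos_cfc sqrt (x \<circ> cadjoint x) \<in> M" "pos_cfc sqrt (cadjoint x \<circ> x) \<in> M"
  by (intro vna_cfc vna mem_intros assms pos_op_comp_adjoint pos_op_adjoint_comp mem_bounded
      continuous_intros)+

lemma map_matrix_abs:
  assumes x: "x \<in> M"
  shows "pos_op_matrix 2 (matrix2 (\<Phi> (pos_cfc sqrt (x \<circ> cadjoint x))) (\<Phi> x) (\<Phi> (cadjoint x))
    (\<Phi> (pos_cfc sqrt (cadjoint x \<circ> x))))"
  by (intro map_matrix2_pos abs_mem pos_op_matrix_abs mem_bounded mem_intros x)

text \<open>In the positive image of the matrix of absolute values the diagonal forms are real, so
  the sum of the off-diagonal ones is real. Evaluating this at \<open>w\<close> and at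
  \<open>\<i> *\<^sub>C w\<close> determines the adjoint.\<close>

lemma map_adjoint:
  assumes x: "x \<in> M"
  shows "\<Phi> (cadjoint x) = cadjoint (\<Phi> x)"
proof (rule adjoint_unique[symmetric])
  fix v w
  let ?A = "pos_cfc sqrt (x \<circ> cadjoint x)" and ?B = "pos_cfc sqrt (cadjoint x \<circ> x)"
  have pos: "pos_op (\<Phi> ?A)" "pos_op (\<Phi> ?B)"
    by (intro map_pos abs_mem x pos_op_cfc pos_op_comp_adjoint pos_op_adjoint_comp mem_bounded
        continuous_intros; simp)+
  have b: "bounded_op (\<Phi> x)" "bounded_op (\<Phi> (cadjoint x))"
    by (intro mem_bounded map_mem x mem_intros)+
  have im: "Im (cinner v (\<Phi> x w)) + Im (cinner w (\<Phi> (cadjoint x) v)) = 0" for v w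
    using spec[OF spec[OF map_matrix_abs[OF x, unfolded pos_op_matrix2], of v], of w]
      pos_op_Im[OF pos(1), of v] pos_op_Im[OF pos(2), of w]
    by (simp add: complex_nonneg_Reals_iff)
  have "cinner w (\<Phi> (cadjoint x) v) = cnj (cinner v (\<Phi> x w))"
    using im[of v w] im[of v "\<i> *\<^sub>C w"]
    by (simp add: complex_eq_iff cinner_algebra bounded_op_scaleC b)
  then show "cinner (\<Phi> (cadjoint x) v) w = cinner v (\<Phi> x w)"
    by (subst cinner_commute) simp
qed

text \<open>The positive matrix is compressed by a column \<open>(U, V)\<close> chosen such that
  \<open>U \<circ> cadjoint U\<close> and \<open>V \<circ> cadjoint V\<close> are
  \<open>k(s) s\<close> at \<open>z \<circ> cadjoint z\<close> and at
  \<open>cadjoint z \<circ> z\<close>, while \<open>V \<circ> cadjoint U\<close> is minus the dual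
  element. The minus sign turns positivity into an upper bound for the pairing.\<close>

lemma trace_pairing:
  assumes x: "x \<in> M" and z: "z \<in> M" and k: "continuous_on {0..} k" "\<And>s. 0 \<le> s \<Longrightarrow> 0 \<le> k s"
  defines "Y \<equiv> pos_cfc (\<lambda>s. k s * sqrt s) (z \<circ> cadjoint z)"
  shows "Re (\<tau> (\<Phi> x \<circ> (cadjoint z \<circ> Y))) + Re (\<tau> (\<Phi> (cadjoint x) \<circ> (Y \<circ> z))) \<le>
    Re (\<tau> (\<Phi> (pos_cfc sqrt (x \<circ> cadjoint x)) \<circ> pos_cfc (\<lambda>s. k s * s) (z \<circ> cadjoint z))) +
    Re (\<tau> (\<Phi> (pos_cfc sqrt (cadjoint x \<circ> x)) \<circ> pos_cfc (\<lambda>s. k s * s) (cadjoint z \<circ> z)))"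
proof -
  have bz: "bounded_op z" using z by (rule mem_bounded)
  define S where "S = z \<circ> cadjoint z"
  define T where "T = cadjoint z \<circ> z"
  have S: "S \<in> M" "pos_op S" unfolding S_def by (intro mem_intros z pos_op_comp_adjoint bz)+
  have T: "T \<in> M" "pos_op T" unfolding T_def by (intro mem_intros z pos_op_adjoint_comp bz)+
  have cS: "continuous_on {0..onorm S} f" if "continuous_on {0..} f" for f :: "real \<Rightarrow> real"
    by (rule continuous_on_subset[OF that]) simp
  have cT: "continuous_on {0..onorm T} f" if "continuous_on {0..} f" for f :: "real \<Rightarrow> real"
    by (rule continuous_on_subset[OF that]) simp
  define m where "m s = sqrt (k s)" for s
  have m: "continuous_on {0..} m" unfolding m_def by (intro continuous_intros k)
  have mm: "m s * m s = k s" if "0 \<le> s" for s using k(2)[OF that] by (simp add: m_def)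
  have ms: "continuous_on {0..} (\<lambda>s. m s * sqrt s)" by (intro continuous_intros m)
  define G where "G = pos_cfc m S"
  define U where "U = pos_cfc (\<lambda>s. m s * sqrt s) S"
  define V where "V = (\<lambda>v. - (cadjoint z \<circ> G) v)"
  have pG: "pos_op G" and pU: "pos_op U"
    unfolding G_def U_def using k(2) by (intro pos_op_cfc S cS m ms; simp add: m_def)+
  have GM: "G \<in> M" and UM: "U \<in> M" unfolding G_def U_def by (intro vna_cfc vna S m ms)+
  have VM: "V \<in> M" unfolding V_def by (intro mem_intros z GM)
  have adjU: "cadjoint U = U" by (rule pos_op_adjoint[OF pU])
  have adjV: "cadjoint V = (\<lambda>v. - (G \<circ> z) v)"
    unfolding V_def by (simp add: adjoint_minus adjoint_comp adjoint_adjoint pos_op_adjoint pG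
      bounded_op_comp bounded_op_adjoint bz pos_op_bounded del: o_apply)
  have Gz: "G (z v) = z (pos_cfc m T v)" for v
    unfolding G_def S_def T_def by (rule cfc_swap[OF bz m, symmetric])
  have GU: "G (U v) = Y v" and UG: "U (G v) = Y v" for v
  proof -
    have "G (U v) = pos_cfc (\<lambda>s. m s * (m s * sqrt s)) S v"
      unfolding G_def U_def by (rule cfc_mult[OF S(2) cS[OF m] cS[OF ms], symmetric])
    also have "pos_cfc (\<lambda>s. m s * (m s * sqrt s)) S = pos_cfc (\<lambda>s. k s * sqrt s) S"
      by (rule cfc_cong) (simp add: mm[symmetric])
    finally show "G (U v) = Y v" by (simp add: Y_def S_def)
    have "U (G v) = pos_cfc (\<lambda>s. (m s * sqrt s) * m s) S v"
      unfolding G_def U_def by (rule cfc_mult[OF S(2) cS[OF ms] cS[OF m], symmetric])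
    also have "pos_cfc (\<lambda>s. (m s * sqrt s) * m s) S = pos_cfc (\<lambda>s. k s * sqrt s) S"
      by (rule cfc_cong) (simp add: mm[symmetric])
    finally show "U (G v) = Y v" by (simp add: Y_def S_def)
  qed
  have UU: "U \<circ> cadjoint U = pos_cfc (\<lambda>s. k s * s) S"
  proof -
    have "U \<circ> U = pos_cfc (\<lambda>s. (m s * sqrt s) * (m s * sqrt s)) S"
      unfolding U_def by (intro ext) (simp only: o_apply cfc_mult[OF S(2) cS[OF ms] cS[OF ms]])
    also have "\<dots> = pos_cfc (\<lambda>s. k s * s) S"
    proof (rule cfc_cong)
      fix s :: real assume "0 \<le> s"
      then have "k s * s = (m s * m s) * (sqrt s * sqrt s)" by (simp add: mm)
      then show "(m s * sqrt s) * (m s * sqrt s) = k s * s" by (simp only: mult_ac)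
    qed
    finally show ?thesis by (simp add: adjU)
  qed
  have VV: "V \<circ> cadjoint V = pos_cfc (\<lambda>s. k s * s) T"
  proof
    fix v
    have "(V \<circ> cadjoint V) v = cadjoint z (G (G (z v)))"
      unfolding o_apply adjV by (simp add: V_def bounded_op_minus[OF pos_op_bounded[OF pG]]
          bounded_op_minus[OF bounded_op_adjoint[OF bz]])
    also have "\<dots> = T (pos_cfc m T (pos_cfc m T v))" by (simp add: Gz T_def)
    also have "\<dots> = pos_cfc (\<lambda>s. s * (m s * m s)) T v"
      by (simp only: cfc_mult[OF T(2)] cT[OF m] continuous_on_id continuous_on_mult cfc_ident[OF T(2)])
    also have "pos_cfc (\<lambda>s. s * (m s * m s)) T = pos_cfc (\<lambda>s. k s * s) T"
      by (rule cfc_cong) (simp add: mm)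
    finally show "(V \<circ> cadjoint V) v = pos_cfc (\<lambda>s. k s * s) T v" .
  qed
  have VU: "X \<circ> (V \<circ> cadjoint U) = (\<lambda>v. - (X \<circ> (cadjoint z \<circ> Y)) v)" if "X \<in> M" for X
    by (auto simp: adjU V_def GU bounded_op_minus[OF mem_bounded[OF that]])
  have UV: "X \<circ> (U \<circ> cadjoint V) = (\<lambda>v. - (X \<circ> (Y \<circ> z)) v)" if "X \<in> M" for X
    by (auto simp: adjV UG bounded_op_minus[OF mem_bounded[OF that]] bounded_op_minus[OF pos_op_bounded[OF pU]])
  have YM: "Y \<in> M" unfolding Y_def S_def[symmetric] by (intro vna_cfc vna S continuous_intros k)
  have xM: "\<Phi> x \<in> M" "\<Phi> (cadjoint x) \<in> M" by (intro map_mem x mem_intros)+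
  have "Re (\<tau> (\<Phi> x \<circ> (V \<circ> cadjoint U))) = - Re (\<tau> (\<Phi> x \<circ> (cadjoint z \<circ> Y)))"
    unfolding VU[OF xM(1)] using trace_minus[of "\<Phi> x \<circ> (cadjoint z \<circ> Y)"]
    by (simp add: mem_intros xM z YM del: o_apply)
  moreover have "Re (\<tau> (\<Phi> (cadjoint x) \<circ> (U \<circ> cadjoint V))) = - Re (\<tau> (\<Phi> (cadjoint x) \<circ> (Y \<circ> z)))"
    unfolding UV[OF xM(2)] using trace_minus[of "\<Phi> (cadjoint x) \<circ> (Y \<circ> z)"]
    by (simp add: mem_intros xM z YM del: o_apply)
  ultimately show ?thesis
    using trace_matrix_pos[OF map_mem[OF abs_mem(1)[OF x]] xM map_mem[OF abs_mem(2)[OF x]] UM VM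
        map_matrix_abs[OF x]]
    unfolding UU VV by (simp add: S_def T_def)
qed

end

section \<open>Scalar Young inequalities and the weight of the dual element\<close>

lemma young_powr:
  fixes a b p :: real
  assumes "0 \<le> a" "0 < b" "1 \<le> p"
  shows "a * b powr (p - 1) \<le> a powr p / p + (1 - 1 / p) * b powr p"
proof (cases "p = 1")
  case False
  \<comment> \<open>The conjugate exponent, for which the \<open>q\<close>-th power of
    \<open>b powr (p - 1)\<close> is \<open>b powr p\<close>; it is finite for \<open>p > 1\<close>
    only, hence the separate case.\<close>
  define q where "q = p / (p - 1)"
  have pq: "p > 1" "q > 1" "1 / p + 1 / q = 1" using assms False by (auto simp: q_def field_simps)
  have "a * b powr (p - 1) \<le> a powr p / p + (b powr (p - 1)) powr q / q"
    by (rule Youngs_inequality) (use pq assms in auto)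
  also have "(b powr (p - 1)) powr q = b powr p" using pq by (simp add: powr_powr q_def)
  also have "b powr p / q = (1 - 1 / p) * b powr p"
  proof -
    have "1 - 1 / p = 1 / q" using pq(3) by linarith
    then show ?thesis by simp
  qed
  finally show ?thesis .
qed (use assms in auto)

text \<open>Young's inequality for \<open>a / \<alpha>\<close> and \<open>b / \<beta>\<close>,
  rescaled. If \<open>a powr p\<close> and \<open>b powr p\<close> are replaced by
  \<open>\<alpha> powr p\<close> and \<open>\<beta> powr p\<close>, the right-hand side is exactly
  \<open>\<alpha> * \<beta> powr (p - 1)\<close>; this is how Hoelder's inequality arises.\<close>

lemma young_powr_weighted:
  fixes a b p \<alpha> \<beta> :: real
  assumes "0 \<le> a" "0 < b" "1 \<le> p" "0 < \<alpha>" "0 < \<beta>"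
  shows "a * b powr (p - 1) \<le>
    (\<beta> / \<alpha>) powr (p - 1) / p * a powr p + (1 - 1 / p) * (\<alpha> / \<beta>) * b powr p"
proof -
  define c where "c = \<alpha> * \<beta> powr (p - 1)"
  have c: "c > 0" using assms by (simp add: c_def)
  have "(a / \<alpha>) * (b / \<beta>) powr (p - 1) \<le> (a / \<alpha>) powr p / p + (1 - 1 / p) * (b / \<beta>) powr p"
    by (rule young_powr) (use assms in auto)
  then have "c * ((a / \<alpha>) * (b / \<beta>) powr (p - 1)) \<le>
      c * ((a / \<alpha>) powr p / p + (1 - 1 / p) * (b / \<beta>) powr p)"
    using c by (intro mult_left_mono) auto
  also have "c * ((a / \<alpha>) * (b / \<beta>) powr (p - 1)) = a * b powr (p - 1)"
    using assms by (simp add: c_def powr_divide)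
  also have "c * ((a / \<alpha>) powr p / p + (1 - 1 / p) * (b / \<beta>) powr p) =
      (c / \<alpha> powr p) / p * a powr p + (1 - 1 / p) * (c / \<beta> powr p) * b powr p"
    using assms by (simp add: powr_divide field_simps)
  also have "c / \<alpha> powr p = (\<beta> / \<alpha>) powr (p - 1)"
    using assms by (simp add: c_def powr_divide powr_diff mult.commute)
  also have "c / \<beta> powr p = \<alpha> / \<beta>"
    using assms by (simp add: c_def powr_diff)
  finally show ?thesis .
qed

text \<open>The dual element of \<open>z\<close> is \<open>|z|\<^bsup>p-2\<^esup> z\<^sup>*\<close>. In the variable \<open>s = t\<^sup>2\<close> of \<open>zz\<^sup>*\<close> it is regularized to
  \<open>z\<^sup>* k(zz\<^sup>*) |z\<^sup>*|\<close>, with \<open>k(s) = t\<^sup>p / (t + e)\<^sup>3\<close> continuous at 0 for all \<open>p \<ge> 1\<close>.\<close>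

definition dual_weight :: "real \<Rightarrow> real \<Rightarrow> real \<Rightarrow> real"
  where "dual_weight p e s = s powr (p / 2) / (sqrt s + e) ^ 3"

lemma dual_weight_nonneg: "0 < e \<Longrightarrow> 0 \<le> s \<Longrightarrow> 0 \<le> dual_weight p e s"
  by (simp add: dual_weight_def)

lemma continuous_on_powr_pos: "0 < p \<Longrightarrow> continuous_on {0..} (\<lambda>s::real. s powr p)"
  by (intro continuous_on_powr' continuous_intros) auto

lemma continuous_on_dual_weight:
  assumes "1 \<le> p" "0 < e"
  shows "continuous_on {0..} (dual_weight p e)"
proof -
  have "sqrt s + e \<noteq> 0" if "0 \<le> s" for s using that assms by (smt (verit) real_sqrt_ge_zero)
  then show ?thesis unfolding dual_weight_def[abs_def] using assms
    by (intro continuous_intros continuous_on_powr_pos) auto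
qed

lemma sqrt_powr: "0 \<le> s \<Longrightarrow> sqrt s powr p = s powr (p / 2)"
  by (simp add: powr_half_sqrt[symmetric] powr_powr)

text \<open>Dropping \<open>e\<close> in the denominator only enlarges the left-hand side and leaves
  \<open>t powr (p - 1)\<close> for \<open>t = sqrt s\<close>. The point \<open>s = 0\<close> is
  separate because the weighted inequality asks for \<open>0 < b\<close>.\<close>

lemma dual_weight_young:
  assumes "1 \<le> p" "0 < e" "0 < \<alpha>" "0 < \<beta>" "0 \<le> r" "0 \<le> s"
  shows "sqrt r * (dual_weight p e s * s) \<le>
    (\<beta> / \<alpha>) powr (p - 1) / p * r powr (p / 2) + (1 - 1 / p) * (\<alpha> / \<beta>) * s powr (p / 2)"
proof (cases "s = 0")
  case True
  then show ?thesis using assms by simp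
next
  case False
  define t where "t = sqrt s"
  have t: "t > 0" "s = t\<^sup>2" using assms False by (auto simp: t_def)
  have "dual_weight p e s * s = t powr p * t\<^sup>2 / (t + e) ^ 3"
    using assms by (simp add: dual_weight_def t_def sqrt_powr)
  also have "\<dots> \<le> t powr p * t\<^sup>2 / t ^ 3"
    using t assms by (intro divide_left_mono power_mono mult_nonneg_nonneg) auto
  also have "\<dots> = t powr (p - 1)" using t by (simp add: powr_diff power2_eq_square power3_eq_cube)
  finally have "sqrt r * (dual_weight p e s * s) \<le> sqrt r * t powr (p - 1)"
    using assms by (intro mult_left_mono) auto
  also have "\<dots> \<le> (\<beta> / \<alpha>) powr (p - 1) / p * sqrt r powr p + (1 - 1 / p) * (\<alpha> / \<beta>) * t powr p"
    by (rule young_powr_weighted) (use assms t in auto)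
  finally show ?thesis using assms by (simp add: sqrt_powr t_def)
qed

text \<open>For \<open>t = sqrt s\<close> and \<open>q = t / (t + e)\<close> the first term is
  \<open>t powr p * q ^ 3\<close>. The factor \<open>1 / (t + e)\<close> of \<open>1 - q\<close>
  absorbs one power of \<open>t\<close>, which leaves a bound linear in \<open>e\<close> and uniform
  on \<open>{0..R}\<close>.\<close>

lemma dual_weight_close:
  assumes "1 \<le> p" "0 < e" "0 \<le> s" "s \<le> R"
  shows "\<bar>dual_weight p e s * sqrt s * s - s powr (p / 2)\<bar> \<le> e * (3 * sqrt R powr (p - 1))"
proof -
  define t where "t = sqrt s"
  have t: "t \<ge> 0" "s = t * t" using assms by (auto simp: t_def)
  define q where "q = t / (t + e)"
  have q: "0 \<le> q" "q \<le> 1" using t assms by (auto simp: q_def)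
  have te: "t + e > 0" using t assms by simp
  have "dual_weight p e s * sqrt s * s = t powr p * q ^ 3"
    using assms t by (simp add: dual_weight_def t_def[symmetric] sqrt_powr[symmetric] q_def power_divide
      power3_eq_cube)
  moreover have "s powr (p / 2) = t powr p" using assms by (simp add: t_def sqrt_powr)
  ultimately have "\<bar>dual_weight p e s * sqrt s * s - s powr (p / 2)\<bar> = t powr p * (1 - q ^ 3)"
    using mult_left_mono[OF power_le_one[OF q, of 3], of "t powr p"] by (simp add: algebra_simps)
  also have "1 - q ^ 3 \<le> 3 * (1 - q)"
  proof -
    \<comment> \<open>This product is the difference of the two sides.\<close>
    have "0 \<le> (1 - q)\<^sup>2 * (2 + q)" using q by simp
    then show ?thesis by (simp add: power2_eq_square power3_eq_cube algebra_simps)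
  qed
  also have "1 - q = e / (t + e)" using te by (simp add: q_def field_simps)
  also have "t powr p * (3 * (e / (t + e))) \<le> e * (3 * t powr (p - 1))"
  proof (cases "t = 0")
    case False
    then have "t > 0" using t by simp
    then have "t powr p = t * t powr (p - 1)" by (simp add: powr_diff)
    then show ?thesis using te t assms by (simp add: divide_le_eq field_simps)
  qed (use assms in simp)
  also have "\<dots> \<le> e * (3 * sqrt R powr (p - 1))"
    using assms by (intro mult_left_mono powr_mono2) (auto simp: t_def)
  finally show ?thesis using t by (simp add: mult_left_mono)
qed


section \<open>Contractivity of symmetric completely positive maps\<close>

context finite_trace
begin

lemma trace_powr_nonneg:
  assumes "x \<in> M" "p > 0"
  shows "0 \<le> Re (\<tau> (pos_cfc (\<lambda>s. s powr (p / 2)) (cadjoint x \<circ> x)))"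
  using assms
  by (intro trace_pos vna_cfc vna mem_intros pos_op_adjoint_comp mem_bounded pos_op_cfc
      continuous_on_subset[OF continuous_on_powr_pos] continuous_on_powr_pos) auto

lemma Lp_norm_op_eq:
  assumes "x \<in> M" "p > 0"
  shows "Lp_norm_op \<tau> p x = Re (\<tau> (pos_cfc (\<lambda>s. s powr (p / 2)) (cadjoint x \<circ> x))) powr (1 / p)"
  using assms by (simp add: Lp_norm_op_def op_powr_op_abs mem_bounded)

lemma Lp_norm_op_nonneg: "0 \<le> Lp_norm_op \<tau> p x"
  by (simp add: Lp_norm_op_def)

lemma Lp_norm_op_powr:
  assumes "x \<in> M" "p > 0"
  shows "Lp_norm_op \<tau> p x powr p = Re (\<tau> (pos_cfc (\<lambda>s. s powr (p / 2)) (cadjoint x \<circ> x)))"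
  using trace_powr_nonneg[OF assms] assms(2) by (simp add: Lp_norm_op_eq[OF assms] powr_powr)

lemma Lp_norm_op_minus:
  assumes "x \<in> M"
  shows "Lp_norm_op \<tau> p (\<lambda>v. - x v) = Lp_norm_op \<tau> p x"
proof -
  have bx: "bounded_op x" using assms by (rule mem_bounded)
  have "cadjoint (\<lambda>v. - x v) \<circ> (\<lambda>v. - x v) = cadjoint x \<circ> x"
    by (auto simp: adjoint_minus bx bounded_op_minus[OF bounded_op_adjoint[OF bx]])
  then show ?thesis by (simp add: Lp_norm_op_def op_abs_def)
qed

text \<open>In \<open>t = sqrt s\<close> the function is
  \<open>t powr (p + 1) / (t + e) ^ 3\<close>, a regularized \<open>t powr (p - 2)\<close>.\<close>

definition dual_factor :: "real \<Rightarrow> real \<Rightarrow> ('a \<Rightarrow> 'a) \<Rightarrow> ('a \<Rightarrow> 'a)"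
  where "dual_factor p e z = pos_cfc (\<lambda>s. dual_weight p e s * sqrt s) (z \<circ> cadjoint z)"

lemma dual_factor_mem:
  assumes "z \<in> M" "1 \<le> p" "0 < e"
  shows "dual_factor p e z \<in> M"
  unfolding dual_factor_def
  by (intro vna_cfc vna mem_intros pos_op_comp_adjoint mem_bounded assms continuous_intros
      continuous_on_dual_weight)

text \<open>As \<open>e\<close> tends to 0, both traces tend to \<open>\<beta> powr p\<close> for
  \<open>\<beta> = Lp_norm_op \<tau> p z\<close>, and dividing the limit of the hypothesis by
  \<open>\<beta> powr (p - 1)\<close> gives the claim. The two traces occur as a sum because
  \<open>trace_pairing\<close> controls only their sum.\<close>

lemma Lp_norm_op_le_dual:
  assumes z: "z \<in> M" and p: "1 \<le> p" and C: "0 \<le> C"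
    and le: "\<And>e. 0 < e \<Longrightarrow> 0 < Lp_norm_op \<tau> p z \<Longrightarrow>
      Re (\<tau> (z \<circ> (cadjoint z \<circ> dual_factor p e z))) + Re (\<tau> (cadjoint z \<circ> (dual_factor p e z \<circ> z)))
        \<le> 2 * (C * Lp_norm_op \<tau> p z powr (p - 1))"
  shows "Lp_norm_op \<tau> p z \<le> C"
proof (cases "Lp_norm_op \<tau> p z > 0")
  case True
  define \<beta> where "\<beta> = Lp_norm_op \<tau> p z"
  have \<beta>: "\<beta> > 0" using True by (simp add: \<beta>_def)
  have bz: "bounded_op z" using z by (rule mem_bounded)
  define S where "S = z \<circ> cadjoint z"
  have S: "S \<in> M" "pos_op S" unfolding S_def by (intro mem_intros z pos_op_comp_adjoint bz)+
  have cS: "continuous_on {0..onorm S} f" if "continuous_on {0..} f" for f :: "real \<Rightarrow> real"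
    by (rule continuous_on_subset[OF that]) simp
  have cp: "continuous_on {0..} (\<lambda>s::real. s powr (p / 2))" using p by (intro continuous_on_powr_pos) simp
  have Z: "\<beta> powr p = Re (\<tau> (pos_cfc (\<lambda>s. s powr (p / 2)) S))"
    using Lp_norm_op_powr[OF z, of p] trace_cfc_adjoint_comp[OF z cp] p
    by (simp add: \<beta>_def S_def)
  define D where "D = 3 * sqrt (onorm S) powr (p - 1) * Re (\<tau> id)"
  have D: "0 \<le> D" unfolding D_def using trace_pos[of id] by (intro mult_nonneg_nonneg) (auto intro: mem_intros)
  have "\<beta> powr p \<le> C * \<beta> powr (p - 1)"
  proof (rule field_le_epsilon)
    fix e' :: real assume e': "e' > 0"
    define e where "e = e' / (D + 1)"
    have e: "e > 0" using e' D by (simp add: e_def)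
    let ?Y = "dual_factor p e z"
    have YM: "?Y \<in> M" by (rule dual_factor_mem[OF z p e])
    have cw: "continuous_on {0..} (\<lambda>s. dual_weight p e s * sqrt s)"
      by (intro continuous_intros continuous_on_dual_weight p e)
    have YS: "?Y \<circ> S = pos_cfc (\<lambda>s. dual_weight p e s * sqrt s * s) S"
      unfolding dual_factor_def S_def[symmetric]
      using cfc_mult[OF S(2) cS[OF cw] continuous_on_id] by (auto simp: cfc_ident S)
    have "\<tau> (z \<circ> (cadjoint z \<circ> ?Y)) = \<tau> (?Y \<circ> S)"
      using trace_comm[OF S(1) YM] by (simp add: S_def comp_assoc)
    moreover have "\<tau> (cadjoint z \<circ> (?Y \<circ> z)) = \<tau> (?Y \<circ> S)"
      using trace_comm[of "cadjoint z" "?Y \<circ> z"] by (simp add: S_def comp_assoc mem_intros YM z)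
    ultimately have "2 * Re (\<tau> (?Y \<circ> S)) \<le> 2 * (C * \<beta> powr (p - 1))"
      using le[OF e True] by (simp add: \<beta>_def)
    moreover have "\<bar>Re (\<tau> (?Y \<circ> S)) - \<beta> powr p\<bar> \<le> e * (3 * sqrt (onorm S) powr (p - 1)) * Re (\<tau> id)"
      unfolding YS Z
      by (intro trace_cfc_close S cp dual_weight_close p e continuous_intros continuous_on_dual_weight)
    ultimately have "\<beta> powr p \<le> C * \<beta> powr (p - 1) + e * D"
      by (simp add: D_def mult.assoc abs_le_iff)
    also have "e * D \<le> e'" using e' D by (simp add: e_def field_simps)
    finally show "\<beta> powr p \<le> C * \<beta> powr (p - 1) + e'" by simp
  qed
  also have "\<beta> powr p = \<beta> * \<beta> powr (p - 1)" using \<beta> by (simp add: powr_diff)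
  finally show ?thesis using \<beta> by (simp add: \<beta>_def)
qed (use C in simp)

end

context symmetric_cp_map
begin

text \<open>Hoelder's inequality with the factor \<open>K\<close>: \<open>|x\<^sup>*|\<close> meets
  \<open>z \<circ> cadjoint z\<close>, \<open>|x|\<close> meets \<open>cadjoint z \<circ> z\<close>,
  and \<open>trace_young\<close> bounds each term. Positive bounds \<open>\<alpha>\<close>,
  \<open>\<beta>\<close> stand in for the norms because the weights divide by them.\<close>

lemma trace_dual_le:
  assumes x: "x \<in> M" and z: "z \<in> M" and p: "1 \<le> p" and e: "0 < e" and \<alpha>: "0 < \<alpha>" and \<beta>: "0 < \<beta>"
    and "Lp_norm_op \<tau> p x \<le> \<alpha>" "Lp_norm_op \<tau> p z \<le> \<beta>"
  shows "Re (\<tau> (\<Phi> x \<circ> (cadjoint z \<circ> dual_factor p e z))) +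
    Re (\<tau> (\<Phi> (cadjoint x) \<circ> (dual_factor p e z \<circ> z))) \<le> 2 * (K * \<alpha> * \<beta> powr (p - 1))"
proof -
  let ?n = "\<lambda>T. Re (\<tau> (pos_cfc (\<lambda>s. s powr (p / 2)) T))"
  have p0: "p > 0" using p by simp
  have cp: "continuous_on {0..} (\<lambda>s::real. s powr (p / 2))" using p by (intro continuous_on_powr_pos) simp
  have sq: "continuous_on {0..} sqrt" by (intro continuous_intros)
  have X: "?n (cadjoint x \<circ> x) \<le> \<alpha> powr p" and Z: "?n (cadjoint z \<circ> z) \<le> \<beta> powr p"
    unfolding Lp_norm_op_powr[OF x p0, symmetric] Lp_norm_op_powr[OF z p0, symmetric]
    using assms p0 by (auto intro!: powr_mono2 Lp_norm_op_nonneg)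
  have bx: "bounded_op x" and bz: "bounded_op z" using x z by (auto intro: mem_bounded)
  \<comment> \<open>The coefficients of \<open>young_powr_weighted\<close>, for which
    \<open>A * \<alpha> powr p + B * \<beta> powr p\<close> equals
    \<open>\<alpha> * \<beta> powr (p - 1)\<close>.\<close>
  define A where "A = (\<beta> / \<alpha>) powr (p - 1) / p"
  define B where "B = (1 - 1 / p) * (\<alpha> / \<beta>)"
  have AB: "0 \<le> A" "0 \<le> B" using p \<alpha> \<beta> by (auto simp: A_def B_def)
  have young: "Re (\<tau> (\<Phi> (pos_cfc sqrt a) \<circ> pos_cfc (\<lambda>s. dual_weight p e s * s) c)) \<le>
      K * (A * \<alpha> powr p + B * \<beta> powr p)"
    if a: "a \<in> M" "pos_op a" and c: "c \<in> M" "pos_op c" and n: "?n a \<le> \<alpha> powr p" "?n c \<le> \<beta> powr p" for a c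
  proof -
    have "Re (\<tau> (\<Phi> (pos_cfc sqrt a) \<circ> pos_cfc (\<lambda>s. dual_weight p e s * s) c)) \<le>
      K * (Re (\<tau> (pos_cfc (\<lambda>s. A * s powr (p / 2)) a)) + Re (\<tau> (pos_cfc (\<lambda>s. B * s powr (p / 2)) c)))"
    proof (intro trace_young a c sq cp continuous_on_mult continuous_on_const continuous_on_id
        continuous_on_dual_weight p e)
      fix s t :: real assume "0 \<le> s" "0 \<le> t"
      then show "sqrt s * (dual_weight p e t * t) \<le> A * s powr (p / 2) + B * t powr (p / 2)"
        unfolding A_def B_def by (intro dual_weight_young p e \<alpha> \<beta>)
    qed (use AB in auto)
    also have "\<dots> = K * (A * ?n a + B * ?n c)"
      by (simp add: trace_cfc_scaleR a c cp)
    also have "\<dots> \<le> K * (A * \<alpha> powr p + B * \<beta> powr p)"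
      using n AB K_nonneg by (intro mult_left_mono add_mono)
    finally show ?thesis .
  qed
  have "A * \<alpha> powr p + B * \<beta> powr p = \<alpha> * \<beta> powr (p - 1)"
  proof -
    have "A * \<alpha> powr p = \<alpha> * \<beta> powr (p - 1) / p"
      using \<alpha> \<beta> by (simp add: A_def powr_divide powr_diff)
    moreover have "B * \<beta> powr p = (1 - 1 / p) * (\<alpha> * \<beta> powr (p - 1))"
      using \<alpha> \<beta> by (simp add: B_def powr_diff)
    ultimately show ?thesis by (simp add: algebra_simps)
  qed
  note young = young[unfolded this]
  have "Re (\<tau> (\<Phi> x \<circ> (cadjoint z \<circ> dual_factor p e z))) + Re (\<tau> (\<Phi> (cadjoint x) \<circ> (dual_factor p e z \<circ> z)))
    \<le> Re (\<tau> (\<Phi> (pos_cfc sqrt (x \<circ> cadjoint x)) \<circ> pos_cfc (\<lambda>s. dual_weight p e s * s) (z \<circ> cadjoint z))) +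
      Re (\<tau> (\<Phi> (pos_cfc sqrt (cadjoint x \<circ> x)) \<circ> pos_cfc (\<lambda>s. dual_weight p e s * s) (cadjoint z \<circ> z)))"
    unfolding dual_factor_def
    by (intro trace_pairing x z continuous_on_dual_weight dual_weight_nonneg p e)
  also have "\<dots> \<le> K * (\<alpha> * \<beta> powr (p - 1)) + K * (\<alpha> * \<beta> powr (p - 1))"
    using X Z trace_cfc_adjoint_comp[OF x cp] trace_cfc_adjoint_comp[OF z cp]
    by (intro add_mono young mem_intros x z pos_op_comp_adjoint pos_op_adjoint_comp bx bz) auto
  finally show ?thesis by (simp add: algebra_simps)
qed

text \<open>\<open>\<Phi> x\<close> is tested against its own dual element; both traces have the
  shape that \<open>Lp_norm_op_le_dual\<close> demands since \<open>\<Phi>\<close> preserves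
  adjoints.\<close>

lemma Lp_norm_op_map_le:
  assumes x: "x \<in> M" and p: "1 \<le> p"
  shows "Lp_norm_op \<tau> p (\<Phi> x) \<le> K * Lp_norm_op \<tau> p x"
proof (rule field_le_epsilon)
  fix e' :: real assume e': "e' > 0"
  \<comment> \<open>A margin that keeps the bound on the norm of \<open>x\<close> positive when that
    norm is 0.\<close>
  define d where "d = e' / (K + 1)"
  have d: "d > 0" using e' K_nonneg by (simp add: d_def)
  let ?\<alpha> = "Lp_norm_op \<tau> p x + d"
  have \<alpha>: "?\<alpha> > 0" using Lp_norm_op_nonneg d by (simp add: add_nonneg_pos)
  have "Lp_norm_op \<tau> p (\<Phi> x) \<le> K * ?\<alpha>"
  proof (rule Lp_norm_op_le_dual[OF map_mem[OF x] p])
    show "0 \<le> K * ?\<alpha>" using K_nonneg \<alpha> by simp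
    fix e :: real assume "0 < e" "0 < Lp_norm_op \<tau> p (\<Phi> x)"
    then show "Re (\<tau> (\<Phi> x \<circ> (cadjoint (\<Phi> x) \<circ> dual_factor p e (\<Phi> x)))) +
        Re (\<tau> (cadjoint (\<Phi> x) \<circ> (dual_factor p e (\<Phi> x) \<circ> \<Phi> x)))
        \<le> 2 * (K * ?\<alpha> * Lp_norm_op \<tau> p (\<Phi> x) powr (p - 1))"
      using trace_dual_le[OF x map_mem[OF x] p _ \<alpha>, of e "Lp_norm_op \<tau> p (\<Phi> x)"] d
      by (simp add: map_adjoint x)
  qed
  also have "K * ?\<alpha> \<le> K * Lp_norm_op \<tau> p x + e'"
    using e' K_nonneg by (simp add: d_def field_simps)
  finally show "Lp_norm_op \<tau> p (\<Phi> x) \<le> K * Lp_norm_op \<tau> p x + e'" .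
qed

text \<open>The endpoint \<open>p = \<infinity>\<close>: with \<open>c = onorm x\<close>, the matrix
  with rows \<open>(c, x)\<close> and \<open>(x\<^sup>*, c)\<close> is positive, and in its image
  the diagonal \<open>c * \<Phi> id\<close> is at most \<open>c * K\<close>.\<close>

lemma onorm_map_le:
  assumes x: "x \<in> M"
  shows "onorm (\<Phi> x) \<le> K * onorm x"
proof (rule onorm_bound)
  have bx: "bounded_op x" using x by (rule mem_bounded)
  define c where "c = onorm x"
  have c: "0 \<le> c" unfolding c_def by (rule onorm_nonneg[OF bx])
  then show "0 \<le> K * onorm x" using K_nonneg by (simp add: c_def)
  have cM: "(\<lambda>v. c *\<^sub>R id v) \<in> M" by (intro mem_intros)
  have "pos_op_matrix 2 (matrix2 (\<lambda>v. c *\<^sub>R id v) x (cadjoint x) (\<lambda>v. c *\<^sub>R id v))"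
    unfolding pos_op_matrix2
  proof (intro allI)
    fix v w
    have adj: "cinner w (cadjoint x v) = cnj (cinner v (x w))"
      by (subst cinner_commute) (simp add: cinner_adjoint_left bx)
    have "- Re (cinner v (x w)) \<le> norm v * norm (x w)"
      using cmod_cinner_le[of v "x w"] abs_Re_le_cmod[of "cinner v (x w)"] by linarith
    also have "\<dots> \<le> norm v * (c * norm w)"
      unfolding c_def by (intro mult_left_mono bounded_op_onorm bx) auto
    also have "2 * (norm v * (c * norm w)) \<le> c * ((norm v)\<^sup>2 + (norm w)\<^sup>2)"
      using mult_left_mono[OF sum_squares_bound[of "norm v" "norm w"] c] by (simp add: mult_ac)
    finally show "cinner v (c *\<^sub>R id v) + cinner v (x w) + cinner w (cadjoint x v) +
        cinner w (c *\<^sub>R id w) \<in> \<real>\<^sub>\<ge>\<^sub>0"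
      by (simp add: complex_nonneg_Reals_iff adj cinner_scaleR_right cinner_self algebra_simps)
  qed
  from map_matrix2_pos[OF cM x vna_adjoint[OF vna x] cM this]
  have pos: "cinner v (c *\<^sub>R \<Phi> id v) + cinner v (\<Phi> x w) + cinner w (cadjoint (\<Phi> x) v) +
      cinner w (c *\<^sub>R \<Phi> id w) \<in> \<real>\<^sub>\<ge>\<^sub>0" for v w
    unfolding pos_op_matrix2 map_scaleR[OF mem_intros(1)] map_adjoint[OF x] by blast
  have b: "bounded_op (\<Phi> x)" by (rule mem_bounded[OF map_mem[OF x]])
  fix w
  define y where "y = \<Phi> x w"
  show "norm (\<Phi> x w) \<le> K * onorm x * norm w"
  proof (cases "y = 0 \<or> w = 0")
    case True
    then show ?thesis using \<open>0 \<le> K * onorm x\<close> bounded_op_zero[OF b] by (auto simp: y_def)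
  next
    case False
    then have n: "norm y > 0" "norm w > 0" by auto
    \<comment> \<open>As long as \<open>w\<close> and directed against \<open>y\<close>, so that the
      cross term becomes \<open>- (norm w * norm y)\<close>.\<close>
    define v where "v = (- norm w / norm y) *\<^sub>R y"
    have nv: "norm v = norm w" using n by (simp add: v_def)
    have \<Phi>1: "Re (cinner v (\<Phi> id v)) \<le> K * (norm v)\<^sup>2" for v
      using pos_op_Re[OF pos_K_minus, of v] by (simp add: cinner_algebra Re_cinner_self)
    have "Re (cinner w (cadjoint (\<Phi> x) v)) = Re (cinner v y)"
      using Re_cinner_commute[of v y] by (simp add: cinner_adjoint_right b y_def)
    then have "0 \<le> c * Re (cinner v (\<Phi> id v)) + 2 * Re (cinner v y) + c * Re (cinner w (\<Phi> id w))"
      using pos[of v w] by (simp add: complex_nonneg_Reals_iff cinner_scaleR_right y_def)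
    also have "\<dots> \<le> c * (K * (norm v)\<^sup>2) + 2 * Re (cinner v y) + c * (K * (norm w)\<^sup>2)"
      using c by (intro add_mono mult_left_mono \<Phi>1) auto
    also have "Re (cinner v y) = - (norm w * norm y)"
      using n by (simp add: v_def cinner_minus_left cinner_scaleR_left cinner_self power2_eq_square)
    finally have "norm w * norm y \<le> norm w * (K * c * norm w)"
      unfolding nv by (simp add: power2_eq_square algebra_simps)
    then show ?thesis using n by (simp add: y_def c_def)
  qed
qed

end

section \<open>Minkowski's inequality\<close>

context finite_trace
begin

text \<open>Through this instance \<open>trace_dual_le\<close> becomes the ordinary Hoelder
  inequality.\<close>

lemma symmetric_cp_ident: "symmetric_cp_map M \<tau> (\<lambda>T. T) 1"
  by unfold_locales
    (auto simp: completely_positive_def linear_on_ops_def trace_symmetric_def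
      intro!: onorm_bound)

text \<open>Hoelder's inequality for each summand against the dual element of the sum.\<close>

lemma Lp_norm_op_triangle:
  assumes x: "x \<in> M" and y: "y \<in> M" and p: "1 \<le> p"
  shows "Lp_norm_op \<tau> p (\<lambda>v. x v + y v) \<le> Lp_norm_op \<tau> p x + Lp_norm_op \<tau> p y"
proof (rule field_le_epsilon)
  interpret ident: symmetric_cp_map M \<tau> "\<lambda>T. T" 1 by (rule symmetric_cp_ident)
  fix e' :: real assume e': "e' > 0"
  let ?z = "\<lambda>v. x v + y v"
  \<comment> \<open>Half of the error goes to each summand, so that both bounds are
    positive.\<close>
  let ?\<alpha> = "\<lambda>x. Lp_norm_op \<tau> p x + e' / 2"
  have \<alpha>: "?\<alpha> x > 0" for x using Lp_norm_op_nonneg[of p x] e' by simp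
  have z: "?z \<in> M" by (intro mem_intros x y)
  have "Lp_norm_op \<tau> p ?z \<le> ?\<alpha> x + ?\<alpha> y"
  proof (rule Lp_norm_op_le_dual[OF z p])
    show "0 \<le> ?\<alpha> x + ?\<alpha> y" using \<alpha>[of x] \<alpha>[of y] by linarith
    fix e :: real assume e: "0 < e" and \<beta>: "0 < Lp_norm_op \<tau> p ?z"
    let ?Y = "dual_factor p e ?z"
    have Y: "?Y \<in> M" by (rule dual_factor_mem[OF z p e])
    have U: "cadjoint ?z \<circ> ?Y \<in> M" and V: "?Y \<circ> ?z \<in> M" by (intro mem_intros z Y)+
    have "\<tau> (?z \<circ> (cadjoint ?z \<circ> ?Y)) = \<tau> (x \<circ> (cadjoint ?z \<circ> ?Y)) + \<tau> (y \<circ> (cadjoint ?z \<circ> ?Y))"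
      using trace_add[OF vna_comp[OF vna x U] vna_comp[OF vna y U]] by (simp add: o_def)
    moreover have "\<tau> (cadjoint ?z \<circ> (?Y \<circ> ?z)) =
        \<tau> (cadjoint x \<circ> (?Y \<circ> ?z)) + \<tau> (cadjoint y \<circ> (?Y \<circ> ?z))"
      using trace_add[OF vna_comp[OF vna vna_adjoint[OF vna x] V] vna_comp[OF vna vna_adjoint[OF vna y] V]]
      by (simp add: o_def adjoint_plus mem_bounded x y)
    ultimately show "Re (\<tau> (?z \<circ> (cadjoint ?z \<circ> ?Y))) + Re (\<tau> (cadjoint ?z \<circ> (?Y \<circ> ?z)))
        \<le> 2 * ((?\<alpha> x + ?\<alpha> y) * Lp_norm_op \<tau> p ?z powr (p - 1))"
      using ident.trace_dual_le[OF x z p e \<alpha>[of x] \<beta>] ident.trace_dual_le[OF y z p e \<alpha>[of y] \<beta>] e'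
      by (simp add: algebra_simps)
  qed
  then show "Lp_norm_op \<tau> p ?z \<le> Lp_norm_op \<tau> p x + Lp_norm_op \<tau> p y + e'" by simp
qed

lemma Lp_norm_op_diff_le:
  assumes x: "x \<in> M" and y: "y \<in> M" and p: "1 \<le> p"
  shows "\<bar>Lp_norm_op \<tau> p x - Lp_norm_op \<tau> p y\<bar> \<le> Lp_norm_op \<tau> p (\<lambda>v. x v - y v)"
proof -
  have d: "(\<lambda>v. x v - y v) \<in> M" "(\<lambda>v. y v - x v) \<in> M" by (intro mem_intros x y)+
  have "Lp_norm_op \<tau> p x \<le> Lp_norm_op \<tau> p (\<lambda>v. x v - y v) + Lp_norm_op \<tau> p y"
    using Lp_norm_op_triangle[OF d(1) y p] by simp
  moreover have "Lp_norm_op \<tau> p y \<le> Lp_norm_op \<tau> p (\<lambda>v. y v - x v) + Lp_norm_op \<tau> p x"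
    using Lp_norm_op_triangle[OF d(2) x p] by simp
  moreover have "Lp_norm_op \<tau> p (\<lambda>v. y v - x v) = Lp_norm_op \<tau> p (\<lambda>v. x v - y v)"
    using Lp_norm_op_minus[OF d(1), of p] by simp
  ultimately show ?thesis by linarith
qed

end

text \<open>Strict positivity of \<open>k\<close> matters for empty \<open>S\<close>: there
  \<open>Inf S\<close> is infinite, whereas \<open>ennreal 0 * \<infinity>\<close> is 0.\<close>

lemma ennreal_le_mult_Inf:
  fixes k :: real and i :: ennreal
  assumes "0 < k" "\<And>s. s \<in> S \<Longrightarrow> i \<le> ennreal k * s"
  shows "i \<le> ennreal k * Inf S"
proof -
  have inv: "ennreal (1 / k) * ennreal k = 1" "ennreal k * ennreal (1 / k) = 1"
    using assms(1) by (simp_all add: ennreal_mult[symmetric])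
  have "ennreal (1 / k) * i \<le> s" if "s \<in> S" for s
    using mult_left_mono[OF assms(2)[OF that], of "ennreal (1 / k)"] inv
    by (simp add: mult.assoc[symmetric])
  then have "ennreal k * (ennreal (1 / k) * i) \<le> ennreal k * Inf S"
    by (intro mult_left_mono Inf_greatest) auto
  then show ?thesis using inv by (simp add: mult.assoc[symmetric])
qed

section \<open>Passage to vectors of the completion\<close>

context symmetric_cp_map
begin

text \<open>The infimum in \<open>Lp_norm\<close> admits a number only as the limit of norms, so a
  bound for the norms of the images does not suffice; their convergence comes from
  \<open>Lp_norm_op_diff_le\<close>.\<close>

lemma Lp_norm_map_le_witness:
  fixes \<Lambda> :: "('a \<Rightarrow> 'a) \<Rightarrow> 'h::complex_hilbert"
  assumes Q: "L2_extension M \<Lambda> \<Phi> Q" and p: "1 \<le> p"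
    and X: "\<And>n. X n \<in> M" "(\<lambda>n. \<Lambda> (X n)) \<longlonglongrightarrow> \<xi>"
    and Cauchy: "\<And>e. e > 0 \<Longrightarrow> \<exists>k. \<forall>m\<ge>k. \<forall>n\<ge>k. Lp_norm_op \<tau> p (\<lambda>v. X m v - X n v) < e"
    and c: "(\<lambda>n. Lp_norm_op \<tau> p (X n)) \<longlonglongrightarrow> c"
  shows "\<exists>c' \<le> K * c. \<exists>Y. (\<forall>n. Y n \<in> M) \<and> (\<lambda>n. \<Lambda> (Y n)) \<longlonglongrightarrow> Q \<xi> \<and>
    (\<forall>e>0. \<exists>k. \<forall>m\<ge>k. \<forall>n\<ge>k. Lp_norm_op \<tau> p (\<lambda>v. Y m v - Y n v) < e) \<and>
    (\<lambda>n. Lp_norm_op \<tau> p (Y n)) \<longlonglongrightarrow> c'"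
proof -
  have bQ: "bounded_op Q" and Q\<Lambda>: "\<And>x. x \<in> M \<Longrightarrow> Q (\<Lambda> x) = \<Lambda> (\<Phi> x)"
    using Q by (auto simp: L2_extension_def)
  define Y where "Y n = \<Phi> (X n)" for n
  have Y: "Y n \<in> M" for n unfolding Y_def by (intro map_mem X)
  have "(\<lambda>n. Q (\<Lambda> (X n))) \<longlonglongrightarrow> Q \<xi>"
    by (rule bounded_linear.tendsto[OF bounded_op_bounded_linear[OF bQ] X(2)])
  then have lim: "(\<lambda>n. \<Lambda> (Y n)) \<longlonglongrightarrow> Q \<xi>" by (simp add: Q\<Lambda> X Y_def)
  have le: "Lp_norm_op \<tau> p (\<lambda>v. Y m v - Y n v) \<le> K * Lp_norm_op \<tau> p (\<lambda>v. X m v - X n v)" for m n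
    using Lp_norm_op_map_le[OF vna_diff[OF vna X(1)[of m] X(1)[of n]] p]
    by (simp add: map_diff X Y_def)
  have CY: "\<exists>k. \<forall>m\<ge>k. \<forall>n\<ge>k. Lp_norm_op \<tau> p (\<lambda>v. Y m v - Y n v) < e" if e: "e > 0" for e
  proof -
    \<comment> \<open>The denominator \<open>K + 1\<close> also covers \<open>K = 0\<close>.\<close>
    obtain k where k: "\<And>m n. k \<le> m \<Longrightarrow> k \<le> n \<Longrightarrow> Lp_norm_op \<tau> p (\<lambda>v. X m v - X n v) < e / (K + 1)"
      using Cauchy[of "e / (K + 1)"] e K_nonneg by auto
    have "Lp_norm_op \<tau> p (\<lambda>v. Y m v - Y n v) < e" if "k \<le> m" "k \<le> n" for m n
    proof -
      have "K * Lp_norm_op \<tau> p (\<lambda>v. X m v - X n v) \<le> K * (e / (K + 1))"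
        using k[OF that] K_nonneg by (intro mult_left_mono) auto
      also have "\<dots> < e" using e K_nonneg by (simp add: field_simps)
      finally show ?thesis using le[of m n] by linarith
    qed
    then show ?thesis by blast
  qed
  have "Cauchy (\<lambda>n. Lp_norm_op \<tau> p (Y n))"
  proof (rule metric_CauchyI)
    fix e :: real assume "e > 0"
    then obtain k where "\<forall>m\<ge>k. \<forall>n\<ge>k. Lp_norm_op \<tau> p (\<lambda>v. Y m v - Y n v) < e" using CY by blast
    then show "\<exists>k. \<forall>m\<ge>k. \<forall>n\<ge>k. dist (Lp_norm_op \<tau> p (Y m)) (Lp_norm_op \<tau> p (Y n)) < e"
      using Lp_norm_op_diff_le[OF Y Y p] unfolding dist_real_def by (meson order_le_less_trans)
  qed
  then obtain c' where c': "(\<lambda>n. Lp_norm_op \<tau> p (Y n)) \<longlonglongrightarrow> c'"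
    using Cauchy_convergent convergent_def by blast
  have "c' \<le> K * c"
    by (rule LIMSEQ_le[OF c' tendsto_mult_left[OF c]])
      (auto simp: Y_def intro!: Lp_norm_op_map_le X p)
  then show ?thesis using Y lim CY c' by blast
qed

lemma Lp_norm_map_le:
  fixes \<Lambda> :: "('a \<Rightarrow> 'a) \<Rightarrow> 'h::complex_hilbert"
  assumes L2: "is_L2 M \<tau> \<Lambda>" and Q: "L2_extension M \<Lambda> \<Phi> Q" and p: "1 \<le> p"
  shows "Lp_norm M \<tau> \<Lambda> p (Q \<xi>) \<le> ennreal K * Lp_norm M \<tau> \<Lambda> p \<xi>"
proof (cases "K = 0")
  case False
  then have K0: "K > 0" using K_nonneg by simp
  show ?thesis
  proof (cases "p = \<infinity>")
    case True
    show ?thesis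
      unfolding Lp_norm_def if_P[OF True]
    proof (rule ennreal_le_mult_Inf[OF K0])
      fix s assume "s \<in> {ennreal (onorm x) | x. x \<in> M \<and> \<Lambda> x = \<xi>}"
      then obtain x where x: "x \<in> M" "\<Lambda> x = \<xi>" "s = ennreal (onorm x)" by blast
      then have "\<Lambda> (\<Phi> x) = Q \<xi>" using Q by (auto simp: L2_extension_def)
      then have "ennreal (onorm (\<Phi> x)) \<in> {ennreal (onorm x) | x. x \<in> M \<and> \<Lambda> x = Q \<xi>}"
        using map_mem[OF x(1)] by (intro CollectI exI[of _ "\<Phi> x"]) simp
      then have "Inf {ennreal (onorm x) | x. x \<in> M \<and> \<Lambda> x = Q \<xi>} \<le> ennreal (onorm (\<Phi> x))"
        by (rule Inf_lower)
      also have "\<dots> \<le> ennreal K * s"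
        using onorm_map_le[OF x(1)] K_nonneg onorm_nonneg[OF mem_bounded[OF x(1)]]
        by (simp add: x(3) ennreal_mult[symmetric] ennreal_leI)
      finally show "Inf {ennreal (onorm x) | x. x \<in> M \<and> \<Lambda> x = Q \<xi>} \<le> ennreal K * s" .
    qed
  next
    case False
    define r where "r = enn2real p"
    have r: "1 \<le> r" using p False unfolding r_def
      by (metis enn2real_1 enn2real_mono ennreal_1 infinity_ennreal_def top.not_eq_extremum)
    show ?thesis
      unfolding Lp_norm_def if_not_P[OF False] r_def[symmetric]
    proof (rule ennreal_le_mult_Inf[OF K0], elim CollectE exE conjE)
      fix s c X assume s: "s = ennreal c" and X: "\<forall>n. X n \<in> M" "(\<lambda>n. \<Lambda> (X n)) \<longlonglongrightarrow> \<xi>"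
        "\<forall>e>0. \<exists>k. \<forall>m\<ge>k. \<forall>n\<ge>k. Lp_norm_op \<tau> r (\<lambda>v. X m v - X n v) < e"
        "(\<lambda>n. Lp_norm_op \<tau> r (X n)) \<longlonglongrightarrow> c"
      have c: "0 \<le> c" by (rule LIMSEQ_le_const[OF X(4)]) (auto intro: Lp_norm_op_nonneg)
      let ?S = "{ennreal c |c. \<exists>X. (\<forall>n. X n \<in> M) \<and> (\<lambda>n. \<Lambda> (X n)) \<longlonglongrightarrow> Q \<xi> \<and>
        (\<forall>e>0. \<exists>k. \<forall>m\<ge>k. \<forall>n\<ge>k. Lp_norm_op \<tau> r (\<lambda>v. X m v - X n v) < e) \<and>
        (\<lambda>n. Lp_norm_op \<tau> r (X n)) \<longlonglongrightarrow> c}"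
      obtain c' where "c' \<le> K * c" "ennreal c' \<in> ?S"
        using Lp_norm_map_le_witness[OF Q r _ X(2) _ X(4)] X(1,3) by blast
      then have "Inf ?S \<le> ennreal (K * c)"
        by (meson Inf_lower ennreal_leI order_trans)
      then show "Inf ?S \<le> ennreal K * s" using c K_nonneg by (simp add: s ennreal_mult)
    qed
  qed
next
  case True
  \<comment> \<open>For \<open>K = 0\<close> the right-hand side is 0 even where the norm of
    \<open>\<xi>\<close> is infinite, so \<open>Q\<close> has to vanish everywhere:
    \<open>\<Phi>\<close> is 0 on \<open>M\<close>, and the image of \<open>M\<close> is
    dense.\<close>
  have zero: "\<Phi> x = (\<lambda>v. 0)" if "x \<in> M" for x
  proof
    fix v
    have "norm (\<Phi> x v) \<le> onorm (\<Phi> x) * norm v"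
      by (rule bounded_op_onorm[OF mem_bounded[OF map_mem[OF that]]])
    also have "\<dots> \<le> 0" using onorm_map_le[OF that] by (simp add: True mult_nonpos_nonneg)
    finally show "\<Phi> x v = 0" by simp
  qed
  have \<Lambda>0: "\<Lambda> (\<lambda>v. 0) = 0"
  proof -
    have "\<forall>c. \<forall>T\<in>M. \<Lambda> (\<lambda>v. c *\<^sub>C T v) = c *\<^sub>C \<Lambda> T"
      using L2 by (simp add: is_L2_def linear_on_ops_def)
    from bspec[OF spec[OF this, of 0] vna_zero[OF vna]]
    have "\<Lambda> (\<lambda>v. 0 *\<^sub>C (0::'a)) = 0 *\<^sub>C \<Lambda> (\<lambda>v. 0)" .
    moreover have "0 *\<^sub>C \<Lambda> (\<lambda>v. 0) = 0" using scaleR_scaleC[of 0 "\<Lambda> (\<lambda>v. 0)"] by simp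
    ultimately show ?thesis by simp
  qed
  have bQ: "bounded_op Q" using Q by (simp add: L2_extension_def)
  have "closure (\<Lambda> ` M) \<subseteq> {\<xi>. Q \<xi> = 0}"
  proof (rule closure_minimal)
    show "\<Lambda> ` M \<subseteq> {\<xi>. Q \<xi> = 0}" using Q \<Lambda>0 zero by (auto simp: L2_extension_def)
    show "closed {\<xi>. Q \<xi> = 0}"
      by (intro closed_Collect_eq linear_continuous_on bounded_op_bounded_linear[OF bQ] continuous_on_const)
  qed
  then have Q0: "Q \<xi> = 0" using L2 by (auto simp: is_L2_def)
  have "Lp_norm M \<tau> \<Lambda> p 0 \<le> ennreal 0"
  proof (cases "p = \<infinity>")
    case True
    have "onorm (\<lambda>v::'a. 0::'a) = 0" by (simp add: onorm_zero)
    then show ?thesis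
      unfolding Lp_norm_def if_P[OF True] using vna_zero[OF vna] \<Lambda>0
      by (intro Inf_lower) (auto intro!: exI[of _ "\<lambda>v. 0"])
  next
    case False
    define r where "r = enn2real p"
    have r: "1 \<le> r" using p False unfolding r_def
      by (metis enn2real_1 enn2real_mono ennreal_1 infinity_ennreal_def top.not_eq_extremum)
    \<comment> \<open>As \<open>\<Phi> id\<close> is the zero operator, the contraction bound itself
      yields the norm of 0.\<close>
    have "Lp_norm_op \<tau> r (\<Phi> id) \<le> 0" using Lp_norm_op_map_le[OF vna_id[OF vna] r] by (simp add: True)
    then have "Lp_norm_op \<tau> r (\<lambda>v. 0) = 0"
      using Lp_norm_op_nonneg[of r "\<Phi> id"] zero[OF vna_id[OF vna]] by simp
    then show ?thesis
      unfolding Lp_norm_def if_not_P[OF False] r_def[symmetric] using vna_zero[OF vna] \<Lambda>0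
      by (intro Inf_lower CollectI exI[of _ "0::real"] exI[of _ "\<lambda>n v. 0"]) auto
  qed
  then show ?thesis unfolding Q0 by simp
qed

end

text \<open>Scaling to norm 1. If \<open>N \<xi> = 0\<close> the right-hand side is 0 even for an
  infinite operator norm, so definiteness of \<open>N\<close> and \<open>T 0 = 0\<close> are
  used.\<close>

lemma opnorm_on_bound:
  assumes N: "complex_norm_on V N" and T: "complex_linear T"
    and V: "\<And>c \<xi>. \<xi> \<in> V \<Longrightarrow> c *\<^sub>C \<xi> \<in> V" "\<And>\<xi>. \<xi> \<in> V \<Longrightarrow> T \<xi> \<in> V" and \<xi>: "\<xi> \<in> V"
  shows "ennreal (N (T \<xi>)) \<le> opnorm_on V N T * ennreal (N \<xi>)"
proof (cases "N \<xi> = 0")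
  case True
  then have "\<xi> = 0" using N \<xi> by (auto simp: complex_norm_on_def)
  moreover have "T 0 = 0" using T unfolding complex_linear_def by (metis add_cancel_right_right add_0)
  ultimately show ?thesis using True by simp
next
  case False
  then have n: "N \<xi> > 0" using N \<xi> by (force simp: complex_norm_on_def)
  define c where "c = complex_of_real (1 / N \<xi>)"
  have cmod: "cmod c = 1 / N \<xi>" using n unfolding c_def norm_of_real by simp
  have N\<eta>: "N (c *\<^sub>C \<xi>) = 1" and NT: "N (T (c *\<^sub>C \<xi>)) = N (T \<xi>) / N \<xi>"
  proof -
    have Nc: "N (c *\<^sub>C \<eta>) = cmod c * N \<eta>" if "\<eta> \<in> V" for \<eta>
      using N that by (simp add: complex_norm_on_def)
    have "T (c *\<^sub>C \<xi>) = c *\<^sub>C T \<xi>" using T by (simp add: complex_linear_def)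
    then show "N (c *\<^sub>C \<xi>) = 1" "N (T (c *\<^sub>C \<xi>)) = N (T \<xi>) / N \<xi>"
      using Nc[OF \<xi>] Nc[OF V(2)[OF \<xi>]] n by (simp_all add: cmod)
  qed
  have "ennreal (N (T \<xi>)) = ennreal (N (T (c *\<^sub>C \<xi>))) * ennreal (N \<xi>)"
    unfolding NT using n N V(2)[OF \<xi>] by (simp add: ennreal_mult[symmetric] complex_norm_on_def)
  also have "ennreal (N (T (c *\<^sub>C \<xi>))) \<le> opnorm_on V N T"
    unfolding opnorm_on_def by (rule SUP_upper) (use V \<xi> N\<eta> in auto)
  finally show ?thesis by (simp add: mult_right_mono)
qed

theorem proposition5p1:
  fixes M A :: "('a::complex_hilbert \<Rightarrow> 'a) set"
    and \<tau> :: "('a \<Rightarrow> 'a) \<Rightarrow> complex"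
    and l r :: "('a \<Rightarrow> 'a) \<Rightarrow> ('h::complex_hilbert \<Rightarrow> 'h)"
    and \<delta> :: "('a \<Rightarrow> 'a) \<Rightarrow> 'h"
    and N :: "'h \<Rightarrow> real"
    and P :: "('a \<Rightarrow> 'a) \<Rightarrow> ('a \<Rightarrow> 'a)"
    and Phat :: "'h \<Rightarrow> 'h"
  assumes "finite_von_neumann_algebra M \<tau>"
    and "first_order_differential_structure M A l r \<delta>"
    and "complex_norm_on (\<delta> ` A) N"
    and "quantum_channel M P"
    and "complex_linear Phat"
    and "intertwines A \<delta> P Phat"
  shows "(\<forall>x\<in>A. ennreal (N (\<delta> (P x))) \<le> opnorm_on (\<delta> ` A) N Phat * ennreal (N (\<delta> x))) \<and>
    (\<forall>(Mhat :: ('a \<Rightarrow> 'a) set) (\<tau>hat :: ('a \<Rightarrow> 'a) \<Rightarrow> complex)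
       (\<Lambda> :: ('a \<Rightarrow> 'a) \<Rightarrow> 'h) (\<Phi> :: ('a \<Rightarrow> 'a) \<Rightarrow> ('a \<Rightarrow> 'a)).
       finite_von_neumann_algebra Mhat \<tau>hat \<and>
       M \<subseteq> Mhat \<and> (\<forall>x\<in>M. \<tau>hat x = \<tau> x) \<and>
       is_L2 Mhat \<tau>hat \<Lambda> \<and>
       acts_by_multiplication M Mhat \<Lambda> l r \<and>
       completely_positive Mhat \<Phi> \<and> trace_symmetric Mhat \<tau>hat \<Phi> \<and>
       L2_extension Mhat \<Lambda> \<Phi> Phat \<longrightarrow>
       (\<forall>x\<in>A. \<forall>p::ennreal. 1 \<le> p \<longrightarrow>
          deriv_Lp_norm Mhat \<tau>hat \<Lambda> \<delta> p (P x)
            \<le> ennreal (onorm (\<Phi> id)) * deriv_Lp_norm Mhat \<tau>hat \<Lambda> \<delta> p x))"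
proof -
  have inter: "P x \<in> A" "\<delta> (P x) = Phat (\<delta> x)" if "x \<in> A" for x
    using assms(6) that by (auto simp: intertwines_def)
  have scale: "c *\<^sub>C \<xi> \<in> \<delta> ` A" if "\<xi> \<in> \<delta> ` A" for c \<xi>
  proof -
    obtain y where y: "y \<in> A" "\<xi> = \<delta> y" using \<open>\<xi> \<in> \<delta> ` A\<close> by blast
    have "weak_star_dense_subalgebra M A" "linear_on_ops A \<delta>"
      using assms(2) by (simp_all add: first_order_differential_structure_def)
    then have "(\<lambda>v. c *\<^sub>C y v) \<in> A" "\<delta> (\<lambda>v. c *\<^sub>C y v) = c *\<^sub>C \<xi>"
      using y by (simp_all add: weak_star_dense_subalgebra_def linear_on_ops_def)
    then show ?thesis by (metis imageI)
  qed
  have 1: "ennreal (N (\<delta> (P x))) \<le> opnorm_on (\<delta> ` A) N Phat * ennreal (N (\<delta> x))" if "x \<in> A" for x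
    unfolding inter(2)[OF that]
  proof (rule opnorm_on_bound[OF assms(3,5) scale])
    \<comment> \<open>Since \<open>P\<close> maps \<open>A\<close> into itself, \<open>Phat\<close>
      leaves the image of \<open>A\<close> under \<open>\<delta>\<close> invariant, as the operator
      norm on its completion presupposes.\<close>
    fix \<xi> assume "\<xi> \<in> \<delta> ` A"
    then obtain y where "y \<in> A" "\<xi> = \<delta> y" by blast
    then show "Phat \<xi> \<in> \<delta> ` A" using inter[of y] by (metis imageI)
  qed (use that in auto)
  have 2: "deriv_Lp_norm Mhat \<tau>hat \<Lambda> \<delta> p (P x)
      \<le> ennreal (onorm (\<Phi> id)) * deriv_Lp_norm Mhat \<tau>hat \<Lambda> \<delta> p x"
    if "finite_von_neumann_algebra Mhat \<tau>hat" "completely_positive Mhat \<Phi>"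
      "trace_symmetric Mhat \<tau>hat \<Phi>" "is_L2 Mhat \<tau>hat \<Lambda>" "L2_extension Mhat \<Lambda> \<Phi> Phat"
      "x \<in> A" "1 \<le> p"
    for Mhat :: "('a \<Rightarrow> 'a) set" and \<tau>hat and \<Lambda> :: "('a \<Rightarrow> 'a) \<Rightarrow> 'h" and \<Phi> x p
  proof -
    \<comment> \<open>With \<open>K\<close> equal to the norm of \<open>\<Phi> id\<close>, the bound
      for \<open>Phat\<close> is applied to the vector \<open>\<delta> x\<close>.\<close>
    interpret symmetric_cp_map Mhat \<tau>hat \<Phi> "onorm (\<Phi> id)"
      by unfold_locales (use that in auto)
    show ?thesis
      unfolding deriv_Lp_norm_def inter(2)[OF that(6)] by (rule Lp_norm_map_le[OF that(4,5,7)])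
  qed
  show ?thesis using 1 2 by blast
qed

end
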